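(* Let $f\in L^2(\Omega)$, let $u_h\in V_h$ be the solution of $a(u_h,v)=\int_\Omega fv\,dx$ for all $v\in V_h$, let $k\ge 1$ be an integer, and let $u_k\in V_k^{\rm ms}$ be the localized multiscale finite element solution, i.e. $a(u_k,v)=\int_\Omega fv\,dx$ for all $v\in V_k^{\rm ms}$. Let $C_*=2^{3/2}/\pi$. If $k$ is sufficiently large so that $$2q^k\sqrt{L}\,\sqrt{M}\,\sqrt{\beta}\le H^2,$$ then $$\|u_h-u_k\|_a\le (C_*+1)\,H\,\|f\|_{L^2(\Omega)}$$ and $$\|u_h-u_k\|_{L^2(\Omega)}\le [(C_*+1)H]^2\,\|f\|_{L^2(\Omega)}.$$
   Context: **Setting.** $\Omega=(0,1)\times(0,1)$. $\kappa\in L^\infty(\Omega)$ is piecewise constant with $\min\kappa=1$ and $\max\kappa=\beta$. $a(v,w)=\int_\Omega\kappa\nabla v\cdot\nabla w\,dx$ and $\|v\|_a=\sqrt{a(v,v)}$. $\mathcal T_H$ is the uniform partition of $\overline\Omega$ into $m=N^2$ closed squares $K_1,\dots,K_m$ of side $H=1/N$ ($N\ge2$); $\mathcal T_h$ is obtained by uniform refinement, each $K_i$ being divided into $r\times r$ equal squares of side $h=H/r$ ($r\ge2$). $V_h\subset H^1_0(\Omega)$ is the $Q_1$ (continuous, piecewise bilinear) finite element space on $\mathcal T_h$, and $\mathcal V_h$ is the set of interior vertices (nodes) of $\mathcal T_h$. $V_h(K_i)$ is the space of restrictions of functions of $V_h$ to $K_i$, $n_i=\dim V_h(K_i)$, and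 $a_i(v,w)=\int_{K_i}\kappa\nabla v\cdot\nabla w\,dx$, $s_i(v,w)=H^{-2}\int_{K_i}\kappa vw\,dx$. (For $v\in V_h$, $s_i(v,\cdot)$ means $s_i(v|_{K_i},\cdot)$.) **Auxiliary space.** Let $0\le\lambda_1^{(i)}\le\dots\le\lambda_{n_i}^{(i)}$ and the $s_i$-orthonormal basis $\psi_1^{(i)},\dots,\psi_{n_i}^{(i)}$ of $V_h(K_i)$ satisfy $a_i(\psi_j^{(i)},w)=\lambda_j^{(i)}s_i(\psi_j^{(i)},w)$ for all $w\in V_h(K_i)$. Let $\mu_i$ be the smallest positive eigenvalue of the same problem on $V_h(K_i)$ with $\kappa$ replaced by $1$. Choose $1\le L_i\le n_i$ such that $\lambda_j^{(i)}>\frac12\mu_i$ for all $j>L_i$. Put $L=\sum_{i=1}^mL_i$, $\Pi_{aux}^{(i)}v=\sum_{j=1}^{L_i}s_i(v,\psi_j^{(i)})\psi_j^{(i)}$, and $\mathrm{Ker}\,\Pi_{aux}=\{v\in V_h:\Pi_{aux}^{(i)}(v|_{K_i})=0,\ 1\le i\le m\}$. **Dual nodes (standing assumption).** For each $i$ there are chosen $L_i$ nodes $\hat p_1^{(i)},\dots,\hat p_{L_i}^{(i)}$ of $\mathcal T_h$ in the interior of $K_i$ such that the matrix $S_i=(s_i(\hat\phi_j^{(i)},\psi_k^{(i)}))_{1\le j,k\le L_i}$ is nonsingular, where $\hat\phi_j^{(i)}\in V_h$ is the hat function at $\hat p_j^{(i)}$ scaled so that $a(\hat\phi_j^{(i)},\hat\phi_j^{(i)})=1$.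 The dual nodes are separated: any element of $\mathcal T_h$ has at most one dual node as a vertex. $\mathcal N_{aux}$ is the set of all dual nodes and $V_h^d$ is the span of all $\hat\phi_j^{(i)}$. Let $\tilde\phi_j^{(i)}=\sum_{\ell=1}^{L_i}(S_i^{-1})_{j\ell}\hat\phi_\ell^{(i)}$, so $s_i(\tilde\phi_j^{(i)},\psi_k^{(i)})=\delta_{jk}$. $M_i$ is the matrix 2-norm of $(a(\tilde\phi_j^{(i)},\tilde\phi_\ell^{(i)}))_{1\le j,\ell\le L_i}$ and $M=\max_iM_i$. **Special basis of the kernel.** For $p\in\mathcal V_h\setminus\mathcal N_{aux}$ let $\phi_p\in V_h$ be the hat function at $p$ scaled so that $\|\phi_p\|_a=1$ and $\tilde\phi_p=\sum_{i=1}^m\sum_{j=1}^{L_i}s_i(\phi_p,\psi_j^{(i)})\tilde\phi_j^{(i)}$; the functions $\phi_p-\tilde\phi_p$ form a basis of $\mathrm{Ker}\,\Pi_{aux}$. They are replaced as follows ("orthogonal", "orthonormal" refer to $a(\cdot,\cdot)$). (1) For each $K_i$, Gram–Schmidt orthonormalize the $\phi_p-\tilde\phi_p$ for the non-dual nodes $p$ in the interior of $K_i$. (2) For each interior edge $E$ of $\mathcal T_H$ shared by two elements, take the $\phi_p-\tilde\phi_p$ for nodes $p$ in the interior of $E$, make each orthogonal to the functions from (1) for these two elements (by subtracting the orthogonal projection onto their span), then Gram–Schmidt orthonormalize the resulting functions. (3) For each interior vertex $p$ of $\mathcal T_H$, replace $\phi_p-\tilde\phi_p$ by a function of unit energy norm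 obtained by making it orthogonal to the functions from (1) for the four elements containing $p$ and the functions from (2) for the four edges containing $p$ (subtracting the orthogonal projection onto their span) and normalizing. Denote the resulting basis of $\mathrm{Ker}\,\Pi_{aux}$ by $\xi_1,\dots,\xi_\ell$, $\ell=\dim V_h-L$, and let $G=(a(\xi_s,\xi_t))_{1\le s,t\le\ell}$ (symmetric positive definite). Let $\mathfrak K=\lambda_{\max}(G)/\lambda_{\min}(G)$ and $q=(\sqrt{\mathfrak K}-1)/(\sqrt{\mathfrak K}+1)$. **Localized correction and space.** For each dual node, let $b\in\mathbb R^\ell$, $b_s=a(\hat\phi_j^{(i)},\xi_s)$, and let $\hat x$ be the result of $k$ iterations of the conjugate gradient algorithm (exact arithmetic) with initial guess $0$ for $Gx=b$, i.e. $\hat x$ minimizes $(G^{-1}b-x)^TG(G^{-1}b-x)$ over $x\in\mathrm{span}\{b,Gb,\dots,G^{k-1}b\}$. Put $\mathfrak C_{h,k}\hat\phi_j^{(i)}=\sum_s\hat x_s\xi_s$ and extend $\mathfrak C_{h,k}$ linearly to $V_h^d\to\mathrm{Ker}\,\Pi_{aux}$. $V_k^{\rm ms}$ is the span of all $\hat\phi_j^{(i)}-\mathfrak C_{h,k}\hat\phi_j^{(i)}$, $1\le i\le m$, $1\le j\le L_i$. *)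

theory Defs
  imports
    "HOL-Analysis.Analysis"
    "HOL-Library.Function_Algebras"
    "Jordan_Normal_Form.Char_Poly"
    "Jordan_Normal_Form.Gauss_Jordan_Elimination"
begin

type_synonym pt = "real \<times> real"
type_synonym fn = "pt \<Rightarrow> real"
type_synonym idx = "nat \<times> nat"

section \<open>Real functions on the plane as a vector space\<close>

definition fscale :: "real \<Rightarrow> fn \<Rightarrow> fn" (infixr \<open>*\<^sub>f\<close> 75)
  where "c *\<^sub>f v = (\<lambda>x. c * v x)"

interpretation fs: vector_space fscale
  by unfold_locales (auto simp: fscale_def algebra_simps fun_eq_iff)

section \<open>Domain, coefficient, bilinear forms\<close>

definition \<Omega> :: "pt set" where "\<Omega> = box (0,0) (1,1)"

text \<open>The pieces have positive measure and cover the domain up to a null set, so that minimum and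
  maximum over the pieces are the essential ones. The pieces need not be aligned with any mesh.\<close>

definition pw_const_coeff :: "fn \<Rightarrow> real \<Rightarrow> bool" where
  "pw_const_coeff \<kappa> \<beta> \<longleftrightarrow>
     (\<exists>P. finite P \<and> disjoint P \<and>
          (\<forall>D\<in>P. D \<subseteq> \<Omega> \<and> D \<in> sets lebesgue \<and> measure lebesgue D > 0 \<and> \<kappa> constant_on D) \<and>
          negligible (\<Omega> - \<Union>P) \<and>
          Min (\<kappa> ` \<Union>P) = 1 \<and> Max (\<kappa> ` \<Union>P) = \<beta>)"

text \<open>The classical partial derivatives; for continuous piecewise bilinear functions they exist
  almost everywhere and agree with the weak gradient.\<close>

definition grad :: "fn \<Rightarrow> pt \<Rightarrow> pt" where
  "grad v z = (deriv (\<lambda>t. v (t, snd z)) (fst z), deriv (\<lambda>t. v (fst z, t)) (snd z))"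

definition energy :: "fn \<Rightarrow> pt set \<Rightarrow> fn \<Rightarrow> fn \<Rightarrow> real" where
  "energy \<kappa> D v w = (LINT x:D|lebesgue. \<kappa> x * inner (grad v x) (grad w x))"

abbreviation a_form :: "fn \<Rightarrow> fn \<Rightarrow> fn \<Rightarrow> real" where
  "a_form \<kappa> \<equiv> energy \<kappa> \<Omega>"

definition form_norm :: "(fn \<Rightarrow> fn \<Rightarrow> real) \<Rightarrow> fn \<Rightarrow> real" where
  "form_norm a v = sqrt (a v v)"

definition L2 :: "fn set" where
  "L2 = {f. set_borel_measurable lebesgue \<Omega> f \<and> set_integrable lebesgue \<Omega> (\<lambda>x. (f x)\<^sup>2)}"

definition L2_prod :: "fn \<Rightarrow> fn \<Rightarrow> real" where
  "L2_prod f v = (LINT x:\<Omega>|lebesgue. f x * v x)"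

definition L2_norm :: "fn \<Rightarrow> real" where
  "L2_norm f = sqrt (L2_prod f f)"

section \<open>Meshes and finite element spaces\<close>

definition cell :: "real \<Rightarrow> idx \<Rightarrow> pt set" where
  "cell d i = cbox (real (fst i) * d, real (snd i) * d)
                   (real (Suc (fst i)) * d, real (Suc (snd i)) * d)"

definition elems :: "nat \<Rightarrow> idx set" where
  "elems n = {..<n} \<times> {..<n}"

text \<open>The four vertices of an element of the fine mesh, in the node numbering used by
  \<open>node_pt\<close> below.\<close>

definition cell_vertices :: "idx \<Rightarrow> idx set" where
  "cell_vertices e = {fst e, Suc (fst e)} \<times> {snd e, Suc (snd e)}"

definition K :: "nat \<Rightarrow> idx \<Rightarrow> pt set" where
  "K N i = cell (1 / real N) i"

definition mesh_h :: "nat \<Rightarrow> nat \<Rightarrow> real" where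
  "mesh_h N r = 1 / (real N * real r)"

definition nodes :: "nat \<Rightarrow> nat \<Rightarrow> idx set" where
  "nodes N r = {1..<N * r} \<times> {1..<N * r}"

definition node_pt :: "nat \<Rightarrow> nat \<Rightarrow> idx \<Rightarrow> pt" where
  "node_pt N r p = (real (fst p) * mesh_h N r, real (snd p) * mesh_h N r)"

definition bilinear_on :: "pt set \<Rightarrow> fn \<Rightarrow> bool" where
  "bilinear_on T v \<longleftrightarrow>
     (\<exists>c0 c1 c2 c3. \<forall>(x, y)\<in>T. v (x, y) = c0 + c1 * x + c2 * y + c3 * x * y)"

text \<open>Finite element functions are extended by zero outside the domain, and restrictions to a
  coarse element by zero outside that element, so that each is a single function on the plane.\<close>

definition Vh :: "nat \<Rightarrow> nat \<Rightarrow> fn set" where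
  "Vh N r = {v. continuous_on (closure \<Omega>) v \<and>
                (\<forall>e\<in>elems (N * r). bilinear_on (cell (mesh_h N r) e) v) \<and>
                (\<forall>x. x \<notin> \<Omega> \<longrightarrow> v x = 0)}"

definition VhK :: "nat \<Rightarrow> nat \<Rightarrow> idx \<Rightarrow> fn set" where
  "VhK N r i = (\<lambda>v x. if x \<in> K N i then v x else 0) ` Vh N r"

definition hat :: "nat \<Rightarrow> nat \<Rightarrow> idx \<Rightarrow> fn" where
  "hat N r p = (\<lambda>(x, y). max 0 (1 - \<bar>x - fst (node_pt N r p)\<bar> / mesh_h N r) *
                        max 0 (1 - \<bar>y - snd (node_pt N r p)\<bar> / mesh_h N r))"

definition unit_energy :: "(fn \<Rightarrow> fn \<Rightarrow> real) \<Rightarrow> fn \<Rightarrow> fn" where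
  "unit_energy a v = (1 / form_norm a v) *\<^sub>f v"

definition phi :: "nat \<Rightarrow> nat \<Rightarrow> fn \<Rightarrow> idx \<Rightarrow> fn" where
  "phi N r \<kappa> p = unit_energy (a_form \<kappa>) (hat N r p)"

section \<open>Local eigenproblems\<close>

definition s_form :: "nat \<Rightarrow> fn \<Rightarrow> idx \<Rightarrow> fn \<Rightarrow> fn \<Rightarrow> real" where
  "s_form N \<kappa> i v w = (real N)\<^sup>2 * (LINT x:K N i|lebesgue. \<kappa> x * v x * w x)"

definition eigenpair :: "nat \<Rightarrow> nat \<Rightarrow> fn \<Rightarrow> idx \<Rightarrow> real \<Rightarrow> fn \<Rightarrow> bool" where
  "eigenpair N r \<kappa> i l v \<longleftrightarrow> v \<in> VhK N r i \<and> v \<noteq> 0 \<and>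
     (\<forall>w\<in>VhK N r i. energy \<kappa> (K N i) v w = l * s_form N \<kappa> i v w)"

definition local_dim :: "nat \<Rightarrow> nat \<Rightarrow> idx \<Rightarrow> nat" where
  "local_dim N r i = fs.dim (VhK N r i)"

text \<open>Eigenvalues and eigenfunctions on a coarse element are numbered from 0.\<close>

definition eigenbasis :: "nat \<Rightarrow> nat \<Rightarrow> fn \<Rightarrow> idx \<Rightarrow> (nat \<Rightarrow> real) \<Rightarrow> (nat \<Rightarrow> fn) \<Rightarrow> bool" where
  "eigenbasis N r \<kappa> i lam \<psi> \<longleftrightarrow>
     (\<forall>j<local_dim N r i. 0 \<le> lam j \<and> eigenpair N r \<kappa> i (lam j) (\<psi> j)) \<and>
     mono_on {..<local_dim N r i} lam \<and>
     (\<forall>j<local_dim N r i. \<forall>l<local_dim N r i.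
        s_form N \<kappa> i (\<psi> j) (\<psi> l) = (if j = l then 1 else 0)) \<and>
     fs.span (\<psi> ` {..<local_dim N r i}) = VhK N r i"

definition smallest_pos_eigenvalue :: "nat \<Rightarrow> nat \<Rightarrow> idx \<Rightarrow> real \<Rightarrow> bool" where
  "smallest_pos_eigenvalue N r i \<mu> \<longleftrightarrow>
     0 < \<mu> \<and> (\<exists>v. eigenpair N r (\<lambda>_. 1) i \<mu> v) \<and>
     (\<forall>l v. 0 < l \<and> eigenpair N r (\<lambda>_. 1) i l v \<longrightarrow> \<mu> \<le> l)"

section \<open>Dual nodes\<close>

definition mat_norm2 :: "real mat \<Rightarrow> real" where
  "mat_norm2 A = Sup {sqrt (scalar_prod (A *\<^sub>v x) (A *\<^sub>v x)) | x.
                       x \<in> carrier_vec (dim_col A) \<and> scalar_prod x x = 1}"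

definition mat_inv :: "real mat \<Rightarrow> real mat" where
  "mat_inv A = the (mat_inverse A)"

definition phi_dual :: "nat \<Rightarrow> nat \<Rightarrow> fn \<Rightarrow> (idx \<Rightarrow> nat \<Rightarrow> idx) \<Rightarrow> idx \<Rightarrow> nat \<Rightarrow> fn" where
  "phi_dual N r \<kappa> dn i j = phi N r \<kappa> (dn i j)"

definition S_mat :: "nat \<Rightarrow> nat \<Rightarrow> fn \<Rightarrow> (idx \<Rightarrow> nat) \<Rightarrow> (idx \<Rightarrow> nat \<Rightarrow> fn) \<Rightarrow>
    (idx \<Rightarrow> nat \<Rightarrow> idx) \<Rightarrow> idx \<Rightarrow> real mat" where
  "S_mat N r \<kappa> L \<psi> dn i =
     mat (L i) (L i) (\<lambda>(j, k). s_form N \<kappa> i (phi_dual N r \<kappa> dn i j) (\<psi> i k))"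

definition N_aux :: "nat \<Rightarrow> (idx \<Rightarrow> nat) \<Rightarrow> (idx \<Rightarrow> nat \<Rightarrow> idx) \<Rightarrow> idx set" where
  "N_aux N L dn = {dn i j | i j. i \<in> elems N \<and> j < L i}"

definition dual_nodes :: "nat \<Rightarrow> nat \<Rightarrow> fn \<Rightarrow> (idx \<Rightarrow> nat) \<Rightarrow> (idx \<Rightarrow> nat \<Rightarrow> fn) \<Rightarrow>
    (idx \<Rightarrow> nat \<Rightarrow> idx) \<Rightarrow> bool" where
  "dual_nodes N r \<kappa> L \<psi> dn \<longleftrightarrow>
     (\<forall>i\<in>elems N. \<forall>j<L i. dn i j \<in> nodes N r \<and> node_pt N r (dn i j) \<in> interior (K N i)) \<and>
     (\<forall>i\<in>elems N. invertible_mat (S_mat N r \<kappa> L \<psi> dn i)) \<and>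
     (\<forall>e\<in>elems (N * r). \<forall>p\<in>N_aux N L dn \<inter> cell_vertices e.
        \<forall>q\<in>N_aux N L dn \<inter> cell_vertices e. p = q)"

definition phi_tilde :: "nat \<Rightarrow> nat \<Rightarrow> fn \<Rightarrow> (idx \<Rightarrow> nat) \<Rightarrow> (idx \<Rightarrow> nat \<Rightarrow> fn) \<Rightarrow>
    (idx \<Rightarrow> nat \<Rightarrow> idx) \<Rightarrow> idx \<Rightarrow> nat \<Rightarrow> fn" where
  "phi_tilde N r \<kappa> L \<psi> dn i j =
     (\<Sum>l<L i. (mat_inv (S_mat N r \<kappa> L \<psi> dn i) $$ (j, l)) *\<^sub>f phi_dual N r \<kappa> dn i l)"

definition M_const :: "nat \<Rightarrow> nat \<Rightarrow> fn \<Rightarrow> (idx \<Rightarrow> nat) \<Rightarrow> (idx \<Rightarrow> nat \<Rightarrow> fn) \<Rightarrow>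
    (idx \<Rightarrow> nat \<Rightarrow> idx) \<Rightarrow> real" where
  "M_const N r \<kappa> L \<psi> dn =
     Max ((\<lambda>i. mat_norm2 (mat (L i) (L i) (\<lambda>(j, l).
            a_form \<kappa> (phi_tilde N r \<kappa> L \<psi> dn i j) (phi_tilde N r \<kappa> L \<psi> dn i l)))) ` elems N)"

section \<open>The special basis of the kernel\<close>

definition proj :: "(fn \<Rightarrow> fn \<Rightarrow> real) \<Rightarrow> fn set \<Rightarrow> fn \<Rightarrow> fn" where
  "proj a S v = (THE w. w \<in> fs.span S \<and> (\<forall>z\<in>fs.span S. a (v - w) z = 0))"

definition gram_schmidt_fn :: "(fn \<Rightarrow> fn \<Rightarrow> real) \<Rightarrow> fn list \<Rightarrow> fn list" where
  "gram_schmidt_fn a vs =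
     foldl (\<lambda>es v. es @ [unit_energy a (v - (\<Sum>e\<leftarrow>es. a v e *\<^sub>f e))]) [] vs"

definition ker_fn :: "nat \<Rightarrow> nat \<Rightarrow> fn \<Rightarrow> (idx \<Rightarrow> nat) \<Rightarrow> (idx \<Rightarrow> nat \<Rightarrow> fn) \<Rightarrow>
    (idx \<Rightarrow> nat \<Rightarrow> idx) \<Rightarrow> idx \<Rightarrow> fn" where
  "ker_fn N r \<kappa> L \<psi> dn p =
     phi N r \<kappa> p -
     (\<Sum>i\<in>elems N. \<Sum>j<L i. s_form N \<kappa> i (phi N r \<kappa> p) (\<psi> i j) *\<^sub>f phi_tilde N r \<kappa> L \<psi> dn i j)"

text \<open>In the following, \<open>ns\<close> is an enumeration of the non-dual nodes. It serves only to fix, inside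
  each coarse element and each coarse edge, the order in which Gram-Schmidt is carried out.\<close>

definition xi_elem :: "nat \<Rightarrow> nat \<Rightarrow> fn \<Rightarrow> (idx \<Rightarrow> nat) \<Rightarrow> (idx \<Rightarrow> nat \<Rightarrow> fn) \<Rightarrow>
    (idx \<Rightarrow> nat \<Rightarrow> idx) \<Rightarrow> idx list \<Rightarrow> idx \<Rightarrow> fn set" where
  "xi_elem N r \<kappa> L \<psi> dn ns i =
     set (gram_schmidt_fn (a_form \<kappa>)
       (map (ker_fn N r \<kappa> L \<psi> dn) (filter (\<lambda>p. node_pt N r p \<in> interior (K N i)) ns)))"

definition coarse_edges :: "nat \<Rightarrow> pt set set" where
  "coarse_edges N = {K N i \<inter> K N i' | i i'. i \<in> elems N \<and> i' \<in> elems N \<and>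
                       (i' = (Suc (fst i), snd i) \<or> i' = (fst i, Suc (snd i)))}"

definition coarse_vertices :: "nat \<Rightarrow> pt set" where
  "coarse_vertices N = {(real b / real N, real c / real N) | b c. b \<in> {1..<N} \<and> c \<in> {1..<N}}"

definition xi_edge :: "nat \<Rightarrow> nat \<Rightarrow> fn \<Rightarrow> (idx \<Rightarrow> nat) \<Rightarrow> (idx \<Rightarrow> nat \<Rightarrow> fn) \<Rightarrow>
    (idx \<Rightarrow> nat \<Rightarrow> idx) \<Rightarrow> idx list \<Rightarrow> pt set \<Rightarrow> fn set" where
  "xi_edge N r \<kappa> L \<psi> dn ns E =
     (let S = \<Union>i\<in>{i\<in>elems N. E \<subseteq> K N i}. xi_elem N r \<kappa> L \<psi> dn ns i;
          v = ker_fn N r \<kappa> L \<psi> dn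
      in set (gram_schmidt_fn (a_form \<kappa>)
           (map (\<lambda>p. v p - proj (a_form \<kappa>) S (v p))
             (filter (\<lambda>p. node_pt N r p \<in> rel_interior E) ns))))"

definition xi_vertex :: "nat \<Rightarrow> nat \<Rightarrow> fn \<Rightarrow> (idx \<Rightarrow> nat) \<Rightarrow> (idx \<Rightarrow> nat \<Rightarrow> fn) \<Rightarrow>
    (idx \<Rightarrow> nat \<Rightarrow> idx) \<Rightarrow> idx list \<Rightarrow> idx \<Rightarrow> fn" where
  "xi_vertex N r \<kappa> L \<psi> dn ns p =
     (let S = (\<Union>i\<in>{i\<in>elems N. node_pt N r p \<in> K N i}. xi_elem N r \<kappa> L \<psi> dn ns i) \<union>
              (\<Union>E\<in>{E\<in>coarse_edges N. node_pt N r p \<in> E}. xi_edge N r \<kappa> L \<psi> dn ns E);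
          v = ker_fn N r \<kappa> L \<psi> dn p
      in unit_energy (a_form \<kappa>) (v - proj (a_form \<kappa>) S v))"

definition kernel_basis :: "nat \<Rightarrow> nat \<Rightarrow> fn \<Rightarrow> (idx \<Rightarrow> nat) \<Rightarrow> (idx \<Rightarrow> nat \<Rightarrow> fn) \<Rightarrow>
    (idx \<Rightarrow> nat \<Rightarrow> idx) \<Rightarrow> idx list \<Rightarrow> fn set" where
  "kernel_basis N r \<kappa> L \<psi> dn ns =
     (\<Union>i\<in>elems N. xi_elem N r \<kappa> L \<psi> dn ns i) \<union>
     (\<Union>E\<in>coarse_edges N. xi_edge N r \<kappa> L \<psi> dn ns E) \<union>
     xi_vertex N r \<kappa> L \<psi> dn ns ` {p \<in> nodes N r. node_pt N r p \<in> coarse_vertices N}"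

section \<open>Localized correction and multiscale space\<close>

definition gram :: "fn \<Rightarrow> fn list \<Rightarrow> real mat" where
  "gram \<kappa> xs = mat (length xs) (length xs) (\<lambda>(s, t). a_form \<kappa> (xs ! s) (xs ! t))"

definition cond_num :: "real mat \<Rightarrow> real" where
  "cond_num G = Max {l. eigenvalue G l} / Min {l. eigenvalue G l}"

definition cg_rate :: "real mat \<Rightarrow> real" where
  "cg_rate G = (sqrt (cond_num G) - 1) / (sqrt (cond_num G) + 1)"

definition krylov :: "real mat \<Rightarrow> real vec \<Rightarrow> nat \<Rightarrow> real vec set" where
  "krylov G b k = {vec (dim_vec b) (\<lambda>s. \<Sum>j<k. c j * (((G ^\<^sub>m j) *\<^sub>v b) $ s)) | c. True}"

definition cg_error :: "real mat \<Rightarrow> real vec \<Rightarrow> real vec \<Rightarrow> real" where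
  "cg_error G b x = (let e = mat_inv G *\<^sub>v b - x in scalar_prod e (G *\<^sub>v e))"

definition cg :: "real mat \<Rightarrow> real vec \<Rightarrow> nat \<Rightarrow> real vec" where
  "cg G b k = (ARG_MIN (cg_error G b) x. x \<in> krylov G b k)"

definition correction :: "fn \<Rightarrow> fn list \<Rightarrow> nat \<Rightarrow> fn \<Rightarrow> fn" where
  "correction \<kappa> xs k v =
     (let x = cg (gram \<kappa> xs) (vec (length xs) (\<lambda>s. a_form \<kappa> v (xs ! s))) k
      in \<Sum>s<length xs. (x $ s) *\<^sub>f (xs ! s))"

definition V_ms :: "nat \<Rightarrow> nat \<Rightarrow> fn \<Rightarrow> (idx \<Rightarrow> nat) \<Rightarrow> (idx \<Rightarrow> nat \<Rightarrow> idx) \<Rightarrow>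
    fn list \<Rightarrow> nat \<Rightarrow> fn set" where
  "V_ms N r \<kappa> L dn xs k =
     fs.span {phi_dual N r \<kappa> dn i j - correction \<kappa> xs k (phi_dual N r \<kappa> dn i j) | i j.
                i \<in> elems N \<and> j < L i}"

definition galerkin_solution :: "fn \<Rightarrow> fn \<Rightarrow> fn set \<Rightarrow> fn \<Rightarrow> bool" where
  "galerkin_solution \<kappa> f V u \<longleftrightarrow> u \<in> V \<and> (\<forall>v\<in>V. a_form \<kappa> u v = L2_prod f v)"

end

(*
Idea. Let W be the span of the xi's. It is the kernel of the auxiliary projection, and V_h = V_h^d + W.
With u = u_h, split u - u_k by best approximation against w in V_k^ms:

- z = (a-orthogonal projection of u onto the complement of W) is the ideal multiscale solution, and
  |u - z|_a <= C H |f| because |w|_{L2} <= C H |w|_a on W: there only eigenvalues above mu_i / 2 occur, and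
  mu_i >= pi^2 / 4 by a Poincare inequality with a Dirichlet condition on one side of the square, or
  with mean zero.

- w replaces the exact correction in z by the conjugate gradient one. In function space the Gram matrix
  acts as the operator v |-> sum_s a(v, xi_s) xi_s on W, and the factor 2 q^k comes from Chebyshev
  polynomials through the Pell identity T_k^2 + (1 - X^2) U_{k-1}^2 = 1, which needs only the spectral
  bounds and no diagonalization. The hat functions of the dual nodes are orthonormal, which turns
  the l1-norm of the coefficients into sqrt L times an energy norm; that energy is at most
  M H^{-2} beta |u|_{L2}^2 by Bessel's inequality for the local eigenfunctions.

That the xi's are linearly independent follows by counting: they span W and there are at most as many as
there are non-dual nodes, while the functions phi_p - phi~_p are independent by evaluation at the nodes.
*)
theory Submission
  imports Defs
begin


section \<open>Semi-inner products on a subspace\<close>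

text \<open>Two obstacles shape the proof. The integral forms are bilinear only on mesh-wise
  bilinear functions, since non-integrable integrands and derivatives at kinks get conventional
  values; so every form lives on a carrier set. The coefficient need not follow the mesh, so its
  integrals have no closed form; exact cell formulas are computed for coefficient 1, and weighted
  forms are compared with them through 1 <= kappa <= beta almost everywhere. Constants: the
  threshold \<open>\<mu> i / 2\<close> and the bound pi^2 / 4 give pi^2 / 8, and sqrt 8 / pi is
  2^(3/2) / pi. On a square at the boundary the functions may vanish on one side only, which admits
  a quarter wave, of frequency pi / 2 per side length; this is the worse case. The added 1 is the
  localization error: \<open>s_form\<close> contributes N = 1/H, which turns the assumed H^2 into H,
  and |u|_{L2} <= |f|_{L2} has constant one because 4 / pi^2 <= 1. The smallness condition does not
  involve f, so the energy estimate applies again to the dual problem with the error as right-hand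
  side, and this squares the factor.\<close>

locale semi_inner = vector_space scale
  for scale :: "real \<Rightarrow> 'v::ab_group_add \<Rightarrow> 'v" (infixr \<open>*s*\<close> 75) +
  fixes V :: "'v set" and B :: "'v \<Rightarrow> 'v \<Rightarrow> real"
  assumes subspace_V: "subspace V"
    and B_add_left: "\<lbrakk>x \<in> V; y \<in> V; z \<in> V\<rbrakk> \<Longrightarrow> B (x + y) z = B x z + B y z"
    and B_scale_left: "\<lbrakk>x \<in> V; z \<in> V\<rbrakk> \<Longrightarrow> B (c *s* x) z = c * B x z"
    and B_sym: "\<lbrakk>x \<in> V; y \<in> V\<rbrakk> \<Longrightarrow> B x y = B y x"
    and B_nonneg: "x \<in> V \<Longrightarrow> 0 \<le> B x x"
begin

lemma V_add [intro, simp]: "\<lbrakk>x \<in> V; y \<in> V\<rbrakk> \<Longrightarrow> x + y \<in> V"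
  and V_diff [intro, simp]: "\<lbrakk>x \<in> V; y \<in> V\<rbrakk> \<Longrightarrow> x - y \<in> V"
  and V_scale [intro, simp]: "x \<in> V \<Longrightarrow> c *s* x \<in> V"
  and V_zero [intro, simp]: "0 \<in> V"
  using subspace_V by (auto simp: subspace_add subspace_diff subspace_scale subspace_0)

lemma V_sum [intro, simp]: "(\<And>i. i \<in> I \<Longrightarrow> f i \<in> V) \<Longrightarrow> sum f I \<in> V"
  using subspace_V by (rule subspace_sum)

lemma V_span: "S \<subseteq> V \<Longrightarrow> span S \<subseteq> V"
  using span_minimal subspace_V by blast

lemma B_add_right: "\<lbrakk>x \<in> V; y \<in> V; z \<in> V\<rbrakk> \<Longrightarrow> B z (x + y) = B z x + B z y"
  by (metis B_add_left B_sym V_add)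

lemma B_scale_right: "\<lbrakk>x \<in> V; z \<in> V\<rbrakk> \<Longrightarrow> B z (c *s* x) = c * B z x"
  by (metis B_scale_left B_sym V_scale)

lemma B_zero_left: "z \<in> V \<Longrightarrow> B 0 z = 0"
  using B_scale_left[of 0 z 0] by simp

lemma B_zero_right: "z \<in> V \<Longrightarrow> B z 0 = 0"
  using B_scale_right[of 0 z 0] by simp

lemma B_diff_left: "\<lbrakk>x \<in> V; y \<in> V; z \<in> V\<rbrakk> \<Longrightarrow> B (x - y) z = B x z - B y z"
  using B_add_left[of "x - y" y z] by simp

lemma B_diff_right: "\<lbrakk>x \<in> V; y \<in> V; z \<in> V\<rbrakk> \<Longrightarrow> B z (x - y) = B z x - B z y"
  using B_add_right[of "x - y" y z] by simp

lemmas B_simps = B_add_left B_add_right B_diff_left B_diff_right B_scale_left B_scale_right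
  B_zero_left B_zero_right

lemma B_sum_left: "\<lbrakk>\<And>i. i \<in> I \<Longrightarrow> f i \<in> V; z \<in> V\<rbrakk> \<Longrightarrow> B (sum f I) z = (\<Sum>i\<in>I. B (f i) z)"
  by (induction I rule: infinite_finite_induct) (auto simp: B_simps)

lemma B_sum_right: "\<lbrakk>\<And>i. i \<in> I \<Longrightarrow> f i \<in> V; z \<in> V\<rbrakk> \<Longrightarrow> B z (sum f I) = (\<Sum>i\<in>I. B z (f i))"
  by (induction I rule: infinite_finite_induct) (auto simp: B_simps)

lemma cauchy_schwarz:
  assumes x: "x \<in> V" and y: "y \<in> V"
  shows "(B x y)\<^sup>2 \<le> B x x * B y y"
proof -
  have q: "0 \<le> B x x + 2 * t * B x y + t\<^sup>2 * B y y" for t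
  proof -
    have "0 \<le> B (x + t *s* y) (x + t *s* y)" using assms by (intro B_nonneg) auto
    also have "\<dots> = B x x + 2 * t * B x y + t\<^sup>2 * B y y"
      using assms by (simp add: B_simps B_sym[OF y x] power2_eq_square algebra_simps)
    finally show ?thesis .
  qed
  show ?thesis
  proof (cases "B y y = 0")
    case True
    have "B x y = 0"
    proof (rule ccontr)
      assume "B x y \<noteq> 0"
      \<comment> \<open>With \<open>B y y = 0\<close> the quadratic degenerates to an affine
        function of \<open>t\<close>, and at this \<open>t\<close> it would have the value
        -1.\<close>
      then show False using q[of "- (B x x + 1) / (2 * B x y)"] True by (simp add: field_simps)
    qed
    then show ?thesis using B_nonneg[OF x] B_nonneg[OF y] by simp
  next
    case False
    then have p: "0 < B y y" using B_nonneg[OF y] by simp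
    have "0 \<le> (B x x + 2 * (- B x y / B y y) * B x y + (- B x y / B y y)\<^sup>2 * B y y) * B y y"
      using q[of "- B x y / B y y"] p by simp
    also have "\<dots> = B x x * B y y - (B x y)\<^sup>2"
      using p by (simp add: field_simps power2_eq_square)
    finally show ?thesis by simp
  qed
qed

lemma cauchy_schwarz_sqrt:
  assumes "x \<in> V" "y \<in> V"
  shows "\<bar>B x y\<bar> \<le> sqrt (B x x) * sqrt (B y y)"
  using real_sqrt_le_mono[OF cauchy_schwarz[OF assms]] by (simp add: real_sqrt_mult)

lemma triangle:
  assumes x: "x \<in> V" and y: "y \<in> V"
  shows "sqrt (B (x + y) (x + y)) \<le> sqrt (B x x) + sqrt (B y y)"
proof (rule real_le_lsqrt)
  have "B (x + y) (x + y) = B x x + 2 * B x y + B y y"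
    using assms by (simp add: B_simps B_sym[OF y x])
  also have "\<dots> \<le> B x x + 2 * (sqrt (B x x) * sqrt (B y y)) + B y y"
    using cauchy_schwarz_sqrt[OF assms] by simp
  also have "\<dots> = (sqrt (B x x) + sqrt (B y y))\<^sup>2"
    using assms by (simp add: power2_sum B_nonneg)
  finally show "B (x + y) (x + y) \<le> (sqrt (B x x) + sqrt (B y y))\<^sup>2" .
qed (use assms B_nonneg in auto)

lemma norm_scale: "x \<in> V \<Longrightarrow> sqrt (B (c *s* x) (c *s* x)) = \<bar>c\<bar> * sqrt (B x x)"
  by (simp add: B_simps real_sqrt_mult flip: mult.assoc)

lemma triangle_sum:
  assumes "\<And>i. i \<in> I \<Longrightarrow> f i \<in> V"
  shows "sqrt (B (sum f I) (sum f I)) \<le> (\<Sum>i\<in>I. sqrt (B (f i) (f i)))"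
  using assms
proof (induction I rule: infinite_finite_induct)
  case (insert i I)
  then show ?case using triangle[of "f i" "sum f I"] by fastforce
qed (auto simp: B_simps)

text \<open>Pythagoras. It serves twice: as Cea's lemma for the Galerkin solution in the multiscale
  space, and to show that an energy projection minimizes the conjugate gradient functional.\<close>

lemma best_approximation:
  assumes u: "u \<in> V" and U: "subspace U" "U \<subseteq> V" and w: "w \<in> U" "z \<in> U"
    and orth: "\<And>z. z \<in> U \<Longrightarrow> B (u - w) z = 0"
  shows "B (u - w) (u - w) \<le> B (u - z) (u - z)"
proof -
  have mem: "w \<in> V" "z \<in> V" using U w by auto
  have "w - z \<in> U" using subspace_diff[OF U(1) w] .
  then have o: "B (u - w) (w - z) = 0" by (rule orth)
  have "B (u - z) (u - z) = B ((u - w) + (w - z)) ((u - w) + (w - z))" by simp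
  also have "\<dots> = B (u - w) (u - w) + 2 * B (u - w) (w - z) + B (w - z) (w - z)"
    using mem u B_sym[of "w - z" "u - w"] by (simp only: B_add_left B_add_right V_diff V_add)
  also have "\<dots> \<ge> B (u - w) (u - w)" using o mem B_nonneg[of "w - z"] by simp
  finally show ?thesis .
qed

end

section \<open>Finite dimension: orthonormal bases, Riesz representation, extremal eigenvectors\<close>

locale fin_inner = semi_inner +
  fixes S :: "'a set"
  assumes finite_S: "finite S" and S_span: "span S = V"
    and definite: "\<lbrakk>x \<in> V; B x x = 0\<rbrakk> \<Longrightarrow> x = 0"
begin

lemma B_pos: "\<lbrakk>x \<in> V; x \<noteq> 0\<rbrakk> \<Longrightarrow> 0 < B x x"
  using B_nonneg definite by (metis order_le_less)

definition onb :: "'a set \<Rightarrow> bool" where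
  "onb E \<longleftrightarrow> finite E \<and> E \<subseteq> V \<and> (\<forall>e\<in>E. \<forall>e'\<in>E. B e e' = (if e = e' then 1 else 0))"

lemma onb_coeff:
  assumes "onb E" "x \<in> span E"
  shows "x = (\<Sum>e\<in>E. B x e *s* e)"
proof -
  have E: "finite E" "E \<subseteq> V" "\<And>e e'. e \<in> E \<Longrightarrow> e' \<in> E \<Longrightarrow> B e e' = (if e = e' then 1 else 0)"
    using assms(1) by (auto simp: onb_def)
  obtain c where c: "x = (\<Sum>e\<in>E. c e *s* e)" using assms(2) span_finite[OF E(1)] by auto
  have "B x e = c e" if e: "e \<in> E" for e
  proof -
    have "B x e = (\<Sum>e'\<in>E. B (c e' *s* e') e)"
      unfolding c using E(2) e by (intro B_sum_left) auto
    also have "\<dots> = (\<Sum>e'\<in>E. if e' = e then c e' else 0)"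
      using E(2) e by (intro sum.cong) (auto simp: B_simps E(3) subset_iff)
    also have "\<dots> = c e" using e E(1) by simp
    finally show ?thesis .
  qed
  then show ?thesis using c by simp
qed

lemma onb_exists:
  assumes "finite T" "T \<subseteq> V"
  shows "\<exists>E. onb E \<and> span E = span T"
  using assms
proof (induction T)
  case empty
  then show ?case by (intro exI[of _ "{}"]) (auto simp: onb_def)
next
  case (insert s T)
  then obtain E where E: "onb E" "span E = span T" by auto
  then have fE: "finite E" "E \<subseteq> V" "\<And>e e'. e \<in> E \<Longrightarrow> e' \<in> E \<Longrightarrow> B e e' = (if e = e' then 1 else 0)"
    by (auto simp: onb_def)
  define p where "p = (\<Sum>e\<in>E. B s e *s* e)"
  define t where "t = s - p"
  have sV: "s \<in> V" using insert by auto
  have pE: "p \<in> span E" unfolding p_def by (intro span_sum span_scale span_base)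
  have pV: "p \<in> V" using pE V_span[OF fE(2)] by auto
  have tV: "t \<in> V" using sV pV by (simp add: t_def)
  have orth: "B t e = 0" if e: "e \<in> E" for e
  proof -
    have "B p e = (\<Sum>e'\<in>E. B (B s e' *s* e') e)"
      unfolding p_def using fE(2) e by (intro B_sum_left) auto
    also have "\<dots> = (\<Sum>e'\<in>E. if e' = e then B s e' else 0)"
      using fE(2) e by (intro sum.cong) (auto simp: B_simps fE(3) subset_iff)
    finally show ?thesis using e fE sV pV by (auto simp: t_def B_simps)
  qed
  have sp: "span (insert s T) = span (insert s E)"
    using E(2) by (simp add: span_insert)
  show ?case
  proof (cases "t = 0")
    case True
    then have "s \<in> span E" using pE by (simp add: t_def)
    then have "span (insert s E) = span E" by (rule span_redundant)
    then show ?thesis using E sp by auto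
  next
    case False
    then have pos: "0 < B t t" using B_pos tV by auto
    define e where "e = (1 / sqrt (B t t)) *s* t"
    have eV: "e \<in> V" using tV by (simp add: e_def)
    have ee: "B e e = 1" using pos tV by (simp add: e_def B_simps)
    have eo: "B e e' = 0" "B e' e = 0" if "e' \<in> E" for e'
    proof -
      show "B e e' = 0" using that fE(2) tV orth[OF that] by (auto simp: e_def B_simps)
      then show "B e' e = 0" using that fE(2) eV B_sym by auto
    qed
    have "onb (insert e E)"
    proof -
      have "e \<notin> E" using ee eo(1) by fastforce
      then show ?thesis
        unfolding onb_def using fE(1,2) eV by (auto simp: ee eo fE(3))
    qed
    moreover have "span (insert e E) = span (insert s E)"
    proof (rule antisym)
      have "e \<in> span (insert s E)"
        unfolding e_def t_def using pE
        by (meson span_scale span_diff span_base insertI1 span_mono subset_insertI subsetD)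
      then show "span (insert e E) \<subseteq> span (insert s E)"
        by (intro span_minimal) (auto intro: span_base)
      have "s = sqrt (B t t) *s* e + p" using pos by (simp add: e_def t_def)
      moreover have "p \<in> span (insert e E)" using pE by (meson span_mono subset_insertI subsetD)
      ultimately have "s \<in> span (insert e E)"
        by (metis span_add span_scale span_base insertI1)
      then show "span (insert s E) \<subseteq> span (insert e E)"
        by (intro span_minimal) (auto intro: span_base)
    qed
    ultimately show ?thesis using sp by metis
  qed
qed

text \<open>Linearity of \<open>F\<close> is asked for only on \<open>span T\<close>, because the
  load functional \<open>L2_prod g\<close> to which this is applied is linear only on
  \<open>L2\<close>.\<close>

lemma riesz:
  assumes T: "finite T" "T \<subseteq> V"
    and F_add: "\<And>x y. x \<in> span T \<Longrightarrow> y \<in> span T \<Longrightarrow> F (x + y) = F x + F y"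
    and F_scale: "\<And>c x. x \<in> span T \<Longrightarrow> F (c *s* x) = c * (F x :: real)"
  shows "\<exists>w\<in>span T. \<forall>z\<in>span T. B w z = F z"
proof -
  obtain E where E: "onb E" "span E = span T" using onb_exists[OF T] by auto
  then have fE: "finite E" "E \<subseteq> V" by (auto simp: onb_def)
  have F0: "F 0 = 0" using F_scale[of 0 0] by (simp add: span_zero)
  have F_sum: "F (\<Sum>e\<in>I. c e *s* e) = (\<Sum>e\<in>I. c e * F e)" if "finite I" "I \<subseteq> span T" for c I
    using that by (induction I) (auto simp: F0 F_add F_scale span_scale span_sum subset_iff)
  define w where "w = (\<Sum>e\<in>E. F e *s* e)"
  have sub: "E \<subseteq> span T" using E(2) span_superset by auto
  have "w \<in> span T" unfolding w_def using sub by (auto intro!: span_sum span_scale)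
  moreover have "B w z = F z" if z: "z \<in> span T" for z
  proof -
    have zV: "z \<in> V" using z V_span[OF T(2)] by auto
    have "B w z = (\<Sum>e\<in>E. F e * B e z)"
      unfolding w_def using fE zV by (subst B_sum_left) (auto simp: B_simps subset_iff intro!: sum.cong)
    also have "\<dots> = (\<Sum>e\<in>E. B z e * F e)"
      using fE zV by (intro sum.cong) (auto simp: B_sym subset_iff)
    also have "\<dots> = F (\<Sum>e\<in>E. B z e *s* e)" using F_sum[OF fE(1) sub] by simp
    also have "\<dots> = F z" using onb_coeff[OF E(1)] z E(2) by simp
    finally show ?thesis .
  qed
  ultimately show ?thesis by auto
qed

text \<open>Uniqueness is part of the claim because \<open>proj\<close> is defined by
  \<open>THE\<close>.\<close>

lemma projection:
  assumes T: "finite T" "T \<subseteq> V" and v: "v \<in> V"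
  shows "\<exists>!w. w \<in> span T \<and> (\<forall>z\<in>span T. B (v - w) z = 0)"
proof -
  note sub = V_span[OF T(2)]
  obtain w where w: "w \<in> span T" "\<And>z. z \<in> span T \<Longrightarrow> B w z = B v z"
    using riesz[OF T, of "B v"] v sub by (auto simp: B_simps subset_iff)
  show ?thesis
  proof (rule ex1I[of _ w])
    show "w \<in> span T \<and> (\<forall>z\<in>span T. B (v - w) z = 0)"
      using w v sub by (auto simp: B_simps subset_iff)
    fix w' assume w': "w' \<in> span T \<and> (\<forall>z\<in>span T. B (v - w') z = 0)"
    have mem: "w \<in> V" "w' \<in> V" "w' - w \<in> span T"
      using w w' sub span_diff by auto
    have "B (v - w') (w' - w) = 0" using w' mem by auto
    then have "B (w' - w) (w' - w) = 0"
      using w(2)[OF mem(3)] mem v by (simp add: B_simps)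
    then have "w' - w = 0" by (intro definite) (use mem in auto)
    then show "w' = w" by simp
  qed
qed

definition lin_op :: "('a \<Rightarrow> 'a) \<Rightarrow> bool" where
  "lin_op A \<longleftrightarrow> (\<forall>x\<in>V. A x \<in> V) \<and> (\<forall>x\<in>V. \<forall>y\<in>V. A (x + y) = A x + A y) \<and>
     (\<forall>x\<in>V. \<forall>c. A (c *s* x) = c *s* A x)"

lemma lin_opD:
  assumes "lin_op A"
  shows "x \<in> V \<Longrightarrow> A x \<in> V" "\<lbrakk>x \<in> V; y \<in> V\<rbrakk> \<Longrightarrow> A (x + y) = A x + A y"
    "x \<in> V \<Longrightarrow> A (c *s* x) = c *s* A x" "A 0 = 0"
    "\<lbrakk>x \<in> V; y \<in> V\<rbrakk> \<Longrightarrow> A (x - y) = A x - A y"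
proof -
  have 1: "\<And>x. x \<in> V \<Longrightarrow> A x \<in> V" "\<And>x y. \<lbrakk>x \<in> V; y \<in> V\<rbrakk> \<Longrightarrow> A (x + y) = A x + A y"
    "\<And>x c. x \<in> V \<Longrightarrow> A (c *s* x) = c *s* A x"
    using assms by (auto simp: lin_op_def)
  show "x \<in> V \<Longrightarrow> A x \<in> V" "\<lbrakk>x \<in> V; y \<in> V\<rbrakk> \<Longrightarrow> A (x + y) = A x + A y"
    "x \<in> V \<Longrightarrow> A (c *s* x) = c *s* A x"
    using 1 by auto
  show "A 0 = 0" using 1(3)[of 0 0] by simp
  show "\<lbrakk>x \<in> V; y \<in> V\<rbrakk> \<Longrightarrow> A (x - y) = A x - A y"
    using 1(2)[of "x - y" y] by simp
qed

lemma lin_op_sum: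
  assumes "lin_op A" "finite I" "\<And>i. i \<in> I \<Longrightarrow> f i \<in> V"
  shows "A (\<Sum>i\<in>I. c i *s* f i) = (\<Sum>i\<in>I. c i *s* A (f i))"
  using assms(2,3) by (induction I) (auto simp: lin_opD[OF assms(1)])

lemma onb_V: "\<exists>E. onb E \<and> span E = V"
  using onb_exists[OF finite_S] S_span span_superset by metis

lemma lin_op_bounded:
  assumes "lin_op A"
  obtains c where "0 < c" "\<And>x. x \<in> V \<Longrightarrow> B (A x) (A x) \<le> c * B x x"
proof -
  obtain E where E: "onb E" "span E = V" using onb_V by auto
  then have fE: "finite E" "E \<subseteq> V" "\<And>e. e \<in> E \<Longrightarrow> B e e = 1" by (auto simp: onb_def)
  define d where "d = (\<Sum>e\<in>E. sqrt (B (A e) (A e)))"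
  have d0: "0 \<le> d" unfolding d_def
    using fE lin_opD(1)[OF assms] B_nonneg by (intro sum_nonneg) (auto simp: subset_iff)
  have bd: "sqrt (B (A x) (A x)) \<le> d * sqrt (B x x)" if x: "x \<in> V" for x
  proof -
    have mem: "e \<in> E \<Longrightarrow> A e \<in> V" "e \<in> E \<Longrightarrow> e \<in> V" for e
      using fE lin_opD(1)[OF assms] by auto
    have "A x = A (\<Sum>e\<in>E. B x e *s* e)" using onb_coeff[OF E(1)] x E(2) by simp
    also have "\<dots> = (\<Sum>e\<in>E. B x e *s* A e)" by (rule lin_op_sum[OF assms fE(1)]) (use mem in auto)
    finally have "sqrt (B (A x) (A x)) \<le> (\<Sum>e\<in>E. sqrt (B (B x e *s* A e) (B x e *s* A e)))"
      using triangle_sum[of E "\<lambda>e. B x e *s* A e"] mem by auto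
    also have "\<dots> = (\<Sum>e\<in>E. \<bar>B x e\<bar> * sqrt (B (A e) (A e)))"
      using mem norm_scale by (intro sum.cong) auto
    also have "\<dots> \<le> (\<Sum>e\<in>E. sqrt (B x x) * sqrt (B (A e) (A e)))"
      using mem x B_nonneg cauchy_schwarz_sqrt[of x] fE(3)
      by (intro sum_mono mult_right_mono) fastforce+
    finally show ?thesis by (simp add: d_def sum_distrib_left mult.commute)
  qed
  show thesis
  \<comment> \<open>The added 1 makes the constant strictly positive even for the zero
    operator.\<close>
  proof (rule that[of "d\<^sup>2 + 1"])
    show "0 < d\<^sup>2 + 1" by (simp add: add_nonneg_pos)
    fix x assume x: "x \<in> V"
    have "(sqrt (B (A x) (A x)))\<^sup>2 \<le> (d * sqrt (B x x))\<^sup>2"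
      using bd[OF x] x lin_opD(1)[OF assms] B_nonneg by (intro power_mono) auto
    then have "B (A x) (A x) \<le> d\<^sup>2 * B x x"
      using x lin_opD(1)[OF assms] B_nonneg by (simp add: power_mult_distrib)
    also have "\<dots> \<le> (d\<^sup>2 + 1) * B x x" using B_nonneg[OF x] by (simp add: algebra_simps)
    finally show "B (A x) (A x) \<le> (d\<^sup>2 + 1) * B x x" .
  qed
qed

text \<open>In finite dimension an injective operator has a linear inverse, and the bound for
  \<open>A\<close> from below is the boundedness of that inverse.\<close>

lemma injective_lin_op_bounded_below:
  assumes A: "lin_op A" and inj: "\<And>x. x \<in> V \<Longrightarrow> A x = 0 \<Longrightarrow> x = 0"
  obtains c where "0 < c" "\<And>x. x \<in> V \<Longrightarrow> B x x \<le> c * B (A x) (A x)"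
proof -
  obtain E where E: "onb E" "span E = V" using onb_V by auto
  then have fE: "finite E" "E \<subseteq> V"
    "\<And>e e'. e \<in> E \<Longrightarrow> e' \<in> E \<Longrightarrow> B e e' = (if e = e' then 1 else 0)" by (auto simp: onb_def)
  have injE: "inj_on A V"
  proof (rule inj_onI)
    fix x y assume "x \<in> V" "y \<in> V" "A x = A y"
    then have "x - y = 0" using inj[of "x - y"] by (simp add: lin_opD(5)[OF A])
    then show "x = y" by simp
  qed
  have ind: "independent (A ` E)"
  proof (rule independent_if_scalars_zero)
    fix f a assume s: "(\<Sum>x\<in>A ` E. f x *s* x) = 0" and a: "a \<in> A ` E"
    have "0 = (\<Sum>e\<in>E. f (A e) *s* A e)"
      using s fE injE by (simp add: sum.reindex inj_on_subset)
    also have "\<dots> = A (\<Sum>e\<in>E. f (A e) *s* e)"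
      by (subst lin_op_sum[OF A fE(1)]) (use fE(2) in auto)
    finally have A0: "A (\<Sum>e\<in>E. f (A e) *s* e) = 0" by simp
    have z: "(\<Sum>e\<in>E. f (A e) *s* e) = 0" by (rule inj[OF _ A0]) (use fE(2) in auto)
    obtain e where e: "e \<in> E" "a = A e" using a by auto
    have "e \<in> V" using e fE(2) by auto
    then have "0 = B (\<Sum>e\<in>E. f (A e) *s* e) e" unfolding z by (simp add: B_zero_left)
    also have "\<dots> = (\<Sum>e'\<in>E. B (f (A e') *s* e') e)"
      using fE(2) e by (intro B_sum_left) auto
    also have "\<dots> = (\<Sum>e'\<in>E. if e' = e then f (A e') else 0)"
      using fE(2) e by (intro sum.cong) (auto simp: B_simps fE(3) subset_iff)
    also have "\<dots> = f a" using e fE(1) by simp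
    finally show "f a = 0" by simp
  qed (use fE in auto)
  have surj: "\<exists>x\<in>V. A x = y" if y: "y \<in> V" for y
  proof -
    have "y \<in> span (A ` E)"
    proof (rule ccontr)
      assume n: "y \<notin> span (A ` E)"
      then have "independent (insert y (A ` E))" using ind independent_insertI by blast
      moreover have "insert y (A ` E) \<subseteq> span E" using y fE lin_opD(1)[OF A] E(2) by auto
      ultimately have "card (insert y (A ` E)) \<le> card E"
        using independent_span_bound[OF fE(1)] by blast
      moreover have "y \<notin> A ` E" using n span_base[of y "A ` E"] by argo
      ultimately show False using card_image[OF inj_on_subset[OF injE fE(2)]] fE(1) by simp
    qed
    then obtain c where "y = (\<Sum>v\<in>A ` E. c v *s* v)" using span_finite[of "A ` E"] fE(1) by auto
    then have "y = (\<Sum>e\<in>E. c (A e) *s* A e)"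
      using fE injE by (simp add: sum.reindex inj_on_subset)
    then have "y = A (\<Sum>e\<in>E. c (A e) *s* e)"
      by (subst lin_op_sum[OF A fE(1)]) (use fE(2) in auto)
    then show ?thesis using fE(2) by (intro bexI[of _ "\<Sum>e\<in>E. c (A e) *s* e"]) auto
  qed
  define R where "R = the_inv_into V A"
  have AR: "y \<in> V \<Longrightarrow> A (R y) = y" and RV: "y \<in> V \<Longrightarrow> R y \<in> V" for y
    unfolding R_def using surj[of y] f_the_inv_into_f[OF injE, of y] the_inv_into_into[OF injE, of y V]
    by auto
  have RA: "x \<in> V \<Longrightarrow> R (A x) = x" for x
    unfolding R_def using the_inv_into_f_f[OF injE] by auto
  have "lin_op R"
    unfolding lin_op_def
  proof (intro conjI ballI allI)
    show "R x \<in> V" if "x \<in> V" for x using RV that by auto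
    show "R (x + y) = R x + R y" if "x \<in> V" "y \<in> V" for x y
      using RA[of "R x + R y"] that RV AR by (simp add: lin_opD[OF A])
    show "R (c *s* x) = c *s* R x" if "x \<in> V" for x c
      using RA[of "c *s* R x"] that RV AR by (simp add: lin_opD[OF A])
  qed
  from lin_op_bounded[OF this] obtain c
    where "0 < c" "\<And>x. x \<in> V \<Longrightarrow> B (R x) (R x) \<le> c * B x x" by auto
  then show thesis using that[of c] RA lin_opD(1)[OF A] by metis
qed

text \<open>Let \<open>\<rho>\<close> be the infimum of the Rayleigh quotient, so that \<open>A - \<rho>\<close> is positive semidefinite. If it
  were injective it would be bounded below, hence uniformly positive, and \<open>\<rho>\<close> could be increased.\<close>

lemma min_eigenvector:
  assumes A: "lin_op A" and self: "\<And>x y. x \<in> V \<Longrightarrow> y \<in> V \<Longrightarrow> B (A x) y = B x (A y)"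
    and ne: "\<exists>x\<in>V. x \<noteq> 0"
  obtains l v where "v \<in> V" "v \<noteq> 0" "A v = l *s* v" "\<And>x. x \<in> V \<Longrightarrow> l * B x x \<le> B (A x) x"
proof -
  define Q where "Q = {B (A x) x | x. x \<in> V \<and> B x x = 1}"
  obtain c where c: "0 < c" "\<And>x. x \<in> V \<Longrightarrow> B (A x) (A x) \<le> c * B x x"
    using lin_op_bounded[OF A] by blast
  have normalize: "\<exists>y. y \<in> V \<and> B y y = 1 \<and> B (A y) y = B (A x) x / B x x" if "x \<in> V" "x \<noteq> 0" for x
  proof -
    define y where "y = (1 / sqrt (B x x)) *s* x"
    have p: "0 < B x x" using B_pos that by auto
    have "y \<in> V" using that by (simp add: y_def)
    moreover have "B y y = 1" using p that by (simp add: y_def B_simps)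
    moreover have "B (A y) y = B (A x) x / B x x"
      using p that lin_opD[OF A] by (simp add: y_def B_simps)
    ultimately show ?thesis by blast
  qed
  have Qne: "Q \<noteq> {}" using ne normalize unfolding Q_def by fastforce
  have "- sqrt c \<le> t" if t: "t \<in> Q" for t
  proof -
    obtain x where x: "x \<in> V" "B x x = 1" "t = B (A x) x" using t by (auto simp: Q_def)
    have "\<bar>t\<bar> \<le> sqrt (B (A x) (A x)) * sqrt (B x x)"
      unfolding x(3) by (intro cauchy_schwarz_sqrt lin_opD[OF A] x(1))
    also have "\<dots> \<le> sqrt c" using c(2)[OF x(1)] x by simp
    finally show ?thesis by simp
  qed
  then have bdd: "bdd_below Q" by (rule bdd_belowI)
  define l where "l = Inf Q"
  have low: "l * B x x \<le> B (A x) x" if x: "x \<in> V" for x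
  proof (cases "x = 0")
    case False
    obtain y where y: "y \<in> V" "B y y = 1" "B (A y) y = B (A x) x / B x x"
      using normalize[OF x False] by blast
    then have "B (A x) x / B x x \<in> Q" unfolding Q_def by (intro CollectI exI[of _ y]) simp
    then have "l \<le> B (A x) x / B x x"
      unfolding l_def using bdd by (intro cInf_lower)
    then show ?thesis using B_pos[OF x False] by (simp add: field_simps)
  qed (simp add: B_simps lin_opD[OF A])
  define P where "P = (\<lambda>x. A x - l *s* x)"
  have P: "lin_op P"
    using A unfolding lin_op_def P_def by (auto simp: algebra_simps scale_right_diff_distrib scale_right_distrib mult.commute)
  note PD = lin_opD[OF P]
  have Pself: "B (P x) y = B x (P y)" if "x \<in> V" "y \<in> V" for x y
    using that lin_opD[OF A] self by (simp add: P_def B_simps)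
  have Ppos: "0 \<le> B (P x) x" if "x \<in> V" for x
    using low[OF that] that lin_opD[OF A] by (simp add: P_def B_simps)
  interpret P: semi_inner scale V "\<lambda>x y. B (P x) y"
    by unfold_locales (use subspace_V Ppos Pself B_sym PD in \<open>auto simp: B_simps\<close>)
  have "\<exists>v\<in>V. v \<noteq> 0 \<and> P v = 0"
  proof (rule ccontr)
    assume "\<not> ?thesis"
    then have "\<And>x. x \<in> V \<Longrightarrow> P x = 0 \<Longrightarrow> x = 0" by auto
    then obtain d where d: "0 < d" "\<And>x. x \<in> V \<Longrightarrow> B x x \<le> d * B (P x) (P x)"
      using injective_lin_op_bounded_below[OF P] by blast
    obtain g where g: "0 < g" "\<And>x. x \<in> V \<Longrightarrow> B (P x) (P x) \<le> g * B x x"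
      using lin_op_bounded[OF P] by blast
    \<comment> \<open>Cauchy-Schwarz for the form \<open>B (P x) y\<close>, tested with
      \<open>P x\<close> in place of \<open>y\<close>: this bounds the squared norm of
      \<open>P x\<close> by the form \<open>B (P x) x\<close> itself.\<close>
    have PP: "B (P x) (P x) \<le> sqrt g * B (P x) x" if x: "x \<in> V" for x
    proof (cases "B (P x) (P x) = 0")
      case False
      then have pos: "0 < B (P x) (P x)" using B_nonneg PD(1)[OF x] by (simp add: order_less_le)
      have "(B (P x) (P x))\<^sup>2 \<le> B (P x) x * B (P (P x)) (P x)"
        using P.cauchy_schwarz[OF x PD(1)[OF x]] .
      also have "B (P (P x)) (P x) \<le> sqrt (B (P (P x)) (P (P x))) * sqrt (B (P x) (P x))"
        using cauchy_schwarz_sqrt[of "P (P x)" "P x"] x PD(1) by auto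
      also have "\<dots> \<le> sqrt (g * B (P x) (P x)) * sqrt (B (P x) (P x))"
        using g(2)[of "P x"] x PD(1) B_nonneg by (intro mult_right_mono) auto
      also have "\<dots> = sqrt g * B (P x) (P x)" using pos by (simp add: real_sqrt_mult)
      finally have "(B (P x) (P x))\<^sup>2 \<le> B (P x) x * (sqrt g * B (P x) (P x))"
        using Ppos[OF x] by (simp add: mult_left_mono)
      then have "B (P x) (P x) * B (P x) (P x) \<le> (sqrt g * B (P x) x) * B (P x) (P x)"
        by (simp only: power2_eq_square mult_ac)
      then show ?thesis using pos by (rule mult_right_le_imp_le)
    qed (use Ppos[OF x] g in auto)
    \<comment> \<open>This is the amount by which the lower bound could be raised: on unit vectors 1
      <= \<open>d * B (P x) (P x)\<close> <= \<open>d * sqrt g * (t - l)\<close>.\<close>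
    define e where "e = 1 / (d * sqrt g)"
    have e: "0 < e" using d g by (simp add: e_def)
    have "l + e \<le> t" if "t \<in> Q" for t
    proof -
      obtain x where x: "x \<in> V" "B x x = 1" "t = B (A x) x" using \<open>t \<in> Q\<close> by (auto simp: Q_def)
      have "1 \<le> d * B (P x) (P x)" using d(2)[OF x(1)] x by simp
      also have "\<dots> \<le> d * (sqrt g * B (P x) x)" using PP[OF x(1)] d by simp
      also have "B (P x) x = t - l" using x lin_opD[OF A] by (simp add: P_def B_simps)
      finally show ?thesis using d g by (simp add: e_def field_simps)
    qed
    then have "l + e \<le> Inf Q" using Qne by (intro cInf_greatest)
    then show False using e by (simp add: l_def)
  qed
  then obtain v where "v \<in> V" "v \<noteq> 0" "A v = l *s* v" by (auto simp: P_def)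
  then show thesis using low that by blast
qed

end


section \<open>Chebyshev bound for Krylov approximation\<close>

context semi_inner
begin

text \<open>The powers start at \<open>A y\<close>, not at \<open>y\<close>: here \<open>y\<close>
  is the unknown exact solution, and only the data \<open>A y\<close> are available to the
  iteration.\<close>

definition krylov_space :: "('v \<Rightarrow> 'v) \<Rightarrow> 'v \<Rightarrow> nat \<Rightarrow> 'v set" where
  "krylov_space A y k = span ((\<lambda>j. (A ^^ Suc j) y) ` {..<k})"

lemma krylov_space_mono: "j \<le> k \<Longrightarrow> krylov_space A y j \<subseteq> krylov_space A y k"
  unfolding krylov_space_def by (intro span_mono image_mono) auto

lemma krylov_space_subspace: "subspace (krylov_space A y k)"
  by (simp add: krylov_space_def)

end

locale pos_operator = semi_inner +
  fixes A :: "'a \<Rightarrow> 'a" and \<alpha> \<beta> :: real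
  assumes A_V: "x \<in> V \<Longrightarrow> A x \<in> V"
    and A_add: "\<lbrakk>x \<in> V; y \<in> V\<rbrakk> \<Longrightarrow> A (x + y) = A x + A y"
    and A_scale: "x \<in> V \<Longrightarrow> A (c *s* x) = c *s* A x"
    and A_self: "\<lbrakk>x \<in> V; y \<in> V\<rbrakk> \<Longrightarrow> B (A x) y = B x (A y)"
    and A_lower: "x \<in> V \<Longrightarrow> \<alpha> * B x x \<le> B (A x) x"
    and A_upper: "x \<in> V \<Longrightarrow> B (A x) x \<le> \<beta> * B x x"
    and \<alpha>_pos: "0 < \<alpha>" and \<alpha>_\<beta>: "\<alpha> \<le> \<beta>"
begin

lemma A_diff: "\<lbrakk>x \<in> V; y \<in> V\<rbrakk> \<Longrightarrow> A (x - y) = A x - A y"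
  using A_add[of "x - y" y] by simp

lemma A_zero: "A 0 = 0"
  using A_scale[of 0 0] by simp

lemma krylov_space_V: "y \<in> V \<Longrightarrow> krylov_space A y k \<subseteq> V"
proof -
  assume "y \<in> V"
  then have "(A ^^ j) y \<in> V" for j by (induction j) (auto simp: A_V)
  then show ?thesis unfolding krylov_space_def by (intro V_span) (auto simp: A_V)
qed

lemma krylov_space_A:
  assumes y: "y \<in> V" and x: "x \<in> krylov_space A y k"
  shows "A x \<in> krylov_space A y (Suc k)"
proof -
  have "krylov_space A y k \<subseteq> {x \<in> V. A x \<in> krylov_space A y (Suc k)}"
    (is "_ \<subseteq> ?U")
    unfolding krylov_space_def[of A y k]
  proof (rule span_minimal)
    have "(A ^^ j) y \<in> V" for j using y by (induction j) (auto simp: A_V)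
    moreover have "A ((A ^^ Suc j) y) \<in> krylov_space A y (Suc k)" if "j < k" for j
    proof -
      have "(A ^^ Suc (Suc j)) y \<in> krylov_space A y (Suc k)"
        unfolding krylov_space_def using that by (intro span_base imageI) auto
      then show ?thesis by simp
    qed
    ultimately show "(\<lambda>j. (A ^^ Suc j) y) ` {..<k} \<subseteq> ?U" by (auto simp: A_V)
    show "subspace ?U"
      using krylov_space_subspace[of A y "Suc k"]
      by (auto simp: subspace_def A_add A_scale A_zero)
  qed
  then show ?thesis using x by auto
qed

text \<open>With \<open>P = A - \<alpha>\<close> and \<open>Q = \<beta> - A\<close> one has \<open>(\<beta> - \<alpha>) P Q = P Q P + Q P Q\<close>.\<close>

lemma commuting_product_nonneg:
  assumes x: "x \<in> V"
  shows "0 \<le> (\<beta> - \<alpha>) * B (A x - \<alpha> *s* x) (\<beta> *s* x - A x)"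
proof -
  define P where "P = (\<lambda>x. A x - \<alpha> *s* x)"
  define Q where "Q = (\<lambda>x. \<beta> *s* x - A x)"
  have mem: "P z \<in> V" "Q z \<in> V" if "z \<in> V" for z using that by (auto simp: P_def Q_def A_V)
  have Q0: "0 \<le> B (P x) (Q (P x))"
    using mem(1)[OF x] A_upper[of "P x"] B_sym[of "A (P x)" "P x"] by (simp add: Q_def B_simps A_V)
  have P0: "0 \<le> B (P (Q x)) (Q x)"
    using mem(2)[OF x] A_lower[of "Q x"] by (simp add: P_def B_simps A_V)
  have "(\<beta> - \<alpha>) * B (P x) (Q x) = B (P x) (Q (P x)) + B (P (Q x)) (Q x)"
    using x by (simp add: P_def Q_def B_simps A_V A_diff A_scale A_self B_sym[of "A (A x)"] algebra_simps)
  then show ?thesis using P0 Q0 by (simp add: P_def Q_def)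
qed

text \<open>The approximation error is T_k(X) y / T_k(x0), where \<open>X\<close> is the affine
  image of \<open>A\<close> that moves the interval from \<open>\<alpha>\<close> to
  \<open>\<beta>\<close> onto [-1, 1], and \<open>x0\<close> is the image of 0. The division makes
  the error polynomial 1 at 0, so that its difference to \<open>y\<close> lies in the Krylov
  space.\<close>

lemma krylov_space_approximation:
  fixes q :: real
  assumes y: "y \<in> V" and k: "1 \<le> k"
    and q_def: "q = (sqrt (\<beta> / \<alpha>) - 1) / (sqrt (\<beta> / \<alpha>) + 1)"
  shows "\<exists>x\<in>krylov_space A y k. B (y - x) (y - x) \<le> (2 * q ^ k)\<^sup>2 * B y y"
proof (cases "\<alpha> = \<beta>")
  case True
  have eq: "B (A x) x = \<alpha> * B x x" if "x \<in> V" for x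
    using A_lower[OF that] A_upper[OF that] True by simp
  define e where "e = A y - \<alpha> *s* y"
  have e: "e \<in> V" using y by (simp add: e_def A_V)
  \<comment> \<open>Polarization: the quadratic identity at \<open>y\<close>, \<open>e\<close> and
    \<open>y + e\<close> gives \<open>B (A y) e = \<alpha> * B y e\<close>, hence
    \<open>B e e = 0\<close>. As \<open>q = 0\<close> and \<open>k\<close> is positive, nothing
    larger than 0 is allowed here.\<close>
  have "B (A (y + e)) (y + e) = \<alpha> * B (y + e) (y + e)" using eq y e by simp
  then have "B (A y) e = \<alpha> * B y e"
    using eq[OF y] eq[OF e] y e A_self[OF e y] B_sym[of e y] B_sym[of e "A y"]
    by (simp add: A_add B_simps A_V algebra_simps)
  then have "B e e = 0" using e y by (subst (1) e_def) (simp add: B_simps A_V)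
  moreover have "y - (1 / \<alpha>) *s* A y = (- (1 / \<alpha>)) *s* e"
    using \<alpha>_pos by (simp add: e_def scale_right_diff_distrib)
  ultimately have "B (y - (1 / \<alpha>) *s* A y) (y - (1 / \<alpha>) *s* A y) = 0"
    using e by (simp only: B_scale_left B_scale_right V_scale mult_zero_right)
  moreover have "A y \<in> (\<lambda>j. (A ^^ Suc j) y) ` {..<k}" using k by (intro image_eqI[of _ _ 0]) auto
  then have "(1 / \<alpha>) *s* A y \<in> krylov_space A y k"
    unfolding krylov_space_def by (intro span_scale span_base)
  ultimately show ?thesis using B_nonneg[OF y]
    by (intro bexI[of _ "(1 / \<alpha>) *s* A y"]) auto
next
  case False
  then have ab: "\<alpha> < \<beta>" using \<alpha>_\<beta> by simp
  define X where "X = (\<lambda>x. (1 / (\<beta> - \<alpha>)) *s* ((\<alpha> + \<beta>) *s* x - 2 *s* A x))"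
  have X_V: "X x \<in> V" if "x \<in> V" for x using that by (simp add: X_def A_V)
  have X_add: "X (x + z) = X x + X z" if "x \<in> V" "z \<in> V" for x z
    using that by (simp add: X_def A_add algebra_simps scale_right_distrib scale_right_diff_distrib)
  have X_diff: "X (x - z) = X x - X z" if "x \<in> V" "z \<in> V" for x z
    using X_add[of "x - z" z] that by simp
  have X_scale: "X (c *s* x) = c *s* X x" if "x \<in> V" for x c
    using that by (simp add: X_def A_scale scale_right_diff_distrib mult_ac)
  have X_self: "B (X x) z = B x (X z)" if "x \<in> V" "z \<in> V" for x z
    using that by (simp add: X_def B_simps A_V A_self)
  \<comment> \<open>1 - X^2 is the multiple 4 / (\<open>\<beta>\<close> - \<open>\<alpha>\<close>)^2
    of the product of A - \<open>\<alpha>\<close> and \<open>\<beta>\<close> - A, which is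
    nonnegative by \<open>commuting_product_nonneg\<close>.\<close>
  have contr: "B (X u) (X u) \<le> B u u" if u: "u \<in> V" for u
  proof -
    have "0 \<le> (\<beta> - \<alpha>) * B (A u - \<alpha> *s* u) (\<beta> *s* u - A u)" by (rule commuting_product_nonneg[OF u])
    then have "0 \<le> B (A u - \<alpha> *s* u) (\<beta> *s* u - A u)" using ab by (simp add: zero_le_mult_iff)
    then have "0 \<le> 4 / (\<beta> - \<alpha>)\<^sup>2 * B (A u - \<alpha> *s* u) (\<beta> *s* u - A u)" by simp
    moreover have "B u u - B (X u) (X u)
        = 4 / (\<beta> - \<alpha>)\<^sup>2 * B (A u - \<alpha> *s* u) (\<beta> *s* u - A u)"
    proof -
      have "(\<beta> - \<alpha>)\<^sup>2 * B (X u) (X u)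
          = B ((\<alpha> + \<beta>) *s* u - 2 *s* A u) ((\<alpha> + \<beta>) *s* u - 2 *s* A u)"
        using ab u by (simp add: X_def B_simps(5,6) A_V power2_eq_square)
      also have "\<dots> = (\<beta> - \<alpha>)\<^sup>2 * B u u - 4 * B (A u - \<alpha> *s* u) (\<beta> *s* u - A u)"
        using u by (simp add: B_simps A_V B_sym[of "A u" u] algebra_simps power2_eq_square)
      finally show ?thesis using ab by (simp add: field_simps)
    qed
    ultimately show ?thesis by linarith
  qed
  define z where "z = 1 / q"
  have sq: "1 < sqrt (\<beta> / \<alpha>)" using ab \<alpha>_pos by simp
  have q01: "0 < (s - 1) / (s + 1) \<and> (s - 1) / (s + 1) < 1" if "1 < s" for s :: real
    using that by (simp add: field_simps)
  from q01[OF sq] have q: "0 < q" "q < 1" unfolding q_def by auto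
  then have z: "1 < z" "z * q = 1" by (auto simp: z_def)
  define x0 where "x0 = (\<alpha> + \<beta>) / (\<beta> - \<alpha>)"
  \<comment> \<open>The Joukowski parametrization of \<open>x0\<close>: with
    \<open>z = 1 / q\<close> one has T_k(x0) = (z^k + q^k) / 2 and U_{k-1}(x0) = (z^k - q^k) / (z -
    q), and the contraction factor appears as 1 / z.\<close>
  have x0: "x0 = (z + q) / 2"
  proof -
    define s where "s = sqrt (\<beta> / \<alpha>)"
    have s: "1 < s" "s\<^sup>2 = \<beta> / \<alpha>" using sq ab \<alpha>_pos by (auto simp: s_def)
    have "x0 = (s\<^sup>2 + 1) / (s\<^sup>2 - 1)"
      unfolding s(2) x0_def using ab \<alpha>_pos by (simp add: field_simps)
    also have "\<dots> = ((s + 1) / (s - 1) + (s - 1) / (s + 1)) / 2"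
    proof -
      have "s\<^sup>2 - 1 = (s - 1) * (s + 1)" by (simp add: algebra_simps power2_eq_square)
      moreover have "s - 1 \<noteq> 0" "s + 1 \<noteq> 0" using s by auto
      ultimately show ?thesis by (simp add: divide_simps) (simp add: algebra_simps power2_eq_square)
    qed
    finally show ?thesis by (simp add: z_def q_def s_def)
  qed
  let ?K = "krylov_space A y"
  let ?\<tau> = "\<lambda>k. (z ^ k + q ^ k) / 2" and ?\<upsilon> = "\<lambda>k. (z ^ k - q ^ k) / (z - q)"
  note K = krylov_space_subspace[THEN subspace_add] krylov_space_subspace[THEN subspace_diff]
    krylov_space_subspace[THEN subspace_scale] krylov_space_subspace[THEN subspace_0]
  have K_mono: "x \<in> ?K j \<Longrightarrow> j \<le> k \<Longrightarrow> x \<in> ?K k" for x j k using krylov_space_mono by blast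
  have KV: "x \<in> ?K j \<Longrightarrow> x \<in> V" for x j using krylov_space_V[OF y] by blast
  have K_X: "X x \<in> ?K (Suc j)" if "x \<in> ?K j" for x j
    unfolding X_def using krylov_space_A[OF y that] K_mono[OF that] by (intro K) auto
  have Xy: "\<exists>x\<in>?K 1. X y = x0 *s* y - x"
  proof (rule bexI)
    show "X y = x0 *s* y - (2 / (\<beta> - \<alpha>)) *s* A y"
      by (simp add: X_def x0_def scale_right_diff_distrib)
    show "(2 / (\<beta> - \<alpha>)) *s* A y \<in> ?K 1"
      unfolding krylov_space_def by (intro span_scale span_base) auto
  qed
  then obtain x1 where x1: "x1 \<in> ?K 1" "X y = x0 *s* y - x1" by blast
  have X_affine: "\<exists>x\<in>?K (Suc j). X w = (c * x0) *s* y - x"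
    if "w = c *s* y - v" "v \<in> ?K j" for w c v j
  proof (rule bexI)
    show "X w = (c * x0) *s* y - (c *s* x1 + X v)"
      using that KV y by (simp add: X_diff X_scale x1(2) scale_right_diff_distrib)
    show "c *s* x1 + X v \<in> ?K (Suc j)"
      using K_X[OF that(2)] K_mono[OF x1(1), of "Suc j"] by (intro K) auto
  qed
  text \<open>\<open>t\<close> and \<open>u\<close> are \<open>T\<^sub>k(X) y\<close> and \<open>U\<^sub>k\<^sub>-\<^sub>1(X) y\<close>, and the energy identity is
    Pell's equation \<open>T\<^sub>k\<^sup>2 + (1 - X\<^sup>2) U\<^sub>k\<^sub>-\<^sub>1\<^sup>2 = 1\<close>.\<close>
  have inv: "\<exists>t u. t \<in> V \<and> u \<in> V \<and> B t t + B u u - B (X u) (X u) = B y y \<and>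
      (\<exists>v\<in>?K k. t = ?\<tau> k *s* y - v) \<and> (\<exists>w\<in>?K (k - 1). u = ?\<upsilon> k *s* y - w)" if "1 \<le> k" for k
    using that
  proof (induction k rule: dec_induct)
    case base
    have "?\<tau> 1 = x0" "?\<upsilon> 1 = 1" using x0 z q by auto
    then have "(\<exists>v\<in>?K 1. X y = ?\<tau> 1 *s* y - v) \<and> (\<exists>w\<in>?K (1 - 1). y = ?\<upsilon> 1 *s* y - w)"
      using x1 K(4)[of A y 0] by (intro conjI bexI[of _ x1] bexI[of _ 0]) auto
    moreover have "B (X y) (X y) + B y y - B (X y) (X y) = B y y" by simp
    ultimately show ?case using y X_V[OF y] by blast
  next
    case (step k)
    then obtain t u v w where tu: "t \<in> V" "u \<in> V" "B t t + B u u - B (X u) (X u) = B y y"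
      and v: "v \<in> ?K k" "t = ?\<tau> k *s* y - v" and w: "w \<in> ?K (k - 1)" "u = ?\<upsilon> k *s* y - w" by blast
    \<comment> \<open>The coupled recurrences T_{k+1} = X T_k - (1 - X^2) U_{k-1} and U_k = X
      U_{k-1} + T_k, which preserve the Pell identity term by term.\<close>
    define t' where "t' = X t - (u - X (X u))"
    define u' where "u' = X u + t"
    have mem: "X t \<in> V" "X u \<in> V" "X (X u) \<in> V" "X (X (X u)) \<in> V" "t' \<in> V" "u' \<in> V"
      using tu X_V by (auto simp: t'_def u'_def)
    have energy: "B t' t' + B u' u' - B (X u') (X u') = B y y"
    proof -
      \<comment> \<open>Selfadjointness brings all mixed terms to the form of \<open>t\<close>
        against a power of \<open>X\<close> applied to \<open>u\<close>; the energy identity is then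
        plain arithmetic.\<close>
      have s: "B u t = B t u" "B u (X t) = B t (X u)" "B u (X (X t)) = B t (X (X u))"
        "B u (X (X (X t))) = B t (X (X (X u)))"
        using tu(1,2) B_sym[of u t] B_sym[of u "X t"] B_sym[of u "X (X t)"] B_sym[of u "X (X (X t))"]
        by (simp_all add: X_self X_V)
      have "B t' t' + B u' u' - B (X u') (X u') = B t t + B u u - B (X u) (X u)"
        using tu(1,2) unfolding t'_def u'_def by (simp add: X_add B_simps X_V X_self s)
      then show ?thesis using tu by simp
    qed
    have kk: "Suc (k - 1) = k" using step(1) by simp
    obtain a where a: "a \<in> ?K (Suc k)" "X t = (?\<tau> k * x0) *s* y - a"
      using X_affine[OF v(2,1)] by blast
    obtain b where b: "b \<in> ?K k" "X u = (?\<upsilon> k * x0) *s* y - b"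
      using X_affine[OF w(2,1)] kk by auto
    obtain c where c: "c \<in> ?K (Suc k)" "X (X u) = (?\<upsilon> k * x0 * x0) *s* y - c"
      using X_affine[OF b(2,1)] by blast
    have zq: "z - q \<noteq> 0" using z q by simp
    have \<tau>_Suc: "?\<tau> k * x0 - (?\<upsilon> k - ?\<upsilon> k * x0 * x0) = ?\<tau> (Suc k)"
    proof -
      have "x0 * x0 - 1 = ((z - q) / 2)\<^sup>2"
        unfolding x0 using z(2) by (simp add: power2_eq_square field_simps)
      then have "u - u * x0 * x0 = - u * ((z - q) / 2)\<^sup>2" for u
        by (metis (no_types) minus_diff_eq mult.assoc mult.right_neutral mult_minus_left mult_minus_right right_diff_distrib)
      then have "?\<upsilon> k - ?\<upsilon> k * x0 * x0 = - ?\<upsilon> k * ((z - q) / 2)\<^sup>2" .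
      also have "\<dots> = - ((z ^ k - q ^ k) * (z - q)) / 4"
        using zq by (simp add: power2_eq_square)
      finally have e: "?\<upsilon> k - ?\<upsilon> k * x0 * x0 = - ((z ^ k - q ^ k) * (z - q)) / 4" .
      show ?thesis by (subst e) (simp add: x0 field_simps)
    qed
    have gen: "(e1 *s* y - a') - ((e2 *s* y - b') - (e3 *s* y - c'))
        = (e1 - (e2 - e3)) *s* y - (a' - (b' - c'))" for e1 e2 e3 a' b' c'
      by (simp add: scale_left_diff_distrib)
    have "t' = (?\<tau> k * x0 - (?\<upsilon> k - ?\<upsilon> k * x0 * x0)) *s* y - (a - (w - c))"
      unfolding t'_def a(2) c(2) by (subst (1) w(2)) (rule gen)
    then have "t' = ?\<tau> (Suc k) *s* y - (a - (w - c))" unfolding \<tau>_Suc .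
    moreover have "a - (w - c) \<in> ?K (Suc k)"
      using a c K_mono[OF w(1), of "Suc k"] by (intro K) auto
    moreover have \<upsilon>_Suc: "?\<upsilon> k * x0 + ?\<tau> k = ?\<upsilon> (Suc k)"
      unfolding x0 using zq z(2) by (simp add: field_simps)
    have gen2: "(e1 *s* y - a') + (e2 *s* y - b') = (e1 + e2) *s* y - (a' + b')" for e1 e2 a' b'
      by (simp add: scale_left_distrib)
    have "u' = (?\<upsilon> k * x0 + ?\<tau> k) *s* y - (b + v)"
      unfolding u'_def b(2) by (subst (1) v(2)) (rule gen2)
    then have "u' = ?\<upsilon> (Suc k) *s* y - (b + v)" unfolding \<upsilon>_Suc .
    moreover have "b + v \<in> ?K (Suc k - 1)" using b v by (auto intro!: K)
    ultimately show ?case using mem energy by blast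
  qed
  obtain t u v where t: "t \<in> V" "u \<in> V" "B t t + B u u - B (X u) (X u) = B y y"
    and v: "v \<in> ?K k" "t = ?\<tau> k *s* y - v" using inv[OF k] by blast
  define c where "c = ?\<tau> k"
  have c: "0 < c" "t = c *s* y - v" using z q v(2) by (simp_all add: c_def add_pos_pos)
  \<comment> \<open>The Pell identity together with the contraction property says that T_k(X) does
    not increase the norm.\<close>
  have tt: "B t t \<le> B y y" using t(3) contr[OF t(2)] by simp
  have "y - (1 / c) *s* v = (1 / c) *s* t"
    unfolding c(2) using c(1) by (simp add: scale_right_diff_distrib)
  then have "B (y - (1 / c) *s* v) (y - (1 / c) *s* v) = (1 / c)\<^sup>2 * B t t"
    using t(1) by (simp add: B_scale_left B_scale_right power2_eq_square)
  also have "\<dots> \<le> (2 * q ^ k)\<^sup>2 * B y y"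
  proof (rule mult_mono[OF power_mono tt])
    have "1 / c = 2 / (z ^ k + q ^ k)" using c by (simp add: c_def)
    also have "\<dots> \<le> 2 / z ^ k" using z q by (intro divide_left_mono) (auto intro!: add_pos_pos mult_pos_pos)
    also have "\<dots> = 2 * q ^ k" by (simp add: z_def power_divide)
    finally show "1 / c \<le> 2 * q ^ k" .
  qed (use c B_nonneg t(1) in auto)
  finally have "B (y - (1 / c) *s* v) (y - (1 / c) *s* v) \<le> (2 * q ^ k)\<^sup>2 * B y y" .
  moreover have "(1 / c) *s* v \<in> ?K k" using v(1) by (intro K)
  ultimately show ?thesis by blast
qed

end


section \<open>Integration of mesh-wise continuous functions\<close>

definition ocell :: "nat \<Rightarrow> idx \<Rightarrow> pt set" where
  "ocell n e = interior (cell (1 / real n) e)"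

lemma cell_alt:
  assumes "0 < n"
  shows "x \<in> cell (1 / real n) e \<longleftrightarrow>
    real (fst e) \<le> fst x * real n \<and> fst x * real n \<le> real (fst e) + 1 \<and>
    real (snd e) \<le> snd x * real n \<and> snd x * real n \<le> real (snd e) + 1"
  using assms by (cases x) (auto simp: cell_def cbox_Pair_eq field_simps)

lemma ocell_alt:
  assumes "0 < n"
  shows "x \<in> ocell n e \<longleftrightarrow>
    real (fst e) < fst x * real n \<and> fst x * real n < real (fst e) + 1 \<and>
    real (snd e) < snd x * real n \<and> snd x * real n < real (snd e) + 1"
  using assms by (cases x) (auto simp: ocell_def cell_def cbox_Pair_eq interior_Times box_real field_simps)

lemma ocell_unique: "0 < n \<Longrightarrow> x \<in> ocell n e \<Longrightarrow> x \<in> ocell n e' \<Longrightarrow> e = e'"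
  by (cases e; cases e') (auto simp: ocell_alt)

lemma ocell_subset_cell: "ocell n e \<subseteq> cell (1 / real n) e"
  by (simp add: ocell_def interior_subset)

lemma ocell_lmeasurable: "ocell n e \<in> lmeasurable"
  by (auto simp: ocell_def cell_def interior_cbox intro: lmeasurable_box)

definition off_grid :: "nat \<Rightarrow> pt \<Rightarrow> bool" where
  "off_grid n x \<longleftrightarrow> fst x * real n \<notin> \<int> \<and> snd x * real n \<notin> \<int>"

lemma off_grid_AE:
  assumes "0 < n"
  shows "AE x in lebesgue. off_grid n x"
proof -
  have "{x. \<not> off_grid n x} \<subseteq> (\<Union>k\<in>(\<int>::real set). {x. inner x ((1, 0) :: pt) = k / real n})
     \<union> (\<Union>k\<in>(\<int>::real set). {x. inner x ((0, 1) :: pt) = k / real n})"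
    using assms by (auto simp: off_grid_def field_simps)
  moreover have "countable (\<int> :: real set)" unfolding Ints_def by auto
  then have "negligible (\<Union>((\<lambda>k. {x. inner x ((1, 0) :: pt) = k / real n}) ` (\<int>::real set)))"
    "negligible (\<Union>((\<lambda>k. {x. inner x ((0, 1) :: pt) = k / real n}) ` (\<int>::real set)))"
    by (intro negligible_countable_Union; auto simp: Basis_prod_def intro!: negligible_standard_hyperplane)+
  ultimately have "negligible {x. \<not> off_grid n x}"
    using negligible_Un negligible_subset by blast
  then show ?thesis by (intro AE_I'[of "{x. \<not> off_grid n x}"]) (auto simp: negligible_iff_null_sets)
qed

text \<open>Membership is compared only off the grid lines, a null set. This one notion therefore
  covers the open domain, the closed coarse squares and single open cells.\<close>

definition mesh_region :: "nat \<Rightarrow> pt set \<Rightarrow> idx set \<Rightarrow> bool" where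
  "mesh_region n D Q \<longleftrightarrow> 0 < n \<and> Q \<subseteq> elems n \<and>
     (\<forall>x. off_grid n x \<longrightarrow> (x \<in> D \<longleftrightarrow> (\<exists>e\<in>Q. x \<in> ocell n e)))"

lemma finite_elems: "finite (elems n)" by (simp add: elems_def)

lemma mesh_region_indicator:
  assumes D: "mesh_region n D Q" and x: "off_grid n x"
  shows "(indicator D x :: real) = (\<Sum>e\<in>Q. indicator (ocell n e) x)"
proof -
  have fin: "finite Q" "0 < n" using D finite_elems finite_subset by (auto simp: mesh_region_def)
  show ?thesis
  proof (cases "x \<in> D")
    case True
    then obtain e where e: "e \<in> Q" "x \<in> ocell n e" using D x unfolding mesh_region_def by blast
    have "(\<Sum>e'\<in>Q. indicator (ocell n e') x :: real) = (\<Sum>e'\<in>Q. if e' = e then 1 else 0)"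
    proof (intro sum.cong refl)
      show "(indicator (ocell n e') x :: real) = (if e' = e then 1 else 0)" for e'
        using ocell_unique[OF fin(2) e(2), of e'] e(2) by (cases "e' = e") (auto simp: indicator_def)
    qed
    then show ?thesis using True e fin by simp
  next
    case False
    then have "e \<in> Q \<Longrightarrow> x \<notin> ocell n e" for e using D x unfolding mesh_region_def by blast
    then show ?thesis using False by (auto simp: indicator_def)
  qed
qed

lemma mesh_region_cell:
  assumes "0 < n" "e \<in> elems n"
  shows "mesh_region n (ocell n e) {e}"
  using assms by (auto simp: mesh_region_def)

lemma mesh_region_\<Omega>:
  assumes n: "0 < n"
  shows "mesh_region n \<Omega> (elems n)"
proof -
  have "x \<in> \<Omega> \<longleftrightarrow> (\<exists>e\<in>elems n. x \<in> ocell n e)" if g: "off_grid n x" for x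
  proof
    assume "x \<in> \<Omega>"
    then have x: "0 < fst x" "fst x < 1" "0 < snd x" "snd x < 1"
      by (cases x; auto simp: \<Omega>_def box_prod box_real)+
    define e where "e = (nat \<lfloor>fst x * real n\<rfloor>, nat \<lfloor>snd x * real n\<rfloor>)"
    have ne: "fst x * real n \<noteq> of_int \<lfloor>fst x * real n\<rfloor>" "snd x * real n \<noteq> of_int \<lfloor>snd x * real n\<rfloor>"
      using g unfolding off_grid_def by (metis Ints_of_int)+
    have p: "0 \<le> \<lfloor>fst x * real n\<rfloor>" "0 \<le> \<lfloor>snd x * real n\<rfloor>" using x by auto
    have b: "fst x * real n < real n" "snd x * real n < real n" using x n by auto
    have e': "real (fst e) = of_int \<lfloor>fst x * real n\<rfloor>" "real (snd e) = of_int \<lfloor>snd x * real n\<rfloor>"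
      using p by (auto simp: e_def)
    have "x \<in> ocell n e"
      unfolding ocell_alt[OF n] e' using ne
        of_int_floor_le[of "fst x * real n"] real_of_int_floor_add_one_gt[of "fst x * real n"]
        of_int_floor_le[of "snd x * real n"] real_of_int_floor_add_one_gt[of "snd x * real n"]
      by (auto simp: order_less_le)
    moreover have "e \<in> elems n"
    proof -
      have "real (fst e) < real n" "real (snd e) < real n"
        unfolding e' using b of_int_floor_le order_le_less_trans by blast+
      then show ?thesis by (cases e) (auto simp: elems_def)
    qed
    ultimately show "\<exists>e\<in>elems n. x \<in> ocell n e" by blast
  next
    assume "\<exists>e\<in>elems n. x \<in> ocell n e"
    then obtain e where e: "e \<in> elems n" "x \<in> ocell n e" by auto
    then have "real (fst e) + 1 \<le> real n" "real (snd e) + 1 \<le> real n"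
      by (cases e; auto simp: elems_def)+
    then have "0 < fst x * real n" "fst x * real n < 1 * real n" "0 < snd x * real n" "snd x * real n < 1 * real n"
      using e(2) unfolding ocell_alt[OF n] by linarith+
    then have "0 < fst x" "fst x < 1" "0 < snd x" "snd x < 1"
      using n by (auto simp: zero_less_mult_iff)
    then show "x \<in> \<Omega>" by (cases x) (auto simp: \<Omega>_def box_prod box_real)
  qed
  then show ?thesis using n by (auto simp: mesh_region_def)
qed

text \<open>The globally continuous representative gives boundedness on the closed cell, hence
  integrability; values on the grid lines stay free because gradients jump there.\<close>

definition pw_cont :: "nat \<Rightarrow> fn \<Rightarrow> bool" where
  "pw_cont n g \<longleftrightarrow> (\<forall>e\<in>elems n. \<exists>p. continuous_on UNIV p \<and> (\<forall>x\<in>ocell n e. g x = p x))"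

lemma pw_cont_const [intro, simp]: "pw_cont n (\<lambda>_. c)"
  unfolding pw_cont_def by (auto intro!: exI[of _ "\<lambda>_. c"])

lemma pw_cont_add [intro]:
  assumes "pw_cont n f" "pw_cont n g" shows "pw_cont n (\<lambda>x. f x + g x)"
  unfolding pw_cont_def
proof
  fix e assume "e \<in> elems n"
  then obtain p q where "continuous_on UNIV p" "\<forall>x\<in>ocell n e. f x = p x"
    "continuous_on UNIV q" "\<forall>x\<in>ocell n e. g x = q x" using assms unfolding pw_cont_def by metis
  then show "\<exists>p. continuous_on UNIV p \<and> (\<forall>x\<in>ocell n e. f x + g x = p x)"
    by (intro exI[of _ "\<lambda>x. p x + q x"]) (auto intro: continuous_intros)
qed

lemma pw_cont_mult [intro]:
  assumes "pw_cont n f" "pw_cont n g" shows "pw_cont n (\<lambda>x. f x * g x)"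
  unfolding pw_cont_def
proof
  fix e assume "e \<in> elems n"
  then obtain p q where "continuous_on UNIV p" "\<forall>x\<in>ocell n e. f x = p x"
    "continuous_on UNIV q" "\<forall>x\<in>ocell n e. g x = q x" using assms unfolding pw_cont_def by metis
  then show "\<exists>p. continuous_on UNIV p \<and> (\<forall>x\<in>ocell n e. f x * g x = p x)"
    by (intro exI[of _ "\<lambda>x. p x * q x"]) (auto intro: continuous_intros)
qed

lemma pw_cont_power2 [intro]: "pw_cont n f \<Longrightarrow> pw_cont n (\<lambda>x. (f x)\<^sup>2)"
  unfolding power2_eq_square by (rule pw_cont_mult)

text \<open>All that the estimates use of a piecewise constant coefficient. The bounds hold almost
  everywhere, so the pieces may cut through cells and leave a null set uncovered.\<close>

locale coefficient =
  fixes \<kappa> :: fn and \<beta> :: real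
  assumes \<kappa>_meas: "(\<lambda>x. indicator \<Omega> x * \<kappa> x) \<in> borel_measurable lebesgue"
    and \<kappa>_bounds: "AE x in lebesgue. x \<in> \<Omega> \<longrightarrow> 1 \<le> \<kappa> x \<and> \<kappa> x \<le> \<beta>"
begin

lemma cell_integrable:
  assumes n: "0 < n" and e: "e \<in> elems n" and p: "continuous_on UNIV (p :: fn)"
  shows "integrable lebesgue (\<lambda>x. indicator (ocell n e) x * (\<kappa> x * p x))"
proof -
  have "compact (cell (1 / real n) e)" by (simp add: cell_def compact_cbox)
  then have "bounded (p ` cell (1 / real n) e)"
    using compact_continuous_image continuous_on_subset[OF p subset_UNIV] compact_imp_bounded by blast
  then obtain c where "\<And>x. x \<in> cell (1 / real n) e \<Longrightarrow> \<bar>p x\<bar> \<le> c"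
    unfolding bounded_iff by (auto simp: image_iff)
  then have c: "x \<in> ocell n e \<Longrightarrow> \<bar>p x\<bar> \<le> c" for x using ocell_subset_cell by blast
  \<comment> \<open>\<open>\<kappa>\<close> is controlled only inside the domain, and an open cell
    is shown to lie there off the grid lines; this is enough almost everywhere.\<close>
  have sub: "ocell n e \<inter> {x. off_grid n x} \<subseteq> \<Omega>"
    using mesh_region_\<Omega>[OF n] e unfolding mesh_region_def by blast
  show ?thesis
  proof (rule Bochner_Integration.integrable_bound)
    show "integrable lebesgue (\<lambda>x. (\<beta> * c) * indicator (ocell n e) x)"
      using ocell_lmeasurable[of n e]
      by (intro integrable_mult_right) (auto simp: fmeasurable_def)
    have "p \<in> borel_measurable lebesgue"
      using borel_measurable_continuous_onI[OF p] by (auto intro: measurable_completion)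
    then have "(\<lambda>x. indicator (ocell n e) x * ((indicator \<Omega> x * \<kappa> x) * p x)) \<in> borel_measurable lebesgue"
      using ocell_lmeasurable[of n e]
      by (intro borel_measurable_times[OF borel_measurable_indicator borel_measurable_times[OF \<kappa>_meas]]) auto
    moreover have "AE x in lebesgue. indicator (ocell n e) x * ((indicator \<Omega> x * \<kappa> x) * p x)
        = indicator (ocell n e) x * (\<kappa> x * p x)"
      using off_grid_AE[OF n] by eventually_elim (use sub in \<open>auto simp: indicator_def\<close>)
    ultimately show "(\<lambda>x. indicator (ocell n e) x * (\<kappa> x * p x)) \<in> borel_measurable lebesgue"
      by (rule borel_measurable_AE)
    show "AE x in lebesgue. norm (indicator (ocell n e) x * (\<kappa> x * p x))
        \<le> norm ((\<beta> * c) * indicator (ocell n e) x)"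
      using off_grid_AE[OF n] \<kappa>_bounds
    proof eventually_elim
      case (elim x)
      show ?case
      proof (cases "x \<in> ocell n e")
        case True
        then have "1 \<le> \<kappa> x" "\<kappa> x \<le> \<beta>" "\<bar>p x\<bar> \<le> c" using elim sub c by auto
        then have "\<bar>\<kappa> x\<bar> * \<bar>p x\<bar> \<le> \<beta> * c" by (intro mult_mono) auto
        then have "\<bar>\<kappa> x\<bar> * \<bar>p x\<bar> \<le> \<bar>\<beta> * c\<bar>" by linarith
        then show ?thesis using True by (auto simp: abs_mult)
      qed auto
    qed
  qed
qed

lemma region_integral_aux:
  assumes D: "mesh_region n D Q" and g: "pw_cont n g"
  shows "set_integrable lebesgue D (\<lambda>x. \<kappa> x * g x) \<and>
    (LINT x:D|lebesgue. \<kappa> x * g x) = (\<Sum>e\<in>Q. LINT x:ocell n e|lebesgue. \<kappa> x * g x)"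
proof -
  have n: "0 < n" and Q: "Q \<subseteq> elems n" using D by (auto simp: mesh_region_def)
  have I: "integrable lebesgue (\<lambda>x. indicator (ocell n e) x * (\<kappa> x * g x))" if "e \<in> Q" for e
  proof -
    have e: "e \<in> elems n" using Q that by auto
    obtain p where p: "continuous_on UNIV p" "\<And>x. x \<in> ocell n e \<Longrightarrow> g x = p x"
      using g e unfolding pw_cont_def by metis
    have "(\<lambda>x. indicator (ocell n e) x * (\<kappa> x * g x)) = (\<lambda>x. indicator (ocell n e) x * (\<kappa> x * p x))"
      using p(2) by (auto simp: indicator_def fun_eq_iff)
    then show ?thesis using cell_integrable[OF n e p(1)] by simp
  qed
  have int: "integrable lebesgue (\<lambda>x. \<Sum>e\<in>Q. indicator (ocell n e) x * (\<kappa> x * g x))"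
    using I by (intro Bochner_Integration.integrable_sum)
  have ae: "AE x in lebesgue. (\<Sum>e\<in>Q. indicator (ocell n e) x * (\<kappa> x * g x)) = indicator D x * (\<kappa> x * g x)"
    using off_grid_AE[OF n]
    by eventually_elim (simp add: mesh_region_indicator[OF D] sum_distrib_right)
  have meas: "(\<lambda>x. indicator D x * (\<kappa> x * g x)) \<in> borel_measurable lebesgue"
    using borel_measurable_AE[OF borel_measurable_integrable[OF int] ae] .
  have "integrable lebesgue (\<lambda>x. indicator D x * (\<kappa> x * g x))"
    using int ae meas borel_measurable_integrable[OF int] integrable_cong_AE by blast
  moreover have "(LINT x|lebesgue. indicator D x * (\<kappa> x * g x))
      = (LINT x|lebesgue. (\<Sum>e\<in>Q. indicator (ocell n e) x * (\<kappa> x * g x)))"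
    using ae by (intro integral_cong_AE meas borel_measurable_integrable[OF int]) (auto simp: eq_commute)
  moreover have "\<dots> = (\<Sum>e\<in>Q. LINT x|lebesgue. indicator (ocell n e) x * (\<kappa> x * g x))"
    using I by (intro Bochner_Integration.integral_sum)
  ultimately show ?thesis by (simp add: set_integrable_def set_lebesgue_integral_def)
qed

lemmas region_integrable = region_integral_aux[THEN conjunct1]
lemmas region_integral = region_integral_aux[THEN conjunct2]

lemma region_integral_cong:
  assumes D: "mesh_region n D Q" and f: "pw_cont n f" and g: "pw_cont n g"
    and eq: "\<And>e x. e \<in> Q \<Longrightarrow> x \<in> ocell n e \<Longrightarrow> f x = g x"
  shows "(LINT x:D|lebesgue. \<kappa> x * f x) = (LINT x:D|lebesgue. \<kappa> x * g x)"
  unfolding region_integral[OF D f] region_integral[OF D g]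
  by (intro sum.cong) (auto simp: eq set_lebesgue_integral_def indicator_def intro!: Bochner_Integration.integral_cong)

lemma region_integral_add:
  assumes "mesh_region n D Q" "pw_cont n f" "pw_cont n g"
  shows "(LINT x:D|lebesgue. \<kappa> x * (f x + g x)) =
    (LINT x:D|lebesgue. \<kappa> x * f x) + (LINT x:D|lebesgue. \<kappa> x * g x)"
  using set_integral_add(2)[OF region_integrable region_integrable, OF assms(1,2,1,3)]
  by (simp add: algebra_simps)

lemma region_integral_scale:
  "(LINT x:D|lebesgue. \<kappa> x * (c * f x)) = c * (LINT x:D|lebesgue. \<kappa> x * f x)"
  by (simp add: mult.left_commute[of _ c])

lemma region_off_grid: "mesh_region n D Q \<Longrightarrow> off_grid n x \<Longrightarrow> x \<in> D \<Longrightarrow> \<exists>e\<in>Q. x \<in> ocell n e"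
  unfolding mesh_region_def by blast

lemma region_in_\<Omega>: "mesh_region n D Q \<Longrightarrow> off_grid n x \<Longrightarrow> x \<in> D \<Longrightarrow> x \<in> \<Omega>"
  using mesh_region_\<Omega>[of n] unfolding mesh_region_def by blast

lemma region_integral_AE_mono:
  assumes D: "mesh_region n D Q" and f: "set_integrable lebesgue D f" and g: "set_integrable lebesgue D g"
    and le: "\<And>e x. e \<in> Q \<Longrightarrow> x \<in> ocell n e \<Longrightarrow> 1 \<le> \<kappa> x \<Longrightarrow> \<kappa> x \<le> \<beta> \<Longrightarrow> f x \<le> (g x :: real)"
  shows "(LINT x:D|lebesgue. f x) \<le> (LINT x:D|lebesgue. g x)"
proof (rule set_integral_mono_AE[OF f g])
  have n: "0 < n" using D by (simp add: mesh_region_def)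
  show "AE x\<in>D in lebesgue. f x \<le> g x"
    using off_grid_AE[OF n] \<kappa>_bounds
    by eventually_elim (use le region_off_grid[OF D] region_in_\<Omega>[OF D] in metis)
qed

lemma region_integral_nonneg:
  assumes "mesh_region n D Q" "pw_cont n g" "\<And>e x. e \<in> Q \<Longrightarrow> x \<in> ocell n e \<Longrightarrow> 0 \<le> g x"
  shows "0 \<le> (LINT x:D|lebesgue. \<kappa> x * g x)"
proof -
  have "(LINT x:D|lebesgue. \<kappa> x * 0) \<le> (LINT x:D|lebesgue. \<kappa> x * g x)"
    using assms region_integrable[OF assms(1)] by (intro region_integral_AE_mono[OF assms(1)]) auto
  then show ?thesis by simp
qed

end

text \<open>With coefficient 1 the unweighted integrals become instances of the weighted ones, so
  that additivity and cell decomposition are proved once.\<close>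

interpretation unit_coeff: coefficient "\<lambda>_. 1" 1
  by unfold_locales (auto intro!: borel_measurable_indicator simp: \<Omega>_def)

section \<open>Comparison of weighted and unweighted integrals\<close>

context coefficient
begin

lemma region_integral_lower:
  assumes D: "mesh_region n D Q" "pw_cont n g" "\<And>e x. e \<in> Q \<Longrightarrow> x \<in> ocell n e \<Longrightarrow> 0 \<le> g x"
  shows "(LINT x:D|lebesgue. g x) \<le> (LINT x:D|lebesgue. \<kappa> x * g x)"
proof (rule region_integral_AE_mono[OF D(1)])
  show "set_integrable lebesgue D g" using unit_coeff.region_integrable[OF D(1,2)] by simp
  show "g x \<le> \<kappa> x * g x" if "e \<in> Q" "x \<in> ocell n e" "1 \<le> \<kappa> x" for e x
    using mult_right_mono[OF that(3) D(3)[OF that(1,2)]] by simp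
qed (rule region_integrable[OF D(1,2)])

lemma region_integral_upper:
  assumes D: "mesh_region n D Q" "pw_cont n g" "\<And>e x. e \<in> Q \<Longrightarrow> x \<in> ocell n e \<Longrightarrow> 0 \<le> g x"
  shows "(LINT x:D|lebesgue. \<kappa> x * g x) \<le> \<beta> * (LINT x:D|lebesgue. g x)"
proof -
  have "(LINT x:D|lebesgue. \<kappa> x * g x) \<le> (LINT x:D|lebesgue. \<beta> * g x)"
  proof (rule region_integral_AE_mono[OF D(1)])
    show "set_integrable lebesgue D (\<lambda>x. \<beta> * g x)" using unit_coeff.region_integrable[OF D(1,2)] by simp
    show "\<kappa> x * g x \<le> \<beta> * g x" if "e \<in> Q" "x \<in> ocell n e" "\<kappa> x \<le> \<beta>" for e x
      using mult_right_mono[OF that(3) D(3)[OF that(1,2)]] by simp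
  qed (rule region_integrable[OF D(1,2)])
  then show ?thesis by simp
qed

lemma region_integral_split:
  assumes D: "mesh_region n D Q" and E: "\<And>i. i \<in> I \<Longrightarrow> mesh_region n (E i) (P i)"
    and fin: "finite I" and disj: "\<And>i j. i \<in> I \<Longrightarrow> j \<in> I \<Longrightarrow> i \<noteq> j \<Longrightarrow> P i \<inter> P j = {}"
    and un: "Q = (\<Union>i\<in>I. P i)" and g: "pw_cont n g"
  shows "(LINT x:D|lebesgue. \<kappa> x * g x) = (\<Sum>i\<in>I. LINT x:E i|lebesgue. \<kappa> x * g x)"
proof -
  have "finite (P i)" if "i \<in> I" for i
    using E[OF that] finite_elems finite_subset by (auto simp: mesh_region_def)
  then show ?thesis
    unfolding region_integral[OF D g] un using fin disj
    by (subst sum.UNION_disjoint) (auto intro!: sum.cong simp: region_integral[OF E g])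
qed

end

lemma pw_const_coeff_coefficient:
  assumes "pw_const_coeff \<kappa> \<beta>"
  shows "coefficient \<kappa> \<beta>"
proof -
  obtain P where P: "finite P" "disjoint P"
      "\<And>D. D \<in> P \<Longrightarrow> D \<subseteq> \<Omega> \<and> D \<in> sets lebesgue \<and> measure lebesgue D > 0 \<and> \<kappa> constant_on D"
      "negligible (\<Omega> - \<Union>P)" "Min (\<kappa> ` \<Union>P) = 1" "Max (\<kappa> ` \<Union>P) = \<beta>"
    using assms unfolding pw_const_coeff_def by metis
  obtain c where c: "\<And>D x. D \<in> P \<Longrightarrow> x \<in> D \<Longrightarrow> \<kappa> x = c D"
    using P(3) unfolding constant_on_def by metis
  \<comment> \<open>\<open>Min\<close> and \<open>Max\<close> carry information only on a finite
    set; \<open>\<kappa>\<close> takes one value per piece.\<close>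
  have fin: "finite (\<kappa> ` \<Union>P)"
    by (rule finite_subset[of _ "c ` P"]) (use c P(1) in auto)
  have ae: "AE x in lebesgue. x \<in> \<Omega> \<longrightarrow> x \<in> \<Union>P"
    using P(4) by (intro AE_I'[of "\<Omega> - \<Union>P"]) (auto simp: negligible_iff_null_sets)
  have bd: "1 \<le> \<kappa> x" "\<kappa> x \<le> \<beta>" if "x \<in> \<Union>P" for x
    using fin that P(5,6) Min_le[OF fin, of "\<kappa> x"] Max_ge[OF fin, of "\<kappa> x"] by auto
  \<comment> \<open>On the uncovered null set \<open>\<kappa>\<close> is arbitrary; measurability
    passes from the simple function to \<open>\<kappa>\<close> because Lebesgue measure is
    complete.\<close>
  have "(\<lambda>x. indicator \<Omega> x * \<kappa> x) \<in> borel_measurable lebesgue"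
  proof (rule borel_measurable_AE)
    show "(\<lambda>x. \<Sum>D\<in>P. indicator D x * c D) \<in> borel_measurable lebesgue"
      using P(3) by (intro borel_measurable_sum borel_measurable_times borel_measurable_indicator) auto
    show "AE x in lebesgue. (\<Sum>D\<in>P. indicator D x * c D) = indicator \<Omega> x * \<kappa> x"
      using ae
    proof eventually_elim
      case (elim x)
      show ?case
      proof (cases "x \<in> \<Omega>")
        case True
        then obtain D where D: "D \<in> P" "x \<in> D" using elim by auto
        have "(\<Sum>D'\<in>P. indicator D' x * c D') = (\<Sum>D'\<in>P. if D' = D then c D else 0)"
          using D P(2) by (intro sum.cong) (auto simp: indicator_def disjoint_def)
        then show ?thesis using D P(1) c True by simp
      next
        case False
        then have "\<And>D. D \<in> P \<Longrightarrow> x \<notin> D" using P(3) by blast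
        then show ?thesis using False by simp
      qed
    qed
  qed
  then show ?thesis
    using eventually_mono[OF ae, of "\<lambda>x. x \<in> \<Omega> \<longrightarrow> 1 \<le> \<kappa> x \<and> \<kappa> x \<le> \<beta>"] bd by unfold_locales blast+
qed

section \<open>Mesh-wise bilinear functions and their forms\<close>

text \<open>No continuity is imposed and nothing on grid lines, so that this common carrier contains
  the finite element functions as well as their restrictions to coarse squares extended by
  zero.\<close>

definition pw_bilinear :: "nat \<Rightarrow> fn set" where
  "pw_bilinear n = {v. \<forall>e\<in>elems n. bilinear_on (ocell n e) v}"

lemma bilinear_on_alt:
  "bilinear_on T v \<longleftrightarrow> (\<exists>c0 c1 c2 c3. \<forall>z\<in>T. v z = c0 + c1 * fst z + c2 * snd z + c3 * fst z * snd z)"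
  unfolding bilinear_on_def by (simp add: split_beta)

lemma pw_bilinearE:
  assumes "v \<in> pw_bilinear n" "e \<in> elems n"
  obtains c0 c1 c2 c3 where "\<forall>z\<in>ocell n e. v z = c0 + c1 * fst z + c2 * snd z + c3 * fst z * snd z"
proof -
  have "bilinear_on (ocell n e) v" using assms unfolding pw_bilinear_def by blast
  then show thesis unfolding bilinear_on_alt using that by blast
qed

lemma subspace_pw_bilinear: "fs.subspace (pw_bilinear n)"
  unfolding fs.subspace_def
proof (intro conjI ballI allI)
  show "0 \<in> pw_bilinear n" unfolding pw_bilinear_def bilinear_on_alt
    by (auto intro!: exI[of _ 0])
next
  fix v w assume mem: "v \<in> pw_bilinear n" "w \<in> pw_bilinear n"
  show "v + w \<in> pw_bilinear n"
    unfolding pw_bilinear_def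
  proof (intro CollectI ballI)
    fix e assume e: "e \<in> elems n"
    obtain c0 c1 c2 c3 where c: "\<forall>z\<in>ocell n e. v z = c0 + c1 * fst z + c2 * snd z + c3 * fst z * snd z"
      using pw_bilinearE[OF mem(1) e] .
    obtain d0 d1 d2 d3 where d: "\<forall>z\<in>ocell n e. w z = d0 + d1 * fst z + d2 * snd z + d3 * fst z * snd z"
      using pw_bilinearE[OF mem(2) e] .
    show "bilinear_on (ocell n e) (v + w)"
      unfolding bilinear_on_alt
      by (intro exI[of _ "c0 + d0"] exI[of _ "c1 + d1"] exI[of _ "c2 + d2"] exI[of _ "c3 + d3"])
        (use c d in \<open>auto simp: algebra_simps\<close>)
  qed
next
  fix c v assume mem: "v \<in> pw_bilinear n"
  show "c *\<^sub>f v \<in> pw_bilinear n"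
    unfolding pw_bilinear_def
  proof (intro CollectI ballI)
    fix e assume e: "e \<in> elems n"
    obtain c0 c1 c2 c3 where "\<forall>z\<in>ocell n e. v z = c0 + c1 * fst z + c2 * snd z + c3 * fst z * snd z"
      using pw_bilinearE[OF mem e] .
    then show "bilinear_on (ocell n e) (c *\<^sub>f v)"
      unfolding bilinear_on_alt
      by (intro exI[of _ "c * c0"] exI[of _ "c * c1"] exI[of _ "c * c2"] exI[of _ "c * c3"])
        (auto simp: algebra_simps fscale_def)
  qed
qed

lemma has_partial_derivs:
  assumes v: "\<forall>z\<in>ocell n e. v z = c0 + c1 * fst z + c2 * snd z + c3 * fst z * snd z"
    and z: "z \<in> ocell n e"
  shows "((\<lambda>t. v (t, snd z)) has_real_derivative (c1 + c3 * snd z)) (at (fst z))"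
    "((\<lambda>t. v (fst z, t)) has_real_derivative (c2 + c3 * fst z)) (at (snd z))"
proof -
  have op: "open (ocell n e)" by (simp add: ocell_def)
  have z': "(fst z, snd z) \<in> ocell n e" using z by simp
  have op': "open ((\<lambda>t. (t, snd z)) -` ocell n e)" "open ((\<lambda>t. (fst z, t)) -` ocell n e)"
    by (intro open_vimage op continuous_intros)+
  have d: "((\<lambda>t. c0 + c1 * t + c2 * snd z + c3 * t * snd z) has_real_derivative (c1 + c3 * snd z)) (at (fst z))"
    "((\<lambda>t. c0 + c1 * fst z + c2 * t + c3 * fst z * t) has_real_derivative (c2 + c3 * fst z)) (at (snd z))"
    by (auto intro!: derivative_eq_intros)
  show "((\<lambda>t. v (t, snd z)) has_real_derivative (c1 + c3 * snd z)) (at (fst z))"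
    by (rule has_field_derivative_transform_within_open[OF d(1) op'(1)]) (use z' v in auto)
  show "((\<lambda>t. v (fst z, t)) has_real_derivative (c2 + c3 * fst z)) (at (snd z))"
    by (rule has_field_derivative_transform_within_open[OF d(2) op'(2)]) (use z' v in auto)
qed

lemma grad_cell:
  assumes "\<forall>z\<in>ocell n e. v z = c0 + c1 * fst z + c2 * snd z + c3 * fst z * snd z" "z \<in> ocell n e"
  shows "grad v z = (c1 + c3 * snd z, c2 + c3 * fst z)"
  using has_partial_derivs[OF assms] by (simp add: grad_def DERIV_imp_deriv)

lemma pw_cont_bilinear:
  assumes "v \<in> pw_bilinear n"
  shows "pw_cont n v" "pw_cont n (\<lambda>x. fst (grad v x))" "pw_cont n (\<lambda>x. snd (grad v x))"
proof -
  show "pw_cont n v" unfolding pw_cont_def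
  proof
    fix e assume e: "e \<in> elems n"
    obtain c0 c1 c2 c3 where "\<forall>z\<in>ocell n e. v z = c0 + c1 * fst z + c2 * snd z + c3 * fst z * snd z"
      using pw_bilinearE[OF assms e] .
    then show "\<exists>p. continuous_on UNIV p \<and> (\<forall>x\<in>ocell n e. v x = p x)"
      by (intro exI[of _ "\<lambda>x. c0 + c1 * fst x + c2 * snd x + c3 * fst x * snd x"])
        (auto intro!: continuous_intros)
  qed
  show "pw_cont n (\<lambda>x. fst (grad v x))" unfolding pw_cont_def
  proof
    fix e assume e: "e \<in> elems n"
    obtain c0 c1 c2 c3 where "\<forall>z\<in>ocell n e. v z = c0 + c1 * fst z + c2 * snd z + c3 * fst z * snd z"
      using pw_bilinearE[OF assms e] .
    then show "\<exists>p. continuous_on UNIV p \<and> (\<forall>x\<in>ocell n e. fst (grad v x) = p x)"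
      by (intro exI[of _ "\<lambda>x. c1 + c3 * snd x"]) (auto intro!: continuous_intros simp: grad_cell)
  qed
  show "pw_cont n (\<lambda>x. snd (grad v x))" unfolding pw_cont_def
  proof
    fix e assume e: "e \<in> elems n"
    obtain c0 c1 c2 c3 where "\<forall>z\<in>ocell n e. v z = c0 + c1 * fst z + c2 * snd z + c3 * fst z * snd z"
      using pw_bilinearE[OF assms e] .
    then show "\<exists>p. continuous_on UNIV p \<and> (\<forall>x\<in>ocell n e. snd (grad v x) = p x)"
      by (intro exI[of _ "\<lambda>x. c2 + c3 * fst x"]) (auto intro!: continuous_intros simp: grad_cell)
  qed
qed

lemma grad_linear:
  assumes v: "v \<in> pw_bilinear n" and w: "w \<in> pw_bilinear n" and e: "e \<in> elems n" and z: "z \<in> ocell n e"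
  shows "grad (v + w) z = grad v z + grad w z" "grad (c *\<^sub>f v) z = c *\<^sub>R grad v z"
proof -
  obtain c0 c1 c2 c3 where c: "\<forall>z\<in>ocell n e. v z = c0 + c1 * fst z + c2 * snd z + c3 * fst z * snd z"
    using pw_bilinearE[OF v e] .
  obtain d0 d1 d2 d3 where d: "\<forall>z\<in>ocell n e. w z = d0 + d1 * fst z + d2 * snd z + d3 * fst z * snd z"
    using pw_bilinearE[OF w e] .
  have "grad (v + w) z = ((c1 + d1) + (c3 + d3) * snd z, (c2 + d2) + (c3 + d3) * fst z)"
    by (rule grad_cell[of _ _ _ "c0 + d0", OF _ z]) (use c d in \<open>auto simp: algebra_simps\<close>)
  moreover have "grad (c *\<^sub>f v) z = (c * c1 + (c * c3) * snd z, c * c2 + (c * c3) * fst z)"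
    by (rule grad_cell[of _ _ _ "c * c0", OF _ z]) (use c in \<open>auto simp: algebra_simps fscale_def\<close>)
  ultimately show "grad (v + w) z = grad v z + grad w z" "grad (c *\<^sub>f v) z = c *\<^sub>R grad v z"
    using grad_cell[OF c z] grad_cell[OF d z] by (auto simp: algebra_simps)
qed

lemma grad_cong:
  assumes "\<And>x. x \<in> ocell n e \<Longrightarrow> v x = w x" "v \<in> pw_bilinear n" "e \<in> elems n" "z \<in> ocell n e"
  shows "grad v z = grad w z"
proof -
  obtain c0 c1 c2 c3 where c: "\<forall>z\<in>ocell n e. v z = c0 + c1 * fst z + c2 * snd z + c3 * fst z * snd z"
    using pw_bilinearE[OF assms(2,3)] .
  then have "\<forall>z\<in>ocell n e. w z = c0 + c1 * fst z + c2 * snd z + c3 * fst z * snd z"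
    using assms(1) by auto
  from grad_cell[OF this assms(4)] show ?thesis using grad_cell[OF c assms(4)] by simp
qed

lemma pw_cont_grad_inner:
  assumes "v \<in> pw_bilinear n" "w \<in> pw_bilinear n"
  shows "pw_cont n (\<lambda>x. inner (grad v x) (grad w x))"
  unfolding inner_prod_def inner_real_def
  using assms by (intro pw_cont_add pw_cont_mult pw_cont_bilinear)

definition mass :: "fn \<Rightarrow> pt set \<Rightarrow> fn \<Rightarrow> fn \<Rightarrow> real" where
  "mass \<kappa> D v w = (LINT x:D|lebesgue. \<kappa> x * (v x * w x))"

lemma s_form_mass: "s_form N \<kappa> i v w = (real N)\<^sup>2 * mass \<kappa> (K N i) v w"
  by (simp add: s_form_def mass_def mult.assoc)

context coefficient
begin

lemma semi_inner_energy:
  assumes D: "mesh_region n D Q"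
  shows "semi_inner fscale (pw_bilinear n) (energy \<kappa> D)"
proof -
  have Q: "\<And>e. e \<in> Q \<Longrightarrow> e \<in> elems n" using D by (auto simp: mesh_region_def)
  note sub = subspace_pw_bilinear[THEN fs.subspace_add] subspace_pw_bilinear[THEN fs.subspace_scale]
  show ?thesis
  proof unfold_locales
    show "fs.subspace (pw_bilinear n)" by (rule subspace_pw_bilinear)
    fix x y z assume mem: "x \<in> pw_bilinear n" "z \<in> pw_bilinear n"
    show "energy \<kappa> D (c *\<^sub>f x) z = c * energy \<kappa> D x z" for c
    proof -
      have "energy \<kappa> D (c *\<^sub>f x) z = (LINT t:D|lebesgue. \<kappa> t * (c * inner (grad x t) (grad z t)))"
        unfolding energy_def
      proof (intro region_integral_cong[OF D] pw_cont_mult pw_cont_const pw_cont_grad_inner mem sub)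
        fix e t assume e: "e \<in> Q" "t \<in> ocell n e"
        show "inner (grad (c *\<^sub>f x) t) (grad z t) = c * inner (grad x t) (grad z t)"
          using grad_linear(2)[OF mem(1,1) Q[OF e(1)] e(2), of c] by simp
      qed
      then show ?thesis by (simp only: region_integral_scale energy_def)
    qed
    show "energy \<kappa> D x z = energy \<kappa> D z x" by (simp add: energy_def inner_commute)
    show "0 \<le> energy \<kappa> D x x" unfolding energy_def
      by (intro region_integral_nonneg[OF D] pw_cont_grad_inner mem) auto
    assume y: "y \<in> pw_bilinear n"
    have "energy \<kappa> D (x + y) z = (LINT t:D|lebesgue. \<kappa> t * (inner (grad x t) (grad z t) + inner (grad y t) (grad z t)))"
      unfolding energy_def
    proof (intro region_integral_cong[OF D] pw_cont_add pw_cont_grad_inner mem y sub)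
      fix e t assume e: "e \<in> Q" "t \<in> ocell n e"
      show "inner (grad (x + y) t) (grad z t) = inner (grad x t) (grad z t) + inner (grad y t) (grad z t)"
        using grad_linear(1)[OF mem(1) y Q[OF e(1)] e(2)] by (simp add: inner_add_left)
    qed
    then show "energy \<kappa> D (x + y) z = energy \<kappa> D x z + energy \<kappa> D y z"
      using region_integral_add[OF D pw_cont_grad_inner pw_cont_grad_inner, OF mem y mem(2)]
      by (simp only: energy_def)
  qed
qed

lemma semi_inner_mass:
  assumes D: "mesh_region n D Q"
  shows "semi_inner fscale (pw_bilinear n) (mass \<kappa> D)"
proof unfold_locales
  show "fs.subspace (pw_bilinear n)" by (rule subspace_pw_bilinear)
  fix x y z assume mem: "x \<in> pw_bilinear n" "z \<in> pw_bilinear n"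
  show "mass \<kappa> D (c *\<^sub>f x) z = c * mass \<kappa> D x z" for c
    by (simp add: mass_def fscale_def mult.assoc region_integral_scale)
  show "mass \<kappa> D x z = mass \<kappa> D z x" by (simp add: mass_def mult.commute)
  show "0 \<le> mass \<kappa> D x x" unfolding mass_def
    by (intro region_integral_nonneg[OF D] pw_cont_mult pw_cont_bilinear mem) auto
  assume y: "y \<in> pw_bilinear n"
  show "mass \<kappa> D (x + y) z = mass \<kappa> D x z + mass \<kappa> D y z"
    using region_integral_add[OF D, of "\<lambda>t. x t * z t" "\<lambda>t. y t * z t"] mem y
    by (simp add: mass_def distrib_right pw_cont_mult pw_cont_bilinear)
qed

lemma energy_cong:
  assumes D: "mesh_region n D Q" and mem: "v \<in> pw_bilinear n" "v' \<in> pw_bilinear n" "w \<in> pw_bilinear n" "w' \<in> pw_bilinear n"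
    and eq: "\<And>e x. e \<in> Q \<Longrightarrow> x \<in> ocell n e \<Longrightarrow> v x = v' x" "\<And>e x. e \<in> Q \<Longrightarrow> x \<in> ocell n e \<Longrightarrow> w x = w' x"
  shows "energy \<kappa> D v w = energy \<kappa> D v' w'"
proof -
  have Q: "\<And>e. e \<in> Q \<Longrightarrow> e \<in> elems n" using D by (auto simp: mesh_region_def)
  show ?thesis unfolding energy_def
  proof (intro region_integral_cong[OF D] pw_cont_grad_inner mem)
    fix e x assume e: "e \<in> Q" "x \<in> ocell n e"
    have "grad v x = grad v' x" "grad w x = grad w' x"
      using grad_cong[OF eq(1)[OF e(1)] mem(1) Q[OF e(1)] e(2)]
        grad_cong[OF eq(2)[OF e(1)] mem(3) Q[OF e(1)] e(2)] by auto
    then show "inner (grad v x) (grad w x) = inner (grad v' x) (grad w' x)" by simp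
  qed
qed

lemma mass_cong:
  assumes D: "mesh_region n D Q" and mem: "v \<in> pw_bilinear n" "v' \<in> pw_bilinear n" "w \<in> pw_bilinear n" "w' \<in> pw_bilinear n"
    and eq: "\<And>e x. e \<in> Q \<Longrightarrow> x \<in> ocell n e \<Longrightarrow> v x = v' x" "\<And>e x. e \<in> Q \<Longrightarrow> x \<in> ocell n e \<Longrightarrow> w x = w' x"
  shows "mass \<kappa> D v w = mass \<kappa> D v' w'"
  unfolding mass_def
  by (intro region_integral_cong[OF D] pw_cont_mult pw_cont_bilinear mem) (use eq in simp)

lemma mass_disjoint:
  assumes D: "mesh_region n D Q" and mem: "v \<in> pw_bilinear n" "w \<in> pw_bilinear n"
    and z: "\<And>e. e \<in> Q \<Longrightarrow> (\<forall>x\<in>ocell n e. v x = 0) \<or> (\<forall>x\<in>ocell n e. w x = 0)"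
  shows "mass \<kappa> D v w = 0"
proof -
  have "mass \<kappa> D v w = (LINT x:D|lebesgue. \<kappa> x * 0)" unfolding mass_def
    by (intro region_integral_cong[OF D] pw_cont_mult pw_cont_bilinear mem pw_cont_const) (use z in fastforce)
  then show ?thesis by simp
qed

lemma energy_disjoint:
  assumes D: "mesh_region n D Q" and mem: "v \<in> pw_bilinear n" "w \<in> pw_bilinear n"
    and z: "\<And>e. e \<in> Q \<Longrightarrow> (\<forall>x\<in>ocell n e. v x = 0) \<or> (\<forall>x\<in>ocell n e. w x = 0)"
  shows "energy \<kappa> D v w = 0"
proof -
  have Q: "\<And>e. e \<in> Q \<Longrightarrow> e \<in> elems n" using D by (auto simp: mesh_region_def)
  have g0: "grad u x = 0" if "\<forall>x\<in>ocell n e. u x = 0" "x \<in> ocell n e" for u e x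
    using grad_cell[of n e u 0 0 0 0] that by (auto simp: zero_prod_def)
  have "energy \<kappa> D v w = (LINT x:D|lebesgue. \<kappa> x * 0)" unfolding energy_def
  proof (intro region_integral_cong[OF D] pw_cont_grad_inner mem pw_cont_const)
    fix e x assume "e \<in> Q" "x \<in> ocell n e"
    then show "inner (grad v x) (grad w x) = 0"
      using z[of e] g0[of e v x] g0[of e w x] by auto
  qed
  then show ?thesis by simp
qed

lemma energy_lower:
  assumes "mesh_region n D Q" "v \<in> pw_bilinear n"
  shows "energy (\<lambda>_. 1) D v v \<le> energy \<kappa> D v v"
  using region_integral_lower[OF assms(1) pw_cont_grad_inner[OF assms(2,2)]] by (simp add: energy_def)

lemma mass_lower:
  assumes "mesh_region n D Q" "v \<in> pw_bilinear n"
  shows "mass (\<lambda>_. 1) D v v \<le> mass \<kappa> D v v"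
  using region_integral_lower[OF assms(1) pw_cont_mult[OF pw_cont_bilinear(1,1)], OF assms(2,2)]
  by (simp add: mass_def)

lemma mass_upper:
  assumes "mesh_region n D Q" "v \<in> pw_bilinear n"
  shows "mass \<kappa> D v v \<le> \<beta> * mass (\<lambda>_. 1) D v v"
  using region_integral_upper[OF assms(1) pw_cont_mult[OF pw_cont_bilinear(1,1)], OF assms(2,2)]
  by (simp add: mass_def)

end


section \<open>Poincare inequalities for bilinear finite elements\<close>

text \<open>The integral over a unit segment of the squared affine function with end values
  \<open>a\<close> and \<open>b\<close>, split into squared mean and variance.\<close>

definition seg_mass :: "real \<Rightarrow> real \<Rightarrow> real" where
  "seg_mass a b = ((a + b) / 2)\<^sup>2 + (b - a)\<^sup>2 / 12"

lemma seg_mass_alt: "seg_mass a b = (a\<^sup>2 + a * b + b\<^sup>2) / 3"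
  by (simp add: seg_mass_def power2_eq_square field_simps)

lemma seg_mass_commute: "seg_mass a b = seg_mass b a"
  by (simp add: seg_mass_alt algebra_simps)

text \<open>On one segment, with \<open>G\<close> the affine function of slope \<open>d\<close> from \<open>a\<close> to \<open>b\<close> and
  \<open>F t = c tan (c (m - t))\<close>, one has \<open>d\<^sup>2 - c\<^sup>2 G\<^sup>2 - (G\<^sup>2 F)' = (d - G F)\<^sup>2\<close>.\<close>

lemma segment_inequality:
  fixes a b c m s :: real
  assumes c: "0 < c" "c * m < pi / 2" and s: "0 \<le> s" "s + 1 \<le> m"
  shows "b\<^sup>2 * (c * tan (c * (m - (s + 1)))) - a\<^sup>2 * (c * tan (c * (m - s)))
    \<le> (b - a)\<^sup>2 - c\<^sup>2 * seg_mass a b"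
proof -
  define d where "d = b - a"
  define G where "G = (\<lambda>t. a + d * (t - s))"
  define F where "F = (\<lambda>t. c * tan (c * (m - t)))"
  define P where "P = (\<lambda>t. a\<^sup>2 * (t - s) + a * d * (t - s)\<^sup>2 + d\<^sup>2 * (t - s) ^ 3 / 3)"
  define \<Psi> where "\<Psi> = (\<lambda>t. d\<^sup>2 * t - c\<^sup>2 * P t - (G t)\<^sup>2 * F t)"
  have "\<Psi> s \<le> \<Psi> (s + 1)"
  proof (rule DERIV_nonneg_imp_nondecreasing[of s "s + 1" \<Psi>])
    fix t assume t: "s \<le> t" "t \<le> s + 1"
    have "0 \<le> c * (m - t)" using c s t by simp
    moreover have "c * (m - t) \<le> c * m" using c s t by simp
    ultimately have cs: "cos (c * (m - t)) \<noteq> 0" using c(2) cos_gt_zero_pi[of "c * (m - t)"] by auto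
    have F: "(F has_real_derivative - (c\<^sup>2 + (F t)\<^sup>2)) (at t)"
    proof -
      have "(F has_real_derivative c * (inverse ((cos (c * (m - t)))\<^sup>2) * (- c))) (at t)"
        unfolding F_def using cs by (auto intro!: derivative_eq_intros)
      moreover have "inverse ((cos (c * (m - t)))\<^sup>2) = 1 + (tan (c * (m - t)))\<^sup>2"
        using tan_sec[OF cs] by (simp add: power_inverse)
      ultimately show ?thesis by (simp add: F_def power2_eq_square algebra_simps)
    qed
    have G: "(G has_real_derivative d) (at t)" unfolding G_def by (auto intro!: derivative_eq_intros)
    have P: "(P has_real_derivative (G t)\<^sup>2) (at t)"
      unfolding P_def G_def by (auto intro!: derivative_eq_intros simp: power2_eq_square field_simps)
    have "(\<Psi> has_real_derivative (d\<^sup>2 - c\<^sup>2 * (G t)\<^sup>2 - (2 * G t * d * F t + (G t)\<^sup>2 * - (c\<^sup>2 + (F t)\<^sup>2)))) (at t)"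
      unfolding \<Psi>_def by (auto intro!: derivative_eq_intros F G P)
    moreover have "d\<^sup>2 - c\<^sup>2 * (G t)\<^sup>2 - (2 * G t * d * F t + (G t)\<^sup>2 * - (c\<^sup>2 + (F t)\<^sup>2)) = (d - G t * F t)\<^sup>2"
      by (simp add: power2_eq_square algebra_simps)
    ultimately show "\<exists>y. (\<Psi> has_real_derivative y) (at t) \<and> y \<ge> 0" by (metis zero_le_power2)
  qed simp
  moreover have "P s = 0" "P (s + 1) = seg_mass a b" "G s = a" "G (s + 1) = b"
    by (simp_all add: P_def G_def d_def seg_mass_alt power2_eq_square field_simps)
  ultimately show ?thesis by (simp add: \<Psi>_def F_def d_def algebra_simps)
qed

text \<open>Summing \<open>segment_inequality\<close> over the segments telescopes; the end terms
  vanish because \<open>g 0 = 0\<close> on the left and \<open>tan 0 = 0\<close> on the right. The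
  comparison function c tan(c (m - t)) is the logarithmic derivative of cos(c (m - t)), which stays
  positive while c m < pi / 2.\<close>

lemma poincare_left:
  fixes g :: "nat \<Rightarrow> real"
  assumes m: "0 < m" and g: "g 0 = 0"
  shows "(\<Sum>k<m. seg_mass (g k) (g (Suc k))) \<le> 4 * (real m)\<^sup>2 / pi\<^sup>2 * (\<Sum>k<m. (g (Suc k) - g k)\<^sup>2)"
proof -
  define A where "A = (\<Sum>k<m. seg_mass (g k) (g (Suc k)))"
  define D where "D = (\<Sum>k<m. (g (Suc k) - g k)\<^sup>2)"
  \<comment> \<open>The quarter-wave frequency: sin(c0 t) vanishes at 0 and is flat at m. At
    \<open>c0\<close> itself the tangent is singular at the left end, so the inequality is proved
    below \<open>c0\<close> and passed to the limit.\<close>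
  define c0 where "c0 = pi / (2 * real m)"
  have le: "c\<^sup>2 * A \<le> D" if c: "0 < c" "c < c0" for c
  proof -
    have cm: "c * real m < pi / 2" using c m by (simp add: c0_def field_simps)
    define F where "F = (\<lambda>k. (g k)\<^sup>2 * (c * tan (c * (real m - real k))))"
    have "F (Suc k) - F k \<le> (g (Suc k) - g k)\<^sup>2 - c\<^sup>2 * seg_mass (g k) (g (Suc k))" if "k < m" for k
      using segment_inequality[OF c(1) cm, of "real k" "g (Suc k)" "g k"] that by (simp add: F_def add.commute)
    then have "(\<Sum>k<m. F (Suc k) - F k) \<le> (\<Sum>k<m. (g (Suc k) - g k)\<^sup>2 - c\<^sup>2 * seg_mass (g k) (g (Suc k)))"
      by (intro sum_mono) auto
    also have "\<dots> = D - c\<^sup>2 * A" by (simp add: D_def A_def sum_subtractf sum_distrib_left)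
    also have "(\<Sum>k<m. F (Suc k) - F k) = F m - F 0" by (rule sum_lessThan_telescope)
    finally show ?thesis using g by (simp add: F_def)
  qed
  have "c0\<^sup>2 * A \<le> D"
  proof (rule tendsto_upperbound)
    show "((\<lambda>c. c\<^sup>2 * A) \<longlongrightarrow> c0\<^sup>2 * A) (at_left c0)" by (intro tendsto_intros)
    have "0 < c0" using m by (simp add: c0_def)
    from eventually_at_left_real[OF this] show "eventually (\<lambda>c. c\<^sup>2 * A \<le> D) (at_left c0)"
      by eventually_elim (auto intro: le)
  qed simp
  then show ?thesis using m by (simp add: c0_def A_def D_def power_divide power_mult_distrib field_simps)
qed

lemma poincare_dirichlet:
  fixes g :: "nat \<Rightarrow> real"
  assumes m: "0 < m" and g: "g 0 = 0 \<or> g m = 0"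
  shows "(\<Sum>k<m. seg_mass (g k) (g (Suc k))) \<le> 4 * (real m)\<^sup>2 / pi\<^sup>2 * (\<Sum>k<m. (g (Suc k) - g k)\<^sup>2)"
  using g
proof
  assume gm: "g m = 0"
  define f where "f = (\<lambda>k. g (m - k))"
  have "(\<Sum>k<m. seg_mass (f k) (f (Suc k))) \<le> 4 * (real m)\<^sup>2 / pi\<^sup>2 * (\<Sum>k<m. (f (Suc k) - f k)\<^sup>2)"
    by (rule poincare_left[OF m]) (simp add: f_def gm)
  moreover have "(\<Sum>k<m. seg_mass (f k) (f (Suc k))) = (\<Sum>k<m. seg_mass (g k) (g (Suc k)))"
    by (subst sum.nat_diff_reindex[symmetric]) (auto simp: f_def Suc_diff_Suc seg_mass_commute intro!: sum.cong)
  moreover have "(\<Sum>k<m. (f (Suc k) - f k)\<^sup>2) = (\<Sum>k<m. (g (Suc k) - g k)\<^sup>2)"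
    by (subst sum.nat_diff_reindex[symmetric]) (auto simp: f_def Suc_diff_Suc power2_commute intro!: sum.cong)
  ultimately show ?thesis by simp
qed (rule poincare_left[OF m])

text \<open>Subtracting \<open>g 0\<close> reduces to the Dirichlet case, and completing the square
  removes the dependence on \<open>g 0\<close>. The constant is four times the sharp one for mean
  zero, but equals that of the Dirichlet case, with which it is combined later.\<close>

lemma poincare_variance:
  fixes g :: "nat \<Rightarrow> real"
  assumes m: "0 < m"
  shows "(\<Sum>k<m. seg_mass (g k) (g (Suc k))) \<le>
    4 * (real m)\<^sup>2 / pi\<^sup>2 * (\<Sum>k<m. (g (Suc k) - g k)\<^sup>2) + (\<Sum>k<m. (g k + g (Suc k)) / 2)\<^sup>2 / real m"
proof -
  define c where "c = g 0"
  define S where "S = (\<Sum>k<m. (g k + g (Suc k)) / 2)"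
  have "(\<Sum>k<m. seg_mass (g k - c) (g (Suc k) - c))
      \<le> 4 * (real m)\<^sup>2 / pi\<^sup>2 * (\<Sum>k<m. ((g (Suc k) - c) - (g k - c))\<^sup>2)"
    by (rule poincare_left[OF m]) (simp add: c_def)
  moreover have "seg_mass (g k - c) (g (Suc k) - c) = seg_mass (g k) (g (Suc k)) - 2 * c * ((g k + g (Suc k)) / 2) + c\<^sup>2" for k
    by (simp add: seg_mass_def power2_eq_square field_simps)
  then have "(\<Sum>k<m. seg_mass (g k - c) (g (Suc k) - c)) = (\<Sum>k<m. seg_mass (g k) (g (Suc k))) - 2 * c * S + real m * c\<^sup>2"
    by (simp only: sum.distrib sum_subtractf S_def sum_distrib_left sum_constant card_lessThan)
  moreover have "2 * c * S - real m * c\<^sup>2 \<le> S\<^sup>2 / real m"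
  proof -
    have "0 \<le> (S - real m * c)\<^sup>2 / real m" by simp
    also have "\<dots> = S\<^sup>2 / real m - 2 * c * S + real m * c\<^sup>2"
      using m by (simp add: power2_eq_square field_simps)
    finally show ?thesis by simp
  qed
  ultimately show ?thesis by (simp add: S_def)
qed

text \<open>Nodal values \<open>g k l\<close>; \<open>mm\<close>, \<open>dm\<close>, \<open>md\<close>, \<open>dd\<close> take the mean (m) or the difference (d) over a
  cell in each of the two directions.\<close>

definition mm :: "(nat \<Rightarrow> nat \<Rightarrow> real) \<Rightarrow> nat \<Rightarrow> nat \<Rightarrow> real" where
  "mm g k l = (g k l + g (Suc k) l + g k (Suc l) + g (Suc k) (Suc l)) / 4"
definition dm :: "(nat \<Rightarrow> nat \<Rightarrow> real) \<Rightarrow> nat \<Rightarrow> nat \<Rightarrow> real" where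
  "dm g k l = (g (Suc k) l + g (Suc k) (Suc l) - g k l - g k (Suc l)) / 2"
definition md :: "(nat \<Rightarrow> nat \<Rightarrow> real) \<Rightarrow> nat \<Rightarrow> nat \<Rightarrow> real" where
  "md g k l = (g k (Suc l) + g (Suc k) (Suc l) - g k l - g (Suc k) l) / 2"
definition dd :: "(nat \<Rightarrow> nat \<Rightarrow> real) \<Rightarrow> nat \<Rightarrow> nat \<Rightarrow> real" where
  "dd g k l = g (Suc k) (Suc l) - g (Suc k) l - g k (Suc l) + g k l"

text \<open>For mesh size 1/n these are n^2 times the integral of v^2 and the integral of |grad v|^2
  over a cell, see \<open>cell_integrals\<close>; the Dirichlet integral is scale invariant in two
  dimensions. Each partial derivative contributes one twelfth of the squared
  \<open>dd\<close>.\<close>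

definition cell_mass :: "(nat \<Rightarrow> nat \<Rightarrow> real) \<Rightarrow> nat \<Rightarrow> nat \<Rightarrow> real" where
  "cell_mass g k l = (mm g k l)\<^sup>2 + (dm g k l)\<^sup>2 / 12 + (md g k l)\<^sup>2 / 12 + (dd g k l)\<^sup>2 / 144"
definition cell_energy :: "(nat \<Rightarrow> nat \<Rightarrow> real) \<Rightarrow> nat \<Rightarrow> nat \<Rightarrow> real" where
  "cell_energy g k l = (dm g k l)\<^sup>2 + (md g k l)\<^sup>2 + (dd g k l)\<^sup>2 / 6"

lemmas cell_ops = mm_def dm_def md_def dd_def

lemma cell_mass_rows:
  "cell_mass g k l = seg_mass ((g k l + g k (Suc l)) / 2) ((g (Suc k) l + g (Suc k) (Suc l)) / 2)
     + seg_mass (g k (Suc l) - g k l) (g (Suc k) (Suc l) - g (Suc k) l) / 12"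
  by (simp add: cell_mass_def seg_mass_def cell_ops power2_eq_square field_simps)

text \<open>In each strip of cells the mass splits into that of the mean profile and one twelfth of
  that of the difference profile (\<open>cell_mass_rows\<close>). Both profiles vanish at the same
  end, and the one-dimensional inequality uses only derivatives in the first direction.\<close>

lemma poincare_block_dirichlet:
  fixes g :: "nat \<Rightarrow> nat \<Rightarrow> real"
  assumes m: "0 < m" and g: "(\<forall>l\<le>m'. g 0 l = 0) \<or> (\<forall>l\<le>m'. g m l = 0)"
  shows "(\<Sum>k<m. \<Sum>l<m'. cell_mass g k l) \<le> 4 * (real m)\<^sup>2 / pi\<^sup>2 * (\<Sum>k<m. \<Sum>l<m'. cell_energy g k l)"
proof -
  let ?C = "4 * (real m)\<^sup>2 / pi\<^sup>2"
  have row: "(\<Sum>k<m. cell_mass g k l) \<le> ?C * (\<Sum>k<m. cell_energy g k l)" if l: "l < m'" for l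
  proof -
    define p where "p = (\<lambda>k. (g k l + g k (Suc l)) / 2)"
    define d where "d = (\<lambda>k. g k (Suc l) - g k l)"
    have pd: "p 0 = 0 \<or> p m = 0" "d 0 = 0 \<or> d m = 0" using g l by (auto simp: p_def d_def)
    have "(\<Sum>k<m. cell_mass g k l) = (\<Sum>k<m. seg_mass (p k) (p (Suc k))) + (\<Sum>k<m. seg_mass (d k) (d (Suc k))) / 12"
      by (simp add: cell_mass_rows p_def d_def sum.distrib sum_divide_distrib)
    also have "\<dots> \<le> ?C * (\<Sum>k<m. (p (Suc k) - p k)\<^sup>2) + ?C * (\<Sum>k<m. (d (Suc k) - d k)\<^sup>2) / 12"
      by (intro add_mono divide_right_mono poincare_dirichlet[OF m pd(1)] poincare_dirichlet[OF m pd(2)]) simp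
    also have "\<dots> = ?C * (\<Sum>k<m. (p (Suc k) - p k)\<^sup>2 + (d (Suc k) - d k)\<^sup>2 / 12)"
      by (simp only: sum.distrib distrib_left sum_divide_distrib[symmetric] times_divide_eq_right)
    also have "\<dots> \<le> ?C * (\<Sum>k<m. cell_energy g k l)"
    proof (intro mult_left_mono sum_mono)
      fix k
      have "cell_energy g k l - ((p (Suc k) - p k)\<^sup>2 + (d (Suc k) - d k)\<^sup>2 / 12) = (md g k l)\<^sup>2 + (dd g k l)\<^sup>2 / 12"
        by (simp add: cell_energy_def p_def d_def cell_ops power2_eq_square field_simps)
      then show "(p (Suc k) - p k)\<^sup>2 + (d (Suc k) - d k)\<^sup>2 / 12 \<le> cell_energy g k l"
        by (smt (verit) zero_le_power2 divide_nonneg_nonneg)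
    qed simp
    finally show ?thesis .
  qed
  have "(\<Sum>k<m. \<Sum>l<m'. cell_mass g k l) = (\<Sum>l<m'. \<Sum>k<m. cell_mass g k l)" by (rule sum.swap)
  also have "\<dots> \<le> (\<Sum>l<m'. ?C * (\<Sum>k<m. cell_energy g k l))" by (intro sum_mono row) auto
  also have "\<dots> = ?C * (\<Sum>k<m. \<Sum>l<m'. cell_energy g k l)"
    by (simp add: sum_distrib_left sum.swap[of _ "{..<m}"])
  finally show ?thesis .
qed

lemma cell_transpose:
  "cell_mass (\<lambda>k l. g l k) k l = cell_mass g l k" "cell_energy (\<lambda>k l. g l k) k l = cell_energy g l k"
  by (simp_all add: cell_mass_def cell_energy_def cell_ops algebra_simps)

text \<open>The one-dimensional variance inequality is used twice: along each strip, leaving squared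
  strip means, and then across the strips, where the mean of the strip means is zero by
  assumption.\<close>

lemma poincare_block_mean_zero:
  fixes g :: "nat \<Rightarrow> nat \<Rightarrow> real"
  assumes m: "0 < m" and g: "(\<Sum>k<m. \<Sum>l<m. mm g k l) = 0"
  shows "(\<Sum>k<m. \<Sum>l<m. cell_mass g k l) \<le> 4 * (real m)\<^sup>2 / pi\<^sup>2 * (\<Sum>k<m. \<Sum>l<m. cell_energy g k l)"
proof -
  let ?C = "4 * (real m)\<^sup>2 / pi\<^sup>2"
  \<comment> \<open>Up to scaling, the integral of the function along the horizontal grid line
    number \<open>l\<close>.\<close>
  define \<alpha> where "\<alpha> = (\<lambda>l. \<Sum>k<m. (g k l + g (Suc k) l) / 2)"
  have \<alpha>: "(\<alpha> l + \<alpha> (Suc l)) / 2 = (\<Sum>k<m. mm g k l)" "\<alpha> (Suc l) - \<alpha> l = (\<Sum>k<m. md g k l)" for l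
    by (simp_all add: \<alpha>_def cell_ops sum_divide_distrib[symmetric] sum.distrib[symmetric] sum_subtractf[symmetric])
      (simp_all add: algebra_simps sum.distrib sum_subtractf)
  have row: "(\<Sum>k<m. cell_mass g k l) \<le> ?C * (\<Sum>k<m. (dm g k l)\<^sup>2 + (dd g k l)\<^sup>2 / 12) + seg_mass (\<alpha> l) (\<alpha> (Suc l)) / real m" for l
  proof -
    define p where "p = (\<lambda>k. (g k l + g k (Suc l)) / 2)"
    define d where "d = (\<lambda>k. g k (Suc l) - g k l)"
    have "(\<Sum>k<m. cell_mass g k l) = (\<Sum>k<m. seg_mass (p k) (p (Suc k))) + (\<Sum>k<m. seg_mass (d k) (d (Suc k))) / 12"
      by (simp add: cell_mass_rows p_def d_def sum.distrib sum_divide_distrib)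
    also have "\<dots> \<le> ?C * (\<Sum>k<m. (p (Suc k) - p k)\<^sup>2) + (\<Sum>k<m. (p k + p (Suc k)) / 2)\<^sup>2 / real m
        + (?C * (\<Sum>k<m. (d (Suc k) - d k)\<^sup>2) + (\<Sum>k<m. (d k + d (Suc k)) / 2)\<^sup>2 / real m) / 12"
      by (intro add_mono divide_right_mono poincare_variance[OF m]) simp
    also have "\<dots> = ?C * (\<Sum>k<m. (dm g k l)\<^sup>2) + (\<Sum>k<m. mm g k l)\<^sup>2 / real m
        + (?C * (\<Sum>k<m. (dd g k l)\<^sup>2) + (\<Sum>k<m. md g k l)\<^sup>2 / real m) / 12"
    proof -
      have "p (Suc k) - p k = dm g k l" "d (Suc k) - d k = dd g k l"
        "(p k + p (Suc k)) / 2 = mm g k l" "(d k + d (Suc k)) / 2 = md g k l" for k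
        by (simp_all add: p_def d_def cell_ops field_simps)
      then show ?thesis by (simp only:)
    qed
    \<comment> \<open>The two squares left over by the variance inequality are the squared mean and
      one twelfth of the squared difference of \<open>\<alpha>\<close>, so they recombine exactly to
      a \<open>seg_mass\<close>.\<close>
    also have "\<dots> = ?C * ((\<Sum>k<m. (dm g k l)\<^sup>2) + (\<Sum>k<m. (dd g k l)\<^sup>2) / 12) + seg_mass (\<alpha> l) (\<alpha> (Suc l)) / real m"
      unfolding seg_mass_def \<alpha> by (simp add: add_divide_distrib distrib_left)
    also have "(\<Sum>k<m. (dm g k l)\<^sup>2) + (\<Sum>k<m. (dd g k l)\<^sup>2) / 12 = (\<Sum>k<m. (dm g k l)\<^sup>2 + (dd g k l)\<^sup>2 / 12)"
      by (simp add: sum.distrib sum_divide_distrib)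
    finally show ?thesis .
  qed
  have "(\<Sum>l<m. (\<alpha> l + \<alpha> (Suc l)) / 2) = 0" unfolding \<alpha> using g sum.swap[of "mm g" "{..<m}" "{..<m}"] by simp
  then have "(\<Sum>l<m. seg_mass (\<alpha> l) (\<alpha> (Suc l))) \<le> ?C * (\<Sum>l<m. (\<alpha> (Suc l) - \<alpha> l)\<^sup>2)"
    using poincare_variance[OF m, of \<alpha>] by simp
  also have "\<dots> \<le> ?C * (\<Sum>l<m. real m * (\<Sum>k<m. (md g k l)\<^sup>2))"
  proof (intro mult_left_mono sum_mono)
    \<comment> \<open>Cauchy-Schwarz over the \<open>m\<close> cells of a strip; the factor
      \<open>m\<close> cancels the division by \<open>m\<close> in \<open>row\<close>.\<close>
    show "(\<alpha> (Suc l) - \<alpha> l)\<^sup>2 \<le> real m * (\<Sum>k<m. (md g k l)\<^sup>2)" for l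
      unfolding \<alpha> using sum_squared_le_sum_of_squares[of "\<lambda>k. md g k l" "{..<m}"] by (simp add: mult.commute)
  qed simp
  also have "\<dots> = real m * (?C * (\<Sum>l<m. \<Sum>k<m. (md g k l)\<^sup>2))"
    by (simp add: sum_distrib_left[symmetric])
  finally have col: "(\<Sum>l<m. seg_mass (\<alpha> l) (\<alpha> (Suc l))) / real m \<le> ?C * (\<Sum>l<m. \<Sum>k<m. (md g k l)\<^sup>2)"
    using m by (simp add: pos_divide_le_eq mult.commute)
  have gen: "(\<Sum>l<m. c * R l + T l / x) = c * (\<Sum>l<m. R l) + (\<Sum>l<m. T l) / x" for c x :: real and R T
    by (simp add: sum.distrib sum_distrib_left sum_divide_distrib)
  have "(\<Sum>k<m. \<Sum>l<m. cell_mass g k l) = (\<Sum>l<m. \<Sum>k<m. cell_mass g k l)" by (rule sum.swap)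
  also have "\<dots> \<le> (\<Sum>l<m. ?C * (\<Sum>k<m. (dm g k l)\<^sup>2 + (dd g k l)\<^sup>2 / 12) + seg_mass (\<alpha> l) (\<alpha> (Suc l)) / real m)"
    by (intro sum_mono row)
  also have "\<dots> = ?C * (\<Sum>l<m. \<Sum>k<m. (dm g k l)\<^sup>2 + (dd g k l)\<^sup>2 / 12) + (\<Sum>l<m. seg_mass (\<alpha> l) (\<alpha> (Suc l))) / real m"
    by (rule gen)
  also have "\<dots> \<le> ?C * (\<Sum>l<m. \<Sum>k<m. (dm g k l)\<^sup>2 + (dd g k l)\<^sup>2 / 12) + ?C * (\<Sum>l<m. \<Sum>k<m. (md g k l)\<^sup>2)"
    using col by simp
  also have "\<dots> = ?C * (\<Sum>l<m. \<Sum>k<m. (dm g k l)\<^sup>2 + (dd g k l)\<^sup>2 / 12 + (md g k l)\<^sup>2)"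
    by (simp only: sum.distrib distrib_left)
  also have "\<dots> \<le> ?C * (\<Sum>l<m. \<Sum>k<m. cell_energy g k l)"
    by (intro mult_left_mono sum_mono) (simp_all add: cell_energy_def)
  also have "(\<Sum>l<m. \<Sum>k<m. cell_energy g k l) = (\<Sum>k<m. \<Sum>l<m. cell_energy g k l)" by (rule sum.swap)
  finally show ?thesis .
qed

section \<open>Cell integrals\<close>

lemma centered_moment:
  fixes h c :: real
  assumes h: "0 < h"
  shows "((\<lambda>t. 1) has_integral h) {c - h / 2..c + h / 2}"
    "((\<lambda>t. t - c) has_integral 0) {c - h / 2..c + h / 2}"
    "((\<lambda>t. (t - c)\<^sup>2) has_integral h ^ 3 / 12) {c - h / 2..c + h / 2}"
proof -
  have le: "c - h / 2 \<le> c + h / 2" using h by simp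
  show "((\<lambda>t. 1) has_integral h) {c - h / 2..c + h / 2}"
    using has_integral_const_real[of "1 :: real" "c - h / 2" "c + h / 2"] h by simp
  have "((\<lambda>t. t - c) has_integral ((c + h / 2 - c)\<^sup>2 / 2 - (c - h / 2 - c)\<^sup>2 / 2)) {c - h / 2..c + h / 2}"
    by (rule fundamental_theorem_of_calculus[OF le])
      (auto intro!: derivative_eq_intros simp flip: has_real_derivative_iff_has_vector_derivative)
  then show "((\<lambda>t. t - c) has_integral 0) {c - h / 2..c + h / 2}" by simp
  have "((\<lambda>t. (t - c)\<^sup>2) has_integral ((c + h / 2 - c) ^ 3 / 3 - (c - h / 2 - c) ^ 3 / 3)) {c - h / 2..c + h / 2}"
    by (rule fundamental_theorem_of_calculus[OF le])
      (auto intro!: derivative_eq_intros simp flip: has_real_derivative_iff_has_vector_derivative)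
  then show "((\<lambda>t. (t - c)\<^sup>2) has_integral h ^ 3 / 12) {c - h / 2..c + h / 2}"
    by (simp add: power3_eq_cube field_simps)
qed

lemma has_integral_product:
  fixes f g :: "real \<Rightarrow> real"
  assumes f: "continuous_on UNIV f" "(f has_integral I) {a..b}"
    and g: "continuous_on UNIV g" "(g has_integral J) {c..d}"
  shows "((\<lambda>z. f (fst z) * g (snd z)) has_integral I * J) (cbox (a, c) (b, d))"
proof -
  have cont: "continuous_on (cbox (a, c) (b, d)) (\<lambda>z. f (fst z) * g (snd z))"
    by (intro continuous_intros continuous_on_compose2[OF f(1)] continuous_on_compose2[OF g(1)]) auto
  then have int: "(\<lambda>z. f (fst z) * g (snd z)) integrable_on cbox (a, c) (b, d)" by (rule integrable_continuous)
  have "integral (cbox (a, c) (b, d)) (\<lambda>z. f (fst z) * g (snd z))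
      = integral (cbox a b) (\<lambda>x. integral (cbox c d) (\<lambda>y. f x * g y))"
    using integral_prod_continuous[OF cont] by simp
  also have "\<dots> = integral {a..b} (\<lambda>x. f x * J)" using g(2) by (simp add: integral_unique)
  also have "\<dots> = I * J" using f(2) by (simp add: integral_unique)
  finally show ?thesis using int by (simp add: has_integral_integrable_integral)
qed

text \<open>v, v^2 and |grad v|^2 have degree at most two in each variable, so one formula with nine
  coefficients covers them all. In coordinates centered at the cell midpoint every monomial with an
  odd exponent integrates to zero.\<close>

lemma centered_cell_integral:
  fixes h p q :: real and a :: "nat \<Rightarrow> nat \<Rightarrow> real"
  assumes h: "0 < h"
  defines "X \<equiv> \<lambda>z :: pt. fst z - p" and "Y \<equiv> \<lambda>z :: pt. snd z - q"
  shows "((\<lambda>z. a 0 0 + a 1 0 * X z + a 0 1 * Y z + a 1 1 * (X z * Y z) + a 2 0 * (X z)\<^sup>2 + a 0 2 * (Y z)\<^sup>2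
      + a 2 1 * ((X z)\<^sup>2 * Y z) + a 1 2 * (X z * (Y z)\<^sup>2) + a 2 2 * ((X z)\<^sup>2 * (Y z)\<^sup>2)) has_integral
      h\<^sup>2 * (a 0 0 + (a 2 0 + a 0 2) * h\<^sup>2 / 12 + a 2 2 * h ^ 4 / 144))
      (cbox (p - h / 2, q - h / 2) (p + h / 2, q + h / 2))"
proof -
  have c: "continuous_on UNIV (\<lambda>t. 1 :: real)" "continuous_on UNIV (\<lambda>t. t - c :: real)" "continuous_on UNIV (\<lambda>t. (t - c :: real)\<^sup>2)" for c
    by (intro continuous_intros)+
  note P = centered_moment[OF h, of p] and Q = centered_moment[OF h, of q]
  note prods = has_integral_product[OF c(1) P(1) c(1) Q(1)] has_integral_product[OF c(2) P(2) c(1) Q(1)]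
    has_integral_product[OF c(1) P(1) c(2) Q(2)] has_integral_product[OF c(2) P(2) c(2) Q(2)]
    has_integral_product[OF c(3) P(3) c(1) Q(1)] has_integral_product[OF c(1) P(1) c(3) Q(3)]
    has_integral_product[OF c(3) P(3) c(2) Q(2)] has_integral_product[OF c(2) P(2) c(3) Q(3)]
    has_integral_product[OF c(3) P(3) c(3) Q(3)]
  have "((\<lambda>z :: pt. a 0 0 * (1 * 1) + a 1 0 * (X z * 1) + a 0 1 * (1 * Y z) + a 1 1 * (X z * Y z) + a 2 0 * ((X z)\<^sup>2 * 1) + a 0 2 * (1 * (Y z)\<^sup>2)
      + a 2 1 * ((X z)\<^sup>2 * Y z) + a 1 2 * (X z * (Y z)\<^sup>2) + a 2 2 * ((X z)\<^sup>2 * (Y z)\<^sup>2)) has_integral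
      (a 0 0 * (h * h) + a 1 0 * (0 * h) + a 0 1 * (h * 0) + a 1 1 * (0 * 0) + a 2 0 * (h ^ 3 / 12 * h) + a 0 2 * (h * (h ^ 3 / 12))
       + a 2 1 * (h ^ 3 / 12 * 0) + a 1 2 * (0 * (h ^ 3 / 12)) + a 2 2 * (h ^ 3 / 12 * (h ^ 3 / 12))))
      (cbox (p - h / 2, q - h / 2) (p + h / 2, q + h / 2))"
    unfolding X_def Y_def by (intro has_integral_add has_integral_mult_right prods)
  moreover have "a 0 0 * (h * h) + a 1 0 * (0 * h) + a 0 1 * (h * 0) + a 1 1 * (0 * 0) + a 2 0 * (h ^ 3 / 12 * h) + a 0 2 * (h * (h ^ 3 / 12))
       + a 2 1 * (h ^ 3 / 12 * 0) + a 1 2 * (0 * (h ^ 3 / 12)) + a 2 2 * (h ^ 3 / 12 * (h ^ 3 / 12))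
      = h\<^sup>2 * (a 0 0 + (a 2 0 + a 0 2) * h\<^sup>2 / 12 + a 2 2 * h ^ 4 / 144)"
    by (simp add: power2_eq_square power3_eq_cube power4_eq_xxxx field_simps)
  ultimately show ?thesis by simp
qed

definition nodal :: "nat \<Rightarrow> fn \<Rightarrow> nat \<Rightarrow> nat \<Rightarrow> real" where
  "nodal n v k l = v (real k / real n, real l / real n)"

lemma cell_LINT:
  assumes n: "0 < n" and e: "e \<in> elems n" and g: "pw_cont n g"
    and p: "\<And>z. z \<in> ocell n e \<Longrightarrow> g z = p z" and I: "(p has_integral I) (cell (1 / real n) e)"
  shows "(LINT z:ocell n e|lebesgue. g z) = I"
proof -
  have "set_integrable lebesgue (ocell n e) g"
    using unit_coeff.region_integrable[OF mesh_region_cell[OF n e] g] by simp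
  then have "(LINT z:ocell n e|lebesgue. g z) = integral (ocell n e) g"
    by (rule set_lebesgue_integral_eq_integral)
  also have "\<dots> = integral (ocell n e) p" using p by (rule Henstock_Kurzweil_Integration.integral_cong)
  also have "\<dots> = I" using I
    by (simp add: ocell_def cell_def interior_cbox integral_open_interval integral_unique)
  finally show ?thesis .
qed

text \<open>Bilinearity is assumed on the closed cell because the nodal values sit at its corners,
  whereas the integrals see only the open cell.\<close>

lemma cell_integrals:
  assumes n: "0 < n" and e: "(k, l) \<in> elems n" and pw: "v \<in> pw_bilinear n"
    and v: "bilinear_on (cell (1 / real n) (k, l)) v"
  shows "(LINT z:ocell n (k, l)|lebesgue. v z) = mm (nodal n v) k l / (real n)\<^sup>2"
    "(LINT z:ocell n (k, l)|lebesgue. v z * v z) = cell_mass (nodal n v) k l / (real n)\<^sup>2"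
    "(LINT z:ocell n (k, l)|lebesgue. inner (grad v z) (grad v z)) = cell_energy (nodal n v) k l"
proof -
  define h where "h = 1 / real n"
  have h: "0 < h" using n by (simp add: h_def)
  obtain c0 c1 c2 c3 where c: "\<forall>z\<in>cell (1 / real n) (k, l). v z = c0 + c1 * fst z + c2 * snd z + c3 * fst z * snd z"
    using v unfolding bilinear_on_alt by blast
  define p q where "p = (real k + 1 / 2) * h" and "q = (real l + 1 / 2) * h"
  define m a b where "m = c0 + c1 * p + c2 * q + c3 * p * q" and "a = c1 + c3 * q" and "b = c2 + c3 * p"
  have cell: "cell (1 / real n) (k, l) = cbox (p - h / 2, q - h / 2) (p + h / 2, q + h / 2)"
    by (simp add: cell_def p_def q_def h_def add_divide_distrib distrib_right add.commute)
  have vz: "v z = m + a * (fst z - p) + b * (snd z - q) + c3 * ((fst z - p) * (snd z - q))" if "z \<in> cell (1 / real n) (k, l)" for z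
    using c that by (simp add: m_def a_def b_def algebra_simps)
  have vz': "v z = m + a * (fst z - p) + b * (snd z - q) + c3 * ((fst z - p) * (snd z - q))" if "z \<in> ocell n (k, l)" for z
    using vz ocell_subset_cell that by blast
  have gz: "grad v z = (a + c3 * (snd z - q), b + c3 * (fst z - p))" if z: "z \<in> ocell n (k, l)" for z
  proof -
    have "\<forall>z\<in>ocell n (k, l). v z = c0 + c1 * fst z + c2 * snd z + c3 * fst z * snd z"
      using c ocell_subset_cell by blast
    from grad_cell[OF this z] show ?thesis by (simp add: a_def b_def algebra_simps)
  qed
  have nod: "nodal n v k l = m - a * h / 2 - b * h / 2 + c3 * h\<^sup>2 / 4"
    "nodal n v (Suc k) l = m + a * h / 2 - b * h / 2 - c3 * h\<^sup>2 / 4"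
    "nodal n v k (Suc l) = m - a * h / 2 + b * h / 2 - c3 * h\<^sup>2 / 4"
    "nodal n v (Suc k) (Suc l) = m + a * h / 2 + b * h / 2 + c3 * h\<^sup>2 / 4"
    unfolding nodal_def
    by (subst vz; (simp add: cell_alt[OF n] n; fail)?; simp add: p_def q_def h_def power2_eq_square field_simps n)+
  have ops: "mm (nodal n v) k l = m" "dm (nodal n v) k l = a * h" "md (nodal n v) k l = b * h" "dd (nodal n v) k l = c3 * h\<^sup>2"
    unfolding cell_ops nod by (simp_all add: field_simps)
  note pc = pw_cont_bilinear(1)[OF pw]
  \<comment> \<open>\<open>A1\<close>, \<open>A2\<close> and \<open>A3\<close> list the coefficients
    of v, v^2 and |grad v|^2 in the centered coordinates.\<close>
  define A1 where "A1 = (\<lambda>(i::nat) (j::nat). if (i, j) = (0, 0) then m else if (i, j) = (1, 0) then a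
    else if (i, j) = (0, 1) then b else if (i, j) = (1, 1) then c3 else 0)"
  define A2 where "A2 = (\<lambda>(i::nat) (j::nat). if (i, j) = (0, 0) then m\<^sup>2 else if (i, j) = (1, 0) then 2 * m * a
    else if (i, j) = (0, 1) then 2 * m * b else if (i, j) = (1, 1) then 2 * m * c3 + 2 * a * b
    else if (i, j) = (2, 0) then a\<^sup>2 else if (i, j) = (0, 2) then b\<^sup>2 else if (i, j) = (2, 1) then 2 * a * c3
    else if (i, j) = (1, 2) then 2 * b * c3 else c3\<^sup>2)"
  define A3 where "A3 = (\<lambda>(i::nat) (j::nat). if (i, j) = (0, 0) then a\<^sup>2 + b\<^sup>2 else if (i, j) = (1, 0) then 2 * b * c3
    else if (i, j) = (0, 1) then 2 * a * c3 else if (i, j) = (2, 0) \<or> (i, j) = (0, 2) then c3\<^sup>2 else 0)"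
  have "(LINT z:ocell n (k, l)|lebesgue. v z) = h\<^sup>2 * m"
    by (rule cell_LINT[OF n e pc], rule vz', assumption)
      (use centered_cell_integral[OF h, of A1 p q] in \<open>simp add: A1_def cell\<close>)
  then show "(LINT z:ocell n (k, l)|lebesgue. v z) = mm (nodal n v) k l / (real n)\<^sup>2"
    by (simp add: ops h_def power_divide)
  have "(LINT z:ocell n (k, l)|lebesgue. v z * v z) = h\<^sup>2 * (m\<^sup>2 + (a\<^sup>2 + b\<^sup>2) * h\<^sup>2 / 12 + c3\<^sup>2 * h ^ 4 / 144)"
  proof (rule cell_LINT[OF n e pw_cont_mult[OF pc pc]])
    show "((\<lambda>z. m\<^sup>2 + 2 * m * a * (fst z - p) + 2 * m * b * (snd z - q) + (2 * m * c3 + 2 * a * b) * ((fst z - p) * (snd z - q))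
        + a\<^sup>2 * (fst z - p)\<^sup>2 + b\<^sup>2 * (snd z - q)\<^sup>2 + 2 * a * c3 * ((fst z - p)\<^sup>2 * (snd z - q))
        + 2 * b * c3 * ((fst z - p) * (snd z - q)\<^sup>2) + c3\<^sup>2 * ((fst z - p)\<^sup>2 * (snd z - q)\<^sup>2)) has_integral
        h\<^sup>2 * (m\<^sup>2 + (a\<^sup>2 + b\<^sup>2) * h\<^sup>2 / 12 + c3\<^sup>2 * h ^ 4 / 144)) (cell (1 / real n) (k, l))"
      using centered_cell_integral[OF h, of A2 p q] by (simp add: A2_def cell)
  qed (simp add: vz' power2_eq_square algebra_simps)
  then show "(LINT z:ocell n (k, l)|lebesgue. v z * v z) = cell_mass (nodal n v) k l / (real n)\<^sup>2"
  proof -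
    have "x / (real n)\<^sup>2 = h\<^sup>2 * x" for x by (simp add: h_def power_divide)
    moreover have "m\<^sup>2 + (a\<^sup>2 + b\<^sup>2) * h\<^sup>2 / 12 + c3\<^sup>2 * h ^ 4 / 144
        = m\<^sup>2 + (a * h)\<^sup>2 / 12 + (b * h)\<^sup>2 / 12 + (c3 * h\<^sup>2)\<^sup>2 / 144"
      by (simp add: power_mult_distrib distrib_right add_divide_distrib)
    moreover assume "(LINT z:ocell n (k, l)|lebesgue. v z * v z) = h\<^sup>2 * (m\<^sup>2 + (a\<^sup>2 + b\<^sup>2) * h\<^sup>2 / 12 + c3\<^sup>2 * h ^ 4 / 144)"
    ultimately show ?thesis unfolding cell_mass_def ops by simp
  qed
  have "(LINT z:ocell n (k, l)|lebesgue. inner (grad v z) (grad v z)) = h\<^sup>2 * (a\<^sup>2 + b\<^sup>2 + 2 * c3\<^sup>2 * h\<^sup>2 / 12)"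
  proof (rule cell_LINT[OF n e pw_cont_grad_inner[OF pw pw]])
    show "((\<lambda>z. a\<^sup>2 + b\<^sup>2 + 2 * b * c3 * (fst z - p) + 2 * a * c3 * (snd z - q) + c3\<^sup>2 * (fst z - p)\<^sup>2 + c3\<^sup>2 * (snd z - q)\<^sup>2)
        has_integral h\<^sup>2 * (a\<^sup>2 + b\<^sup>2 + 2 * c3\<^sup>2 * h\<^sup>2 / 12)) (cell (1 / real n) (k, l))"
      using centered_cell_integral[OF h, of A3 p q] by (simp add: A3_def cell)
  qed (simp add: gz power2_eq_square algebra_simps)
  then show "(LINT z:ocell n (k, l)|lebesgue. inner (grad v z) (grad v z)) = cell_energy (nodal n v) k l"
    unfolding cell_energy_def ops by (simp add: power2_eq_square algebra_simps)
qed

section \<open>Poincare inequalities on blocks of cells\<close>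

definition block :: "nat \<Rightarrow> nat \<Rightarrow> nat \<Rightarrow> idx set" where
  "block i j m = {i..<i + m} \<times> {j..<j + m}"

lemma sum_block: "(\<Sum>e\<in>block i j m. f e) = (\<Sum>k<m. \<Sum>l<m. f (i + k, j + l))" for f :: "idx \<Rightarrow> real"
proof -
  have shift: "sum g {a..<a + m} = (\<Sum>k<m. g (a + k))" for g :: "nat \<Rightarrow> real" and a
    using sum.shift_bounds_nat_ivl[of g 0 a m] by (simp add: lessThan_atLeast0 add.commute)
  have "(\<Sum>e\<in>block i j m. f e) = (\<Sum>k\<in>{i..<i + m}. \<Sum>l\<in>{j..<j + m}. f (k, l))"
    by (simp add: block_def sum.cartesian_product split_beta)
  also have "\<dots> = (\<Sum>k<m. \<Sum>l<m. f (i + k, j + l))"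
    by (simp only: shift)
  finally show ?thesis .
qed

text \<open>The alternatives in \<open>bc\<close> are the situations that occur for a square block:
  a zero side at the left, right, bottom or top, or mean zero. Bottom and top reduce to the other
  sides by transposing the nodal values. The factor m / n is the side length of the block.\<close>

lemma poincare_region:
  assumes D: "mesh_region n D (block i j m)" and m: "0 < m" and pw: "v \<in> pw_bilinear n"
    and v: "\<And>e. e \<in> block i j m \<Longrightarrow> bilinear_on (cell (1 / real n) e) v"
    and bc: "(\<forall>l\<le>m. nodal n v i (j + l) = 0) \<or> (\<forall>l\<le>m. nodal n v (i + m) (j + l) = 0) \<or>
      (\<forall>l\<le>m. nodal n v (i + l) j = 0) \<or> (\<forall>l\<le>m. nodal n v (i + l) (j + m) = 0) \<or> (LINT z:D|lebesgue. v z) = 0"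
  shows "mass (\<lambda>_. 1) D v v \<le> 4 / pi\<^sup>2 * (real m / real n)\<^sup>2 * energy (\<lambda>_. 1) D v v"
proof -
  have n: "0 < n" and Q: "block i j m \<subseteq> elems n" using D by (auto simp: mesh_region_def)
  define g where "g = (\<lambda>k l. nodal n v (i + k) (j + l))"
  note U = unit_coeff.region_integral[OF D, simplified mult_1]
  have memb: "k < m \<Longrightarrow> l < m \<Longrightarrow> (i + k, j + l) \<in> block i j m" for k l by (auto simp: block_def)
  have sh: "mm (nodal n v) (i + k) (j + l) = mm g k l" "cell_mass (nodal n v) (i + k) (j + l) = cell_mass g k l"
    "cell_energy (nodal n v) (i + k) (j + l) = cell_energy g k l" for k l
    by (simp_all add: cell_mass_def cell_energy_def cell_ops g_def)
  have ci: "(LINT z:ocell n (i + k, j + l)|lebesgue. v z) = mm g k l / (real n)\<^sup>2"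
    "(LINT z:ocell n (i + k, j + l)|lebesgue. v z * v z) = cell_mass g k l / (real n)\<^sup>2"
    "(LINT z:ocell n (i + k, j + l)|lebesgue. inner (grad v z) (grad v z)) = cell_energy g k l"
    if "k < m" "l < m" for k l
    using cell_integrals[OF n subsetD[OF Q memb[OF that]] pw v[OF memb[OF that]]] by (simp_all only: sh)
  have I: "(LINT z:D|lebesgue. v z) = (\<Sum>k<m. \<Sum>l<m. mm g k l) / (real n)\<^sup>2"
    "mass (\<lambda>_. 1) D v v = (\<Sum>k<m. \<Sum>l<m. cell_mass g k l) / (real n)\<^sup>2"
    "energy (\<lambda>_. 1) D v v = (\<Sum>k<m. \<Sum>l<m. cell_energy g k l)"
    unfolding mass_def energy_def mult_1
    by (simp_all add: U pw pw_cont_bilinear pw_cont_mult pw_cont_grad_inner sum_block ci sum_divide_distrib)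
  have "(\<Sum>k<m. \<Sum>l<m. cell_mass g k l) \<le> 4 * (real m)\<^sup>2 / pi\<^sup>2 * (\<Sum>k<m. \<Sum>l<m. cell_energy g k l)"
  proof -
    consider "(\<forall>l\<le>m. g 0 l = 0) \<or> (\<forall>l\<le>m. g m l = 0)" | "(\<forall>l\<le>m. g l 0 = 0) \<or> (\<forall>l\<le>m. g l m = 0)"
      | "(\<Sum>k<m. \<Sum>l<m. mm g k l) = 0"
      using bc I(1) n by (auto simp: g_def)
    then show ?thesis
    proof cases
      case 1
      then show ?thesis by (rule poincare_block_dirichlet[OF m])
    next
      case 2
      have "(\<Sum>k<m. \<Sum>l<m. cell_mass (\<lambda>k l. g l k) k l) \<le> 4 * (real m)\<^sup>2 / pi\<^sup>2 * (\<Sum>k<m. \<Sum>l<m. cell_energy (\<lambda>k l. g l k) k l)"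
        by (rule poincare_block_dirichlet[OF m]) (use 2 in simp)
      then show ?thesis unfolding cell_transpose[of g]
        by (simp only: sum.swap[of "\<lambda>k l. cell_mass g l k"] sum.swap[of "\<lambda>k l. cell_energy g l k"])
    next
      case 3
      then show ?thesis by (rule poincare_block_mean_zero[OF m])
    qed
  qed
  then have "(\<Sum>k<m. \<Sum>l<m. cell_mass g k l) / (real n)\<^sup>2 \<le> 4 * (real m)\<^sup>2 / pi\<^sup>2 * (\<Sum>k<m. \<Sum>l<m. cell_energy g k l) / (real n)\<^sup>2"
    by (rule divide_right_mono) simp
  then show ?thesis unfolding I by (simp add: power_divide)
qed


lemma (in semi_inner) semi_inner_subspace:
  assumes "subspace U" "U \<subseteq> V"
  shows "semi_inner scale U B"
proof -
  have sub: "x \<in> U \<Longrightarrow> x \<in> V" for x using assms(2) by blast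
  show ?thesis
    by unfold_locales (rule assms(1) B_add_left B_scale_left B_nonneg B_sym; erule sub)+
qed

section \<open>The finite element space\<close>

lemma bilinear_on_subset: "bilinear_on T v \<Longrightarrow> S \<subseteq> T \<Longrightarrow> bilinear_on S v"
  unfolding bilinear_on_alt by blast

lemma bilinear_interpolation:
  assumes n: "0 < n" and v: "bilinear_on (cell (1 / real n) (k, l)) v" and z: "z \<in> cell (1 / real n) (k, l)"
  defines "s \<equiv> fst z * real n - real k" and "t \<equiv> snd z * real n - real l"
  shows "v z = (1 - s) * (1 - t) * nodal n v k l + s * (1 - t) * nodal n v (Suc k) l
    + (1 - s) * t * nodal n v k (Suc l) + s * t * nodal n v (Suc k) (Suc l)"
proof -
  define h where "h = 1 / real n"
  obtain c0 c1 c2 c3 where c: "\<forall>z\<in>cell (1 / real n) (k, l). v z = c0 + c1 * fst z + c2 * snd z + c3 * fst z * snd z"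
    using v unfolding bilinear_on_alt by blast
  have zz: "fst z = (real k + s) * h" "snd z = (real l + t) * h" using n by (auto simp: s_def t_def h_def)
  have nod: "nodal n v a b = c0 + c1 * (real a * h) + c2 * (real b * h) + c3 * (real a * h) * (real b * h)"
    if "a \<in> {k, Suc k}" "b \<in> {l, Suc l}" for a b
  proof -
    have "(real a / real n, real b / real n) \<in> cell (1 / real n) (k, l)"
      using that n by (auto simp: cell_alt[OF n])
    then show ?thesis unfolding nodal_def using c by (simp add: h_def)
  qed
  have "v z = c0 + c1 * ((real k + s) * h) + c2 * ((real l + t) * h) + c3 * ((real k + s) * h) * ((real l + t) * h)"
    using c z unfolding zz[symmetric] by blast
  then show ?thesis by (simp add: nod algebra_simps)
qed

lemma bilinear_eqI:
  assumes n: "0 < n" and v: "bilinear_on (cell (1 / real n) (k, l)) v" "bilinear_on (cell (1 / real n) (k, l)) w"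
    and eq: "nodal n v k l = nodal n w k l" "nodal n v (Suc k) l = nodal n w (Suc k) l"
      "nodal n v k (Suc l) = nodal n w k (Suc l)" "nodal n v (Suc k) (Suc l) = nodal n w (Suc k) (Suc l)"
    and z: "z \<in> cell (1 / real n) (k, l)"
  shows "v z = w z"
  unfolding bilinear_interpolation[OF n v(1) z] bilinear_interpolation[OF n v(2) z] eq ..

lemma unit_interval_cover:
  fixes t :: real
  assumes "real a \<le> t" "t \<le> real (a + m)" "0 < m"
  shows "\<exists>k. a \<le> k \<and> k < a + m \<and> real k \<le> t \<and> t \<le> real k + 1"
proof (cases "t = real (a + m)")
  case True
  \<comment> \<open>Rounding down would move the right end point to an interval outside the range;
    it is assigned to the last closed interval instead.\<close>
  then show ?thesis using assms(3) by (intro exI[of _ "a + m - 1"]) (auto simp: of_nat_diff)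
next
  case False
  have t0: "0 \<le> t" using assms(1) by (meson of_nat_0_le_iff order_trans)
  define k where "k = nat \<lfloor>t\<rfloor>"
  have k: "real k = of_int \<lfloor>t\<rfloor>" using t0 by (simp add: k_def)
  have b: "real k \<le> t" "t < real k + 1" unfolding k by linarith+
  have "a \<le> k" using assms(1) b by linarith
  moreover have "real k < real (a + m)" using b False assms(2) by linarith
  then have "k < a + m" by linarith
  ultimately show ?thesis using b by auto
qed

definition tent :: "real \<Rightarrow> real" where "tent t = max 0 (1 - \<bar>t\<bar>)"

lemma tent_affine:
  "\<exists>\<alpha> \<beta>. \<forall>x. real k \<le> x * c \<longrightarrow> x * c \<le> real k + 1 \<longrightarrow> tent (x * c - real p) = \<alpha> + \<beta> * x"
proof -
  consider "p = k" | "p = Suc k" | "p < k" | "Suc k < p" by linarith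
  then show ?thesis
  proof cases
    case 1
    then show ?thesis by (intro exI[of _ "1 + real k"] exI[of _ "- c"]) (auto simp: tent_def)
  next
    case 2
    then show ?thesis by (intro exI[of _ "- real k"] exI[of _ c]) (auto simp: tent_def)
  next
    case 3
    then have "real p + 1 \<le> real k" by linarith
    then show ?thesis by (intro exI[of _ 0]) (auto simp: tent_def)
  next
    case 4
    then have "real k + 2 \<le> real p" by linarith
    then show ?thesis by (intro exI[of _ 0]) (auto simp: tent_def)
  qed
qed

section \<open>The nodal basis of the finite element space\<close>

locale fe_mesh =
  fixes N r :: nat
  assumes N: "2 \<le> N" and r: "2 \<le> r"
begin

abbreviation n :: nat where "n \<equiv> N * r"

lemma n_pos: "0 < n" using N r by simp

lemma mesh_h_alt: "mesh_h N r = 1 / real n" by (simp add: mesh_h_def)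

lemma hat_alt: "hat N r p z = tent (fst z * real n - real (fst p)) * tent (snd z * real n - real (snd p))"
proof -
  have "\<bar>x - real a * (1 / real n)\<bar> / (1 / real n) = \<bar>x * real n - real a\<bar>" for x a
  proof -
    have "x - real a * (1 / real n) = (x * real n - real a) / real n" using n_pos N r by (simp add: field_simps)
    then show ?thesis using n_pos N r by (simp add: abs_divide)
  qed
  then show ?thesis by (simp only: hat_def tent_def node_pt_def mesh_h_alt split_beta fst_conv snd_conv)
qed

lemma nodal_hat: "nodal n (hat N r p) k l = (if (k, l) = p then 1 else 0)"
proof -
  have "tent (real a - real b) = (if a = b then 1 else 0)" for a b
    by (auto simp: tent_def)
  then show ?thesis using n_pos N r by (cases p) (simp add: nodal_def hat_alt)
qed

lemma hat_bilinear: "bilinear_on (cell (1 / real n) e) (hat N r p)"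
proof -
  obtain a b where ab: "\<And>x. real (fst e) \<le> x * real n \<Longrightarrow> x * real n \<le> real (fst e) + 1 \<Longrightarrow>
      tent (x * real n - real (fst p)) = a + b * x" using tent_affine by metis
  obtain c d where cd: "\<And>x. real (snd e) \<le> x * real n \<Longrightarrow> x * real n \<le> real (snd e) + 1 \<Longrightarrow>
      tent (x * real n - real (snd p)) = c + d * x" using tent_affine by metis
  show ?thesis unfolding bilinear_on_alt
    by (intro exI[of _ "a * c"] exI[of _ "b * c"] exI[of _ "a * d"] exI[of _ "b * d"])
      (auto simp: cell_alt[OF n_pos] hat_alt ab cd algebra_simps simp del: of_nat_mult)
qed

lemma \<Omega>_alt: "x \<in> \<Omega> \<longleftrightarrow> 0 < fst x \<and> fst x < 1 \<and> 0 < snd x \<and> snd x < 1"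
  by (cases x) (auto simp: \<Omega>_def box_prod box_real)

lemma hat_Vh:
  assumes p: "p \<in> nodes N r"
  shows "hat N r p \<in> Vh N r"
proof -
  have "continuous_on A (hat N r p)" for A
    unfolding hat_alt[abs_def] tent_def by (intro continuous_intros)
  moreover have "hat N r p x = 0" if x: "x \<notin> \<Omega>" for x
  proof -
    have p': "1 \<le> real (fst p)" "real (fst p) + 1 \<le> real n" "1 \<le> real (snd p)" "real (snd p) + 1 \<le> real n"
      using p by (auto simp: nodes_def simp del: of_nat_mult)
    have t: "tent (y * real n - q) = 0" if "y \<le> 0 \<or> 1 \<le> y" "1 \<le> q" "q + 1 \<le> real n" for y q
    proof -
      have "y * real n \<le> 0" if "y \<le> 0" using that by (intro mult_nonpos_nonneg) auto
      moreover have "1 * real n \<le> y * real n" if "1 \<le> y" using that by (intro mult_right_mono) auto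
      ultimately show ?thesis using that unfolding tent_def by linarith
    qed
    have "(fst x \<le> 0 \<or> 1 \<le> fst x) \<or> (snd x \<le> 0 \<or> 1 \<le> snd x)" using x by (auto simp: \<Omega>_alt)
    then show ?thesis unfolding hat_alt using t p' by auto
  qed
  ultimately show ?thesis using hat_bilinear by (simp add: Vh_def mesh_h_alt)
qed

lemma hat_zero_cell:
  assumes "p \<notin> cell_vertices e" "z \<in> cell (1 / real n) e"
  shows "hat N r p z = 0"
proof -
  have t: "tent (x - real q) = 0" if "real k \<le> x" "x \<le> real k + 1" "q \<noteq> k" "q \<noteq> Suc k" for x q k
  proof -
    have "real q + 1 \<le> real k \<or> real k + 2 \<le> real q" using that(3,4) by linarith
    then show ?thesis using that unfolding tent_def by linarith
  qed
  have "(fst p \<noteq> fst e \<and> fst p \<noteq> Suc (fst e)) \<or> (snd p \<noteq> snd e \<and> snd p \<noteq> Suc (snd e))"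
    using assms(1) by (cases p) (auto simp: cell_vertices_def)
  then show ?thesis using assms(2) t unfolding hat_alt cell_alt[OF n_pos] by auto
qed

lemma Vh_bilinear: "v \<in> Vh N r \<Longrightarrow> e \<in> elems n \<Longrightarrow> bilinear_on (cell (1 / real n) e) v"
  unfolding Vh_def mesh_h_alt by blast

lemma Vh_zero: "v \<in> Vh N r \<Longrightarrow> x \<notin> \<Omega> \<Longrightarrow> v x = 0"
  unfolding Vh_def by blast

lemma Vh_pw_bilinear: "Vh N r \<subseteq> pw_bilinear n"
  unfolding pw_bilinear_def using Vh_bilinear bilinear_on_subset ocell_subset_cell by blast

lemma subspace_Vh: "fs.subspace (Vh N r)"
proof -
  have bl: "bilinear_on T (v + w)" "bilinear_on T (c *\<^sub>f v)" if bv: "bilinear_on T v" and bw: "bilinear_on T w" for T v w c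
  proof -
    obtain c0 c1 c2 c3 where v: "\<forall>z\<in>T. v z = c0 + c1 * fst z + c2 * snd z + c3 * fst z * snd z"
      using bv unfolding bilinear_on_alt by blast
    obtain d0 d1 d2 d3 where w: "\<forall>z\<in>T. w z = d0 + d1 * fst z + d2 * snd z + d3 * fst z * snd z"
      using bw unfolding bilinear_on_alt by blast
    show "bilinear_on T (v + w)" unfolding bilinear_on_alt
      by (intro exI[of _ "c0 + d0"] exI[of _ "c1 + d1"] exI[of _ "c2 + d2"] exI[of _ "c3 + d3"])
        (use v w in \<open>auto simp: algebra_simps\<close>)
    show "bilinear_on T (c *\<^sub>f v)" unfolding bilinear_on_alt
      by (intro exI[of _ "c * c0"] exI[of _ "c * c1"] exI[of _ "c * c2"] exI[of _ "c * c3"])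
        (use v in \<open>auto simp: algebra_simps fscale_def\<close>)
  qed
  have z: "bilinear_on T 0" for T unfolding bilinear_on_alt by (auto intro!: exI[of _ 0])
  show ?thesis unfolding fs.subspace_def
  proof (intro conjI ballI allI)
    show "0 \<in> Vh N r" by (simp add: Vh_def z zero_fun_def[symmetric])
    show "v + w \<in> Vh N r" if "v \<in> Vh N r" "w \<in> Vh N r" for v w
      using that bl unfolding Vh_def by (auto simp: plus_fun_def intro!: continuous_on_add)
    show "c *\<^sub>f v \<in> Vh N r" if "v \<in> Vh N r" for c v
      using that bl(2)[of _ v v] unfolding Vh_def by (auto simp: fscale_def intro!: continuous_on_mult continuous_on_const)
  qed
qed

lemma nodal_scale: "nodal n (c *\<^sub>f v) k l = c * nodal n v k l"
  and nodal_zero: "nodal n 0 k l = 0"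
  and nodal_diff: "nodal n (v - w) k l = nodal n v k l - nodal n w k l"
  by (simp_all add: nodal_def fscale_def)

lemma nodal_sum: "nodal n (sum f I) k l = (\<Sum>i\<in>I. nodal n (f i) k l)"
  by (induction I rule: infinite_finite_induct) (simp_all add: nodal_def)

lemma Vh_nodal_boundary:
  assumes "v \<in> Vh N r" "k = 0 \<or> n \<le> k \<or> l = 0 \<or> n \<le> l"
  shows "nodal n v k l = 0"
proof -
  have "(real k / real n, real l / real n) \<notin> \<Omega>"
    using assms(2) n_pos N r by (auto simp: \<Omega>_alt field_simps simp flip: of_nat_mult)
  then show ?thesis unfolding nodal_def using Vh_zero[OF assms(1)] by blast
qed

lemma \<Omega>_cover:
  assumes "x \<in> \<Omega>"
  shows "\<exists>e\<in>elems n. x \<in> cell (1 / real n) e"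
proof -
  have x: "0 < fst x" "fst x < 1" "0 < snd x" "snd x < 1" using assms by (auto simp: \<Omega>_alt)
  have le: "t * real n \<le> 1 * real n" if "t < 1" for t using that by (intro mult_right_mono) auto
  have "\<exists>k. 0 \<le> k \<and> k < 0 + n \<and> real k \<le> fst x * real n \<and> fst x * real n \<le> real k + 1"
    "\<exists>k. 0 \<le> k \<and> k < 0 + n \<and> real k \<le> snd x * real n \<and> snd x * real n \<le> real k + 1"
    using x n_pos le[of "fst x"] le[of "snd x"] by (intro unit_interval_cover; simp del: of_nat_mult)+
  then obtain k l where "k < n" "l < n" "real k \<le> fst x * real n" "fst x * real n \<le> real k + 1"
    "real l \<le> snd x * real n" "snd x * real n \<le> real l + 1" by auto
  then show ?thesis
    by (intro bexI[of _ "(k, l)"]) (auto simp: cell_alt[OF n_pos] elems_def simp del: of_nat_mult)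
qed

lemma Vh_eqI:
  assumes v: "v \<in> Vh N r" "w \<in> Vh N r" and eq: "\<And>p. p \<in> nodes N r \<Longrightarrow> nodal n v (fst p) (snd p) = nodal n w (fst p) (snd p)"
  shows "v = w"
proof
  fix x
  have nod: "nodal n v k l = nodal n w k l" for k l
    using eq[of "(k, l)"] Vh_nodal_boundary[OF v(1), of k l] Vh_nodal_boundary[OF v(2), of k l]
    by (cases "(k, l) \<in> nodes N r") (auto simp: nodes_def not_le)
  show "v x = w x"
  proof (cases "x \<in> \<Omega>")
    case True
    then obtain e where e: "e \<in> elems n" "x \<in> cell (1 / real n) e" using \<Omega>_cover by blast
    obtain k l where kl: "e = (k, l)" by (cases e)
    show ?thesis
      by (rule bilinear_eqI[OF n_pos, of k l]) (use e v Vh_bilinear kl nod in auto)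
  qed (simp add: Vh_zero[OF v(1)] Vh_zero[OF v(2)])
qed

lemma finite_nodes: "finite (nodes N r)" by (simp add: nodes_def)

lemma Vh_expansion:
  assumes v: "v \<in> Vh N r"
  shows "v = (\<Sum>p\<in>nodes N r. nodal n v (fst p) (snd p) *\<^sub>f hat N r p)"
proof (rule Vh_eqI[OF v])
  show "(\<Sum>p\<in>nodes N r. nodal n v (fst p) (snd p) *\<^sub>f hat N r p) \<in> Vh N r"
    by (intro fs.subspace_sum subspace_Vh fs.subspace_scale hat_Vh)
  fix p assume p: "p \<in> nodes N r"
  have "(\<Sum>q\<in>nodes N r. nodal n v (fst q) (snd q) * (if p = q then 1 else 0)) = nodal n v (fst p) (snd p)"
    using p finite_nodes by (simp add: if_distrib cong: if_cong)
  then show "nodal n v (fst p) (snd p) = nodal n (\<Sum>p\<in>nodes N r. nodal n v (fst p) (snd p) *\<^sub>f hat N r p) (fst p) (snd p)"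
    by (simp add: nodal_sum nodal_scale nodal_hat)
qed

lemma span_hat: "fs.span (hat N r ` nodes N r) = Vh N r"
proof (rule antisym)
  show "fs.span (hat N r ` nodes N r) \<subseteq> Vh N r"
    by (rule fs.span_minimal) (use hat_Vh subspace_Vh in auto)
  show "Vh N r \<subseteq> fs.span (hat N r ` nodes N r)"
  proof
    fix v assume "v \<in> Vh N r"
    then show "v \<in> fs.span (hat N r ` nodes N r)"
      by (subst Vh_expansion) (simp_all add: fs.span_sum fs.span_scale fs.span_base)
  qed
qed

section \<open>Coarse squares as blocks of fine cells\<close>

abbreviation kblock :: "idx \<Rightarrow> idx set" where
  "kblock i \<equiv> block (fst i * r) (snd i * r) r"

lemma kblock_subset: "i \<in> elems N \<Longrightarrow> kblock i \<subseteq> elems n"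
proof -
  assume i: "i \<in> elems N"
  have "a * r + r \<le> N * r" if "a < N" for a using mult_le_mono1[of "Suc a" N r] that by simp
  then have "fst i * r + r \<le> n" "snd i * r + r \<le> n" using i by (auto simp: elems_def)
  then show "kblock i \<subseteq> elems n" by (auto simp: block_def elems_def)
qed

lemma K_alt:
  "x \<in> K N i \<longleftrightarrow> real (fst i * r) \<le> fst x * real n \<and> fst x * real n \<le> real (fst i * r + r) \<and>
    real (snd i * r) \<le> snd x * real n \<and> snd x * real n \<le> real (snd i * r + r)"
proof -
  have N0: "0 < N" using N by simp
  have 1: "real a \<le> t * real N \<longleftrightarrow> real (a * r) \<le> t * real n" for a t
    using r mult_le_cancel_right_pos[of "real r" "real a" "t * real N"] by (simp add: mult.assoc)
  have 2: "t * real N \<le> real a + 1 \<longleftrightarrow> t * real n \<le> real (a * r + r)" for a t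
    using r mult_le_cancel_right_pos[of "real r" "t * real N" "real a + 1"] by (simp add: algebra_simps)
  show ?thesis unfolding K_def cell_alt[OF N0] 1 2 ..
qed

lemma interior_K_alt:
  "x \<in> interior (K N i) \<longleftrightarrow> real (fst i * r) < fst x * real n \<and> fst x * real n < real (fst i * r + r) \<and>
    real (snd i * r) < snd x * real n \<and> snd x * real n < real (snd i * r + r)"
proof -
  have N0: "0 < N" using N by simp
  have 1: "real a < t * real N \<longleftrightarrow> real (a * r) < t * real n" for a t
    using r mult_less_cancel_right_pos[of "real r" "real a" "t * real N"] by (simp add: mult.assoc)
  have 2: "t * real N < real a + 1 \<longleftrightarrow> t * real n < real (a * r + r)" for a t
    using r mult_less_cancel_right_pos[of "real r" "t * real N" "real a + 1"] by (simp add: algebra_simps)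
  show ?thesis using ocell_alt[OF N0, of x i] unfolding K_def ocell_def 1 2 .
qed

lemma K_cover:
  assumes "x \<in> K N i"
  shows "\<exists>e\<in>kblock i. x \<in> cell (1 / real n) e"
proof -
  have r0: "0 < r" using r by simp
  obtain k where k: "fst i * r \<le> k" "k < fst i * r + r" "real k \<le> fst x * real n" "fst x * real n \<le> real k + 1"
    using unit_interval_cover[OF _ _ r0, of "fst i * r" "fst x * real n"] assms unfolding K_alt by blast
  obtain l where l: "snd i * r \<le> l" "l < snd i * r + r" "real l \<le> snd x * real n" "snd x * real n \<le> real l + 1"
    using unit_interval_cover[OF _ _ r0, of "snd i * r" "snd x * real n"] assms unfolding K_alt by blast
  show ?thesis
    by (intro bexI[of _ "(k, l)"]) (use k l in \<open>auto simp: cell_alt[OF n_pos] block_def simp del: of_nat_mult\<close>)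
qed

lemma kblock_cell_subset:
  assumes "e \<in> kblock i"
  shows "cell (1 / real n) e \<subseteq> K N i"
proof
  fix x assume x: "x \<in> cell (1 / real n) e"
  have "real (fst i * r) \<le> real (fst e)" "real (fst e) + 1 \<le> real (fst i * r + r)"
    "real (snd i * r) \<le> real (snd e)" "real (snd e) + 1 \<le> real (snd i * r + r)"
    using assms by (auto simp: block_def simp flip: of_nat_Suc simp del: of_nat_add of_nat_mult)
  then show "x \<in> K N i" using x unfolding K_alt cell_alt[OF n_pos] by linarith
qed

lemma mesh_region_K:
  assumes i: "i \<in> elems N"
  shows "mesh_region n (K N i) (kblock i)"
  unfolding mesh_region_def
proof (intro conjI n_pos kblock_subset i allI impI iffI)
  fix x assume g: "off_grid n x"
  show "\<exists>e\<in>kblock i. x \<in> ocell n e" if x: "x \<in> K N i"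
  proof -
    obtain e where e: "e \<in> kblock i" "x \<in> cell (1 / real n) e" using K_cover[OF x] by blast
    have "fst x * real n \<notin> \<int>" "snd x * real n \<notin> \<int>" using g by (auto simp: off_grid_def)
    then have "fst x * real n \<noteq> real a" "snd x * real n \<noteq> real a" for a by auto
    from this[of "fst e"] this[of "snd e"] this[of "Suc (fst e)"] this[of "Suc (snd e)"]
    have "x \<in> ocell n e" using e(2) unfolding ocell_alt[OF n_pos] cell_alt[OF n_pos]
      by (auto simp: order_less_le simp del: of_nat_mult)
    then show ?thesis using e by blast
  qed
  show "x \<in> K N i" if "\<exists>e\<in>kblock i. x \<in> ocell n e"
    using that ocell_subset_cell kblock_cell_subset by blast
qed

lemma kblock_disjoint:
  assumes "i \<noteq> i'"
  shows "kblock i \<inter> kblock i' = {}"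
proof -
  have "a = b" if "a * r \<le> k" "k < a * r + r" "b * r \<le> k" "k < b * r + r" for a b k
  proof -
    have "k div r = a" "k div r = b" using that r by (auto intro!: div_nat_eqI simp: algebra_simps)
    then show ?thesis by simp
  qed
  then show ?thesis using assms by (cases i; cases i') (auto simp: block_def)
qed

lemma elems_kblocks: "elems n = (\<Union>i\<in>elems N. kblock i)"
proof (rule antisym)
  show "elems n \<subseteq> (\<Union>i\<in>elems N. kblock i)"
  proof
    fix e assume e: "e \<in> elems n"
    have "a div r < N" "a div r * r \<le> a" "a < a div r * r + r" if "a < N * r" for a
      using that r by (auto simp: less_mult_imp_div_less) (metis div_mult_mod_eq mod_less_divisor nat_add_left_cancel_less not_gr_zero not_numeral_le_zero)
    then have "(fst e div r, snd e div r) \<in> elems N" "e \<in> kblock (fst e div r, snd e div r)"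
      using e by (auto simp: elems_def block_def mem_Times_iff)
    then show "e \<in> (\<Union>i\<in>elems N. kblock i)" by blast
  qed
qed (use kblock_subset in blast)

lemma K_split:
  assumes "coefficient \<kappa> \<beta>" "pw_cont n g"
  shows "(LINT x:\<Omega>|lebesgue. \<kappa> x * g x) = (\<Sum>i\<in>elems N. LINT x:K N i|lebesgue. \<kappa> x * g x)"
  by (rule coefficient.region_integral_split[OF assms(1) mesh_region_\<Omega>[OF n_pos] mesh_region_K finite_elems kblock_disjoint elems_kblocks assms(2)])

lemma energy_split: "coefficient \<kappa> \<beta> \<Longrightarrow> v \<in> pw_bilinear n \<Longrightarrow> w \<in> pw_bilinear n \<Longrightarrow>
    energy \<kappa> \<Omega> v w = (\<Sum>i\<in>elems N. energy \<kappa> (K N i) v w)"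
  unfolding energy_def by (intro K_split pw_cont_grad_inner)

lemma mass_split: "coefficient \<kappa> \<beta> \<Longrightarrow> v \<in> pw_bilinear n \<Longrightarrow> w \<in> pw_bilinear n \<Longrightarrow>
    mass \<kappa> \<Omega> v w = (\<Sum>i\<in>elems N. mass \<kappa> (K N i) v w)"
  unfolding mass_def by (intro K_split pw_cont_mult pw_cont_bilinear)

subsection \<open>Definiteness and the Poincare inequality on the domain\<close>

lemma elems_block: "elems m = block 0 0 m"
  by (auto simp: elems_def block_def)

lemma mass_region_sum:
  assumes D: "mesh_region n D Q" and pw: "v \<in> pw_bilinear n" and v: "\<And>e. e \<in> Q \<Longrightarrow> bilinear_on (cell (1 / real n) e) v"
  shows "mass (\<lambda>_. 1) D v v = (\<Sum>e\<in>Q. cell_mass (nodal n v) (fst e) (snd e)) / (real n)\<^sup>2"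
proof -
  have Q: "Q \<subseteq> elems n" using D by (auto simp: mesh_region_def)
  have "mass (\<lambda>_. 1) D v v = (\<Sum>e\<in>Q. LINT z:ocell n e|lebesgue. v z * v z)"
    unfolding mass_def using unit_coeff.region_integral[OF D pw_cont_mult[OF pw_cont_bilinear(1,1), OF pw pw]] by simp
  also have "\<dots> = (\<Sum>e\<in>Q. cell_mass (nodal n v) (fst e) (snd e) / (real n)\<^sup>2)"
    using cell_integrals(2)[OF n_pos _ pw] v Q by (intro sum.cong) auto
  finally show ?thesis by (simp add: sum_divide_distrib)
qed

text \<open>\<open>cell_mass\<close> is a sum of squares of four linear combinations that determine
  the four corner values, and these determine the bilinear function on the closed cell.\<close>

lemma mass_zero_imp:
  assumes D: "mesh_region n D Q" and pw: "v \<in> pw_bilinear n" and v: "\<And>e. e \<in> Q \<Longrightarrow> bilinear_on (cell (1 / real n) e) v"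
    and z: "mass (\<lambda>_. 1) D v v \<le> 0" and e: "e \<in> Q" "x \<in> cell (1 / real n) e"
  shows "v x = 0"
proof -
  have fin: "finite Q" using D finite_elems finite_subset by (auto simp: mesh_region_def)
  have pos: "0 \<le> cell_mass (nodal n v) k l" for k l by (simp add: cell_mass_def)
  have "(\<Sum>e\<in>Q. cell_mass (nodal n v) (fst e) (snd e)) \<le> 0"
  proof -
    have "0 < (real n)\<^sup>2" using n_pos by (simp del: of_nat_mult)
    moreover have "mass (\<lambda>_. 1) D v v = (\<Sum>e\<in>Q. cell_mass (nodal n v) (fst e) (snd e)) / (real n)\<^sup>2"
      by (rule mass_region_sum[OF D pw v])
    ultimately show ?thesis using z by (metis divide_le_0_iff not_le)
  qed
  then have "cell_mass (nodal n v) (fst e) (snd e) = 0"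
    using sum_nonneg_eq_0_iff[OF fin, of "\<lambda>e. cell_mass (nodal n v) (fst e) (snd e)"] pos e(1)
    by (metis (no_types, lifting) order_antisym sum_nonneg)
  then have ops: "mm (nodal n v) (fst e) (snd e) = 0" "dm (nodal n v) (fst e) (snd e) = 0"
    "md (nodal n v) (fst e) (snd e) = 0" "dd (nodal n v) (fst e) (snd e) = 0"
    unfolding cell_mass_def by (simp_all add: add_nonneg_eq_0_iff)
  have corners: "a = 0 \<and> b = 0 \<and> c = 0 \<and> d = 0"
    if "(a + b + c + d) / 4 = 0" "(b + d - a - c) / 2 = 0" "(c + d - a - b) / 2 = 0" "d - b - c + a = 0" for a b c d :: real
    using that by simp
  from corners[OF ops[unfolded cell_ops]] show ?thesis
    using bilinear_interpolation[OF n_pos, of "fst e" "snd e" v x] v[OF e(1)] e(2) by simp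
qed

text \<open>A zero value on a single side of the unit square is enough for its two purposes,
  definiteness of the energy form and a stability bound with constant at most one.\<close>

lemma poincare_\<Omega>:
  assumes \<kappa>: "coefficient \<kappa> \<beta>" and v: "v \<in> Vh N r"
  shows "mass (\<lambda>_. 1) \<Omega> v v \<le> 4 / pi\<^sup>2 * a_form \<kappa> v v"
proof -
  have pw: "v \<in> pw_bilinear n" using v Vh_pw_bilinear by auto
  have "mass (\<lambda>_. 1) \<Omega> v v \<le> 4 / pi\<^sup>2 * (real n / real n)\<^sup>2 * energy (\<lambda>_. 1) \<Omega> v v"
    by (rule poincare_region[of n \<Omega> 0 0 n v])
      (use mesh_region_\<Omega>[OF n_pos] n_pos pw Vh_bilinear[OF v] Vh_nodal_boundary[OF v] elems_block[of n] in auto)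
  also have "\<dots> = 4 / pi\<^sup>2 * energy (\<lambda>_. 1) \<Omega> v v" using n_pos by (simp del: of_nat_mult)
  also have "\<dots> \<le> 4 / pi\<^sup>2 * a_form \<kappa> v v"
    using coefficient.energy_lower[OF \<kappa> mesh_region_\<Omega>[OF n_pos] pw] by (intro mult_left_mono) auto
  finally show ?thesis .
qed

lemma a_form_definite:
  assumes \<kappa>: "coefficient \<kappa> \<beta>" and v: "v \<in> Vh N r" and z: "a_form \<kappa> v v = 0"
  shows "v = 0"
proof
  fix x
  have pw: "v \<in> pw_bilinear n" using v Vh_pw_bilinear by auto
  have m0: "mass (\<lambda>_. 1) \<Omega> v v \<le> 0" using poincare_\<Omega>[OF \<kappa> v] z by simp
  show "v x = 0 x"
  proof (cases "x \<in> \<Omega>")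
    case True
    then obtain e where "e \<in> elems n" "x \<in> cell (1 / real n) e" using \<Omega>_cover by blast
    then show ?thesis using mass_zero_imp[OF mesh_region_\<Omega>[OF n_pos] pw Vh_bilinear[OF v] m0] by simp
  qed (simp add: Vh_zero[OF v])
qed

lemma semi_inner_Vh:
  assumes "coefficient \<kappa> \<beta>"
  shows "semi_inner fscale (Vh N r) (a_form \<kappa>)"
proof -
  interpret semi_inner fscale "pw_bilinear n" "a_form \<kappa>"
    by (rule coefficient.semi_inner_energy[OF assms mesh_region_\<Omega>[OF n_pos]])
  show ?thesis
    by (rule semi_inner_subspace[OF subspace_Vh Vh_pw_bilinear])
qed

lemma fin_inner_Vh:
  assumes "coefficient \<kappa> \<beta>"
  shows "fin_inner fscale (Vh N r) (a_form \<kappa>) (hat N r ` nodes N r)"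
proof -
  interpret semi_inner fscale "Vh N r" "a_form \<kappa>" by (rule semi_inner_Vh[OF assms])
  show ?thesis
    by unfold_locales (use finite_nodes span_hat a_form_definite[OF assms] in auto)
qed

end


section \<open>Local eigenproblems\<close>

context semi_inner
begin

lemma orthonormal_inj:
  assumes "\<And>i. i \<in> I \<Longrightarrow> f i \<in> V" "\<And>i j. i \<in> I \<Longrightarrow> j \<in> I \<Longrightarrow> B (f i) (f j) = (if i = j then 1 else 0)"
  shows "inj_on f I"
proof (rule inj_onI)
  fix i j assume ij: "i \<in> I" "j \<in> I" "f i = f j"
  then have "B (f i) (f j) = 1" using assms(2)[of j j] by simp
  then show "i = j" using assms(2)[OF ij(1,2)] by (simp split: if_splits)
qed

lemma orthonormal_expansion:
  assumes fin: "finite I" and f: "\<And>i. i \<in> I \<Longrightarrow> f i \<in> V"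
    and on: "\<And>i j. i \<in> I \<Longrightarrow> j \<in> I \<Longrightarrow> B (f i) (f j) = (if i = j then 1 else 0)" and x: "x \<in> span (f ` I)"
  shows "x = (\<Sum>i\<in>I. B x (f i) *s* f i)"
proof -
  obtain c where c: "x = (\<Sum>v\<in>f ` I. c v *s* v)" using x span_finite[of "f ` I"] fin by auto
  then have x': "x = (\<Sum>i\<in>I. c (f i) *s* f i)"
    using orthonormal_inj[OF f on] by (simp add: sum.reindex)
  have "B x (f j) = c (f j)" if j: "j \<in> I" for j
  proof -
    have "B x (f j) = (\<Sum>i\<in>I. B (c (f i) *s* f i) (f j))"
      unfolding x' using f j by (intro B_sum_left) auto
    also have "\<dots> = (\<Sum>i\<in>I. if i = j then c (f j) else 0)"
      using f j by (intro sum.cong) (auto simp: B_scale_left on)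
    finally show ?thesis using j fin by simp
  qed
  then show ?thesis using x' by simp
qed

lemma parseval:
  assumes fin: "finite I" and f: "\<And>i. i \<in> I \<Longrightarrow> f i \<in> V"
    and on: "\<And>i j. i \<in> I \<Longrightarrow> j \<in> I \<Longrightarrow> B (f i) (f j) = (if i = j then 1 else 0)" and x: "x \<in> span (f ` I)"
  shows "B x x = (\<Sum>i\<in>I. (B x (f i))\<^sup>2)"
proof -
  have xV: "x \<in> V" using x V_span[of "f ` I"] f by auto
  have "B x x = B (\<Sum>i\<in>I. B x (f i) *s* f i) x"
    using orthonormal_expansion[OF assms] by simp
  also have "\<dots> = (\<Sum>i\<in>I. B (B x (f i) *s* f i) x)"
    using f xV by (intro B_sum_left) auto
  also have "\<dots> = (\<Sum>i\<in>I. (B x (f i))\<^sup>2)"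
    using f xV B_sym[OF xV] by (intro sum.cong) (auto simp: B_scale_left power2_eq_square)
  finally show ?thesis .
qed

lemma semi_inner_mult:
  assumes "0 \<le> (c :: real)"
  shows "semi_inner scale V (\<lambda>x y. c * B x y)"
  using assms by unfold_locales (simp_all add: subspace_V B_add_left B_scale_left B_nonneg distrib_left, metis B_sym)

end

lemma bilinear_on_const: "bilinear_on T (\<lambda>_. c)"
  unfolding bilinear_on_alt by (rule exI[of _ c], rule exI[of _ 0], rule exI[of _ 0], rule exI[of _ 0]) simp

section \<open>Restriction to a coarse square\<close>

locale fe_problem = fe_mesh N r + coefficient \<kappa> \<beta> for N r \<kappa> \<beta>
begin

text \<open>Local eigenfunctions are extended by zero, global functions are not; \<open>cut\<close>
  passes from one kind to the other without changing the forms on the coarse square.\<close>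

definition cut :: "idx \<Rightarrow> fn \<Rightarrow> fn" where
  "cut i v = (\<lambda>x. if x \<in> K N i then v x else 0)"

lemma VhK_alt: "VhK N r i = cut i ` Vh N r"
  by (simp add: VhK_def cut_def)

lemma ocell_K_kblock:
  assumes "x \<in> ocell n e" "x \<in> K N i"
  shows "e \<in> kblock i"
proof -
  have "real (fst i * r) < real (fst e) + 1" "real (fst e) < real (fst i * r + r)"
    "real (snd i * r) < real (snd e) + 1" "real (snd e) < real (snd i * r + r)"
    using assms unfolding K_alt ocell_alt[OF n_pos] by linarith+
  then have "fst i * r < Suc (fst e)" "fst e < fst i * r + r" "snd i * r < Suc (snd e)" "snd e < snd i * r + r"
    unfolding of_nat_Suc[symmetric] of_nat_less_iff add.commute[of _ 1]
    by (simp_all add: of_nat_Suc[symmetric] del: of_nat_Suc of_nat_add of_nat_mult)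
  then show ?thesis by (cases e) (auto simp: block_def)
qed

lemma cut_ocell: "e \<in> kblock i \<Longrightarrow> x \<in> ocell n e \<Longrightarrow> cut i v x = v x"
  unfolding cut_def using kblock_cell_subset ocell_subset_cell by (metis subsetD)

lemma cut_cell: "e \<in> kblock i \<Longrightarrow> x \<in> cell (1 / real n) e \<Longrightarrow> cut i v x = v x"
  unfolding cut_def using kblock_cell_subset by (metis subsetD)

lemma cut_pw_bilinear:
  assumes "v \<in> pw_bilinear n"
  shows "cut i v \<in> pw_bilinear n"
  unfolding pw_bilinear_def
proof (intro CollectI ballI)
  fix e assume e: "e \<in> elems n"
  show "bilinear_on (ocell n e) (cut i v)"
  proof (cases "e \<in> kblock i")
    case True
    have "bilinear_on (ocell n e) v" using assms e by (simp add: pw_bilinear_def)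
    then show ?thesis unfolding bilinear_on_alt using cut_ocell[OF True] by simp
  next
    case False
    then have "cut i v x = 0" if "x \<in> ocell n e" for x
      using ocell_K_kblock[OF that] by (auto simp: cut_def)
    then show ?thesis unfolding bilinear_on_alt by (intro exI[of _ 0]) simp
  qed
qed

lemma Vh_pw: "v \<in> Vh N r \<Longrightarrow> v \<in> pw_bilinear n"
  using Vh_pw_bilinear by blast

lemma cut_bilinear:
  assumes "v \<in> Vh N r" "i \<in> elems N" "e \<in> kblock i"
  shows "bilinear_on (cell (1 / real n) e) (cut i v)"
proof -
  have "bilinear_on (cell (1 / real n) e) v"
    using Vh_bilinear[OF assms(1)] kblock_subset[OF assms(2)] assms(3) by blast
  then show ?thesis unfolding bilinear_on_alt by (simp add: cut_cell[OF assms(3)])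
qed

lemma VhK_pw: "VhK N r i \<subseteq> pw_bilinear n"
  unfolding VhK_alt using cut_pw_bilinear Vh_pw by blast

lemma mass_cut:
  assumes "i \<in> elems N" "v \<in> pw_bilinear n" "w \<in> pw_bilinear n"
  shows "mass \<kappa> (K N i) (cut i v) w = mass \<kappa> (K N i) v w"
  by (rule mass_cong[OF mesh_region_K]) (use assms cut_pw_bilinear cut_ocell in auto)

lemma energy_cut:
  assumes "i \<in> elems N" "v \<in> pw_bilinear n" "w \<in> pw_bilinear n"
  shows "energy \<kappa> (K N i) (cut i v) w = energy \<kappa> (K N i) v w"
  by (rule energy_cong[OF mesh_region_K]) (use assms cut_pw_bilinear cut_ocell in auto)

lemma semi_inner_s_form:
  assumes "i \<in> elems N"
  shows "semi_inner fscale (pw_bilinear n) (s_form N \<kappa> i)"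
proof -
  interpret semi_inner fscale "pw_bilinear n" "mass \<kappa> (K N i)"
    by (rule semi_inner_mass[OF mesh_region_K[OF assms]])
  show ?thesis using semi_inner_mult[of "(real N)\<^sup>2"] by (simp add: s_form_mass[abs_def])
qed

lemma s_form_cut:
  "i \<in> elems N \<Longrightarrow> v \<in> pw_bilinear n \<Longrightarrow> w \<in> pw_bilinear n \<Longrightarrow> s_form N \<kappa> i (cut i v) w = s_form N \<kappa> i v w"
  by (simp add: s_form_mass mass_cut)

end

text \<open>The eigenvalue \<open>\<mu> i\<close> belongs to the coefficient 1, so its lower bound
  is proved with the restriction machinery at that coefficient.\<close>

sublocale fe_mesh \<subseteq> unit: fe_problem N r "\<lambda>_. 1" 1
  by unfold_locales

context fe_mesh
begin

text \<open>All nodes of a coarse square away from the boundary are interior nodes, so the sum of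
  all hats is 1 on it. This makes the constant an admissible test function in the local eigenproblem
  there.\<close>

lemma interior_block_one:
  assumes i: "i \<in> elems N" and int: "fst i \<noteq> 0" "snd i \<noteq> 0" "Suc (fst i) \<noteq> N" "Suc (snd i) \<noteq> N"
  shows "\<exists>T\<in>Vh N r. \<forall>x\<in>K N i. T x = 1"
proof
  define T where "T = (\<Sum>p\<in>nodes N r. hat N r p)"
  show T: "T \<in> Vh N r" unfolding T_def by (intro fs.subspace_sum subspace_Vh hat_Vh)
  have nodT: "nodal n T k l = 1" if "(k, l) \<in> nodes N r" for k l
    using that finite_nodes by (simp add: T_def nodal_sum nodal_hat)
  have lt: "Suc (fst i) < N" "Suc (snd i) < N" using i int by (auto simp: elems_def)
  have bound: "k \<in> {1..<n}" if "a \<noteq> 0" "Suc a < N" "a * r \<le> k" "k \<le> a * r + r" for a k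
  proof -
    have "0 < a * r" using that(1) r by simp
    moreover have "a * r + r < N * r" using mult_less_mono1[OF that(2), of r] r by simp
    ultimately have "1 \<le> k" "k < n" using that(3,4) by linarith+
    then show ?thesis by simp
  qed
  have nod: "(k, l) \<in> nodes N r" if "fst i * r \<le> k" "k \<le> fst i * r + r" "snd i * r \<le> l" "l \<le> snd i * r + r" for k l
    using bound[OF int(1) lt(1) that(1,2)] bound[OF int(2) lt(2) that(3,4)] by (simp add: nodes_def)
  show "\<forall>x\<in>K N i. T x = 1"
  proof
    fix x assume "x \<in> K N i"
    then obtain e where e: "e \<in> kblock i" "x \<in> cell (1 / real n) e" using K_cover by blast
    obtain k l where kl: "e = (k, l)" by (cases e)
    have b: "fst i * r \<le> k" "k < fst i * r + r" "snd i * r \<le> l" "l < snd i * r + r"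
      using e(1) kl by (auto simp: block_def)
    have "bilinear_on (cell (1 / real n) (k, l)) (\<lambda>_. 1)"
      by (rule bilinear_on_const)
    moreover have "bilinear_on (cell (1 / real n) (k, l)) T"
      using Vh_bilinear[OF T] kblock_subset[OF i] e kl by auto
    ultimately show "T x = 1"
    proof -
      have nod1: "nodal n T a c = nodal n (\<lambda>_. 1) a c" if "a \<in> {k, Suc k}" "c \<in> {l, Suc l}" for a c
      proof -
        have "nodal n T a c = 1" using b that by (intro nodT nod) auto
        then show ?thesis by (simp add: nodal_def)
      qed
      assume bl: "bilinear_on (cell (1 / real n) (k, l)) (\<lambda>_. 1)" "bilinear_on (cell (1 / real n) (k, l)) T"
      show "T x = 1"
        by (rule bilinear_eqI[OF n_pos bl(2,1)]) (use nod1 e(2) kl in simp_all)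
    qed
  qed
qed

text \<open>A coarse square touching the boundary inherits a zero side. On any other square, testing
  with the constant gives 0 = \<open>\<mu>\<close> times the mean up to scaling, and
  \<open>0 < \<mu>\<close> forces mean zero. Either way \<open>poincare_region\<close> applies with
  side length 1/N, and N^2 in \<open>s_form\<close> compensates it.\<close>

lemma smallest_pos_eigenvalue_lower:
  assumes i: "i \<in> elems N" and ep: "eigenpair N r (\<lambda>_. 1) i \<mu> v" and \<mu>: "0 < \<mu>"
  shows "pi\<^sup>2 / 4 \<le> \<mu>"
proof -
  note reg = mesh_region_K[OF i]
  have v: "v \<in> VhK N r i" "v \<noteq> 0"
    and eig: "\<And>w. w \<in> VhK N r i \<Longrightarrow> energy (\<lambda>_. 1) (K N i) v w = \<mu> * s_form N (\<lambda>_. 1) i v w"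
    using ep by (auto simp: eigenpair_def)
  obtain u where u: "u \<in> Vh N r" "v = unit.cut i u" using v(1) unit.VhK_alt by auto
  have pw: "v \<in> pw_bilinear n" using v unit.VhK_pw by blast
  have bil: "\<And>e. e \<in> kblock i \<Longrightarrow> bilinear_on (cell (1 / real n) e) v" using unit.cut_bilinear[OF u(1) i] u(2) by simp
  have nod: "nodal n v k l = nodal n u k l" if "fst i * r \<le> k" "k \<le> fst i * r + r" "snd i * r \<le> l" "l \<le> snd i * r + r" for k l
  proof -
    have "(real k / real n, real l / real n) \<in> K N i"
      unfolding K_alt using that n_pos by (simp del: of_nat_mult of_nat_add)
    then show ?thesis by (simp add: nodal_def u(2) unit.cut_def)
  qed
  have bc: "(\<forall>l\<le>r. nodal n v (fst i * r) (snd i * r + l) = 0) \<or> (\<forall>l\<le>r. nodal n v (fst i * r + r) (snd i * r + l) = 0) \<or>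
      (\<forall>l\<le>r. nodal n v (fst i * r + l) (snd i * r) = 0) \<or> (\<forall>l\<le>r. nodal n v (fst i * r + l) (snd i * r + r) = 0)
      \<or> (LINT z:K N i|lebesgue. v z) = 0"
  proof -
    have last: "a * r + r = n" if "Suc a = N" for a using that by auto
    consider "fst i = 0" | "snd i = 0" | "Suc (fst i) = N" | "Suc (snd i) = N"
      | "fst i \<noteq> 0" "snd i \<noteq> 0" "Suc (fst i) \<noteq> N" "Suc (snd i) \<noteq> N" by blast
    then show ?thesis
    proof cases
      case 1
      then show ?thesis by (auto simp: nod Vh_nodal_boundary[OF u(1)])
    next
      case 2
      then show ?thesis by (auto simp: nod Vh_nodal_boundary[OF u(1)])
    next
      case 3
      then have "\<forall>l\<le>r. nodal n v (fst i * r + r) (snd i * r + l) = 0"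
        using last[OF 3] by (auto simp: nod Vh_nodal_boundary[OF u(1)])
      then show ?thesis by blast
    next
      case 4
      then have "\<forall>l\<le>r. nodal n v (fst i * r + l) (snd i * r + r) = 0"
        using last[OF 4] by (auto simp: nod Vh_nodal_boundary[OF u(1)])
      then show ?thesis by blast
    next
      case 5
      obtain T where T: "T \<in> Vh N r" "\<forall>x\<in>K N i. T x = 1" using interior_block_one[OF i 5] by blast
      have cT: "unit.cut i T \<in> VhK N r i" using T(1) by (simp add: unit.VhK_alt)
      have one: "(\<lambda>_. 1) \<in> pw_bilinear n"
        unfolding pw_bilinear_def using bilinear_on_const by blast
      have eqT: "unit.cut i T x = 1" if "e \<in> kblock i" "x \<in> ocell n e" for e x
        using unit.cut_ocell[OF that, of T] T(2) kblock_cell_subset[OF that(1)] ocell_subset_cell that(2) by (metis subsetD)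
      have "energy (\<lambda>_. 1) (K N i) v (unit.cut i T) = energy (\<lambda>_. 1) (K N i) v (\<lambda>_. 1)"
        by (rule unit_coeff.energy_cong[OF reg pw pw _ one]) (use subsetD[OF unit.VhK_pw cT] eqT in simp_all)
      also have "\<dots> = 0" by (simp add: energy_def grad_def zero_prod_def[symmetric])
      finally have "s_form N (\<lambda>_. 1) i v (unit.cut i T) = 0" using eig[OF cT] \<mu> by simp
      then have "mass (\<lambda>_. 1) (K N i) v (unit.cut i T) = 0" using N by (simp add: s_form_mass)
      also have "mass (\<lambda>_. 1) (K N i) v (unit.cut i T) = mass (\<lambda>_. 1) (K N i) v (\<lambda>_. 1)"
        by (rule unit_coeff.mass_cong[OF reg pw pw _ one]) (use subsetD[OF unit.VhK_pw cT] eqT in simp_all)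
      finally show ?thesis by (simp add: mass_def)
    qed
  qed
  have "mass (\<lambda>_. 1) (K N i) v v \<le> 4 / pi\<^sup>2 * (real r / real n)\<^sup>2 * energy (\<lambda>_. 1) (K N i) v v"
    using r by (intro poincare_region[OF reg _ pw bil bc]) auto
  also have "\<dots> = 4 / pi\<^sup>2 * (real r / real n)\<^sup>2 * (\<mu> * ((real N)\<^sup>2 * mass (\<lambda>_. 1) (K N i) v v))"
    using eig[OF v(1)] by (simp add: s_form_mass)
  also have "\<dots> = (4 / pi\<^sup>2 * \<mu>) * mass (\<lambda>_. 1) (K N i) v v"
    using N r by (simp add: power_divide power_mult_distrib)
  finally have le: "1 * mass (\<lambda>_. 1) (K N i) v v \<le> (4 / pi\<^sup>2 * \<mu>) * mass (\<lambda>_. 1) (K N i) v v" by simp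
  have "0 < mass (\<lambda>_. 1) (K N i) v v"
  proof (rule ccontr)
    assume "\<not> ?thesis"
    then have z: "mass (\<lambda>_. 1) (K N i) v v \<le> 0" by simp
    have "v x = 0" for x
    proof (cases "x \<in> K N i")
      case True
      then obtain e where "e \<in> kblock i" "x \<in> cell (1 / real n) e" using K_cover by blast
      then show ?thesis using mass_zero_imp[OF reg pw bil z] by simp
    qed (simp add: u(2) unit.cut_def)
    then show False using v(2) by auto
  qed
  then have "1 \<le> 4 / pi\<^sup>2 * \<mu>" using le by (rule mult_right_le_imp_le[rotated])
  then show ?thesis by (simp add: field_simps)
qed

end

section \<open>Expansion in local eigenfunctions and the kernel inequality\<close>

context fe_problem
begin

text \<open>The eigenbasis spans the restrictions, while \<open>v\<close> is global. Both forms see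
  only the coarse square, so \<open>v\<close> may be exchanged for \<open>cut i v\<close>, to which
  Parseval and the eigenvalue equation apply.\<close>

lemma eigenbasis_expansion:
  assumes i: "i \<in> elems N" and eb: "eigenbasis N r \<kappa> i lam \<psi>" and v: "v \<in> Vh N r"
  defines "d \<equiv> local_dim N r i"
  shows "s_form N \<kappa> i v v = (\<Sum>j<d. (s_form N \<kappa> i v (\<psi> j))\<^sup>2)"
    "energy \<kappa> (K N i) v v = (\<Sum>j<d. lam j * (s_form N \<kappa> i v (\<psi> j))\<^sup>2)"
    "\<And>j. j < d \<Longrightarrow> \<psi> j \<in> pw_bilinear n"
proof -
  have \<psi>: "\<And>j. j < d \<Longrightarrow> \<psi> j \<in> VhK N r i"
    and eig: "\<And>j w. j < d \<Longrightarrow> w \<in> VhK N r i \<Longrightarrow> energy \<kappa> (K N i) (\<psi> j) w = lam j * s_form N \<kappa> i (\<psi> j) w"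
    and on: "\<And>j l. j < d \<Longrightarrow> l < d \<Longrightarrow> s_form N \<kappa> i (\<psi> j) (\<psi> l) = (if j = l then 1 else 0)"
    and sp: "fs.span (\<psi> ` {..<d}) = VhK N r i"
    using eb by (auto simp: eigenbasis_def eigenpair_def d_def)
  show \<psi>pw: "\<And>j. j < d \<Longrightarrow> \<psi> j \<in> pw_bilinear n" using \<psi> VhK_pw by blast
  interpret s: semi_inner fscale "pw_bilinear n" "s_form N \<kappa> i" by (rule semi_inner_s_form[OF i])
  interpret E: semi_inner fscale "pw_bilinear n" "energy \<kappa> (K N i)" by (rule semi_inner_energy[OF mesh_region_K[OF i]])
  define w where "w = cut i v"
  have w: "w \<in> VhK N r i" using v by (simp add: w_def VhK_alt)
  have pw: "v \<in> pw_bilinear n" "w \<in> pw_bilinear n" using v w Vh_pw subsetD[OF VhK_pw] by blast+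
  have sw: "s_form N \<kappa> i w (\<psi> j) = s_form N \<kappa> i v (\<psi> j)" if "j < d" for j
    unfolding w_def using s_form_cut[OF i pw(1) \<psi>pw[OF that]] .
  have sww: "s_form N \<kappa> i w w = s_form N \<kappa> i v v"
    using s_form_cut[OF i pw] s.B_sym[OF pw] s_form_cut[OF i pw(1,1)] by (simp add: w_def)
  have Eww: "energy \<kappa> (K N i) w w = energy \<kappa> (K N i) v v"
    using energy_cut[OF i pw] E.B_sym[OF pw] energy_cut[OF i pw(1,1)] by (simp add: w_def)
  have wsp: "w \<in> fs.span (\<psi> ` {..<d})" using w sp by simp
  show "s_form N \<kappa> i v v = (\<Sum>j<d. (s_form N \<kappa> i v (\<psi> j))\<^sup>2)"
    using s.parseval[of "{..<d}" \<psi> w] \<psi>pw on wsp sw sww by simp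
  have "w = (\<Sum>j<d. s_form N \<kappa> i w (\<psi> j) *\<^sub>f \<psi> j)"
    by (rule s.orthonormal_expansion) (use \<psi>pw on wsp in auto)
  then have "energy \<kappa> (K N i) w w = energy \<kappa> (K N i) (\<Sum>j<d. s_form N \<kappa> i w (\<psi> j) *\<^sub>f \<psi> j) w" by simp
  also have "\<dots> = (\<Sum>j<d. energy \<kappa> (K N i) (s_form N \<kappa> i w (\<psi> j) *\<^sub>f \<psi> j) w)"
    using \<psi>pw pw by (intro E.B_sum_left) auto
  also have "\<dots> = (\<Sum>j<d. lam j * (s_form N \<kappa> i v (\<psi> j))\<^sup>2)"
  proof (intro sum.cong refl)
    fix j assume "j \<in> {..<d}"
    then have j: "j < d" by simp
    show "energy \<kappa> (K N i) (s_form N \<kappa> i w (\<psi> j) *\<^sub>f \<psi> j) w = lam j * (s_form N \<kappa> i v (\<psi> j))\<^sup>2"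
      using \<psi>pw[OF j] pw eig[OF j w] sw[OF j] s.B_sym[of w "\<psi> j"] by (simp add: E.B_scale_left power2_eq_square)
  qed
  finally show "energy \<kappa> (K N i) v v = (\<Sum>j<d. lam j * (s_form N \<kappa> i v (\<psi> j))\<^sup>2)" using Eww by simp
qed

lemma s_form_bessel:
  assumes i: "i \<in> elems N" and eb: "eigenbasis N r \<kappa> i lam \<psi>" and v: "v \<in> Vh N r" and l: "l \<le> local_dim N r i"
  shows "(\<Sum>j<l. (s_form N \<kappa> i v (\<psi> j))\<^sup>2) \<le> s_form N \<kappa> i v v"
  unfolding eigenbasis_expansion(1)[OF i eb v] using l by (intro sum_mono2) auto

text \<open>Only indices with eigenvalue above pi^2 / 8 carry nonzero coefficients. Passing to the
  unweighted mass at the end uses 1 <= kappa, which is why no \<open>\<beta>\<close> enters the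
  constant.\<close>

lemma kernel_poincare_local:
  assumes i: "i \<in> elems N" and eb: "eigenbasis N r \<kappa> i lam \<psi>" and v: "v \<in> Vh N r"
    and \<mu>: "smallest_pos_eigenvalue N r i \<mu>"
    and ker: "\<And>j. j < l \<Longrightarrow> s_form N \<kappa> i v (\<psi> j) = 0"
    and lam: "\<And>j. l \<le> j \<Longrightarrow> j < local_dim N r i \<Longrightarrow> \<mu> / 2 < lam j"
  shows "mass (\<lambda>_. 1) (K N i) v v \<le> 8 / pi\<^sup>2 / (real N)\<^sup>2 * energy \<kappa> (K N i) v v"
proof -
  let ?s = "s_form N \<kappa> i"
  have \<mu>': "pi\<^sup>2 / 4 \<le> \<mu>" using \<mu> smallest_pos_eigenvalue_lower[OF i] by (auto simp: smallest_pos_eigenvalue_def)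
  have "pi\<^sup>2 / 8 * ?s v v = (\<Sum>j<local_dim N r i. pi\<^sup>2 / 8 * (?s v (\<psi> j))\<^sup>2)"
    unfolding eigenbasis_expansion(1)[OF i eb v] by (simp add: sum_distrib_left)
  also have "\<dots> \<le> (\<Sum>j<local_dim N r i. lam j * (?s v (\<psi> j))\<^sup>2)"
  proof (rule sum_mono)
    fix j assume j: "j \<in> {..<local_dim N r i}"
    show "pi\<^sup>2 / 8 * (?s v (\<psi> j))\<^sup>2 \<le> lam j * (?s v (\<psi> j))\<^sup>2"
    proof (cases "j < l")
      case False
      then have "pi\<^sup>2 / 8 \<le> lam j" using lam[of j] j \<mu>' by simp
      then show ?thesis by (rule mult_right_mono) simp
    qed (simp add: ker)
  qed
  also have "\<dots> = energy \<kappa> (K N i) v v" by (rule eigenbasis_expansion(2)[OF i eb v, symmetric])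
  finally have "pi\<^sup>2 / 8 * ((real N)\<^sup>2 * mass \<kappa> (K N i) v v) \<le> energy \<kappa> (K N i) v v" by (simp add: s_form_mass)
  then have "mass \<kappa> (K N i) v v \<le> 8 / pi\<^sup>2 / (real N)\<^sup>2 * energy \<kappa> (K N i) v v"
    using N by (simp add: field_simps)
  then show ?thesis using mass_lower[OF mesh_region_K[OF i] Vh_pw[OF v]] by linarith
qed

lemma kernel_poincare:
  assumes eb: "\<And>i. i \<in> elems N \<Longrightarrow> eigenbasis N r \<kappa> i (lam i) (\<psi> i)" and v: "v \<in> Vh N r"
    and \<mu>: "\<And>i. i \<in> elems N \<Longrightarrow> smallest_pos_eigenvalue N r i (\<mu> i)"
    and ker: "\<And>i j. i \<in> elems N \<Longrightarrow> j < L i \<Longrightarrow> s_form N \<kappa> i v (\<psi> i j) = 0"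
    and lam: "\<And>i j. i \<in> elems N \<Longrightarrow> L i \<le> j \<Longrightarrow> j < local_dim N r i \<Longrightarrow> \<mu> i / 2 < lam i j"
  shows "mass (\<lambda>_. 1) \<Omega> v v \<le> 8 / pi\<^sup>2 / (real N)\<^sup>2 * a_form \<kappa> v v"
proof -
  have "mass (\<lambda>_. 1) \<Omega> v v = (\<Sum>i\<in>elems N. mass (\<lambda>_. 1) (K N i) v v)"
    by (rule mass_split[OF unit_coeff.coefficient_axioms Vh_pw[OF v] Vh_pw[OF v]])
  also have "\<dots> \<le> (\<Sum>i\<in>elems N. 8 / pi\<^sup>2 / (real N)\<^sup>2 * energy \<kappa> (K N i) v v)"
    using kernel_poincare_local[OF _ eb v \<mu> ker lam] by (intro sum_mono) auto
  also have "\<dots> = 8 / pi\<^sup>2 / (real N)\<^sup>2 * a_form \<kappa> v v"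
    using energy_split[OF coefficient_axioms Vh_pw[OF v] Vh_pw[OF v]] by (simp add: sum_distrib_left)
  finally show ?thesis .
qed

end

section \<open>Square integrable functions\<close>

lemma L2_mult_integrable:
  assumes "f \<in> L2" "g \<in> L2"
  shows "set_integrable lebesgue \<Omega> (\<lambda>x. f x * g x)"
proof (rule set_integrable_bound)
  show "set_integrable lebesgue \<Omega> (\<lambda>x. (f x)\<^sup>2 + (g x)\<^sup>2)"
    using assms by (intro set_integral_add) (auto simp: L2_def)
  have "(\<lambda>x. (indicator \<Omega> x *\<^sub>R f x) * (indicator \<Omega> x *\<^sub>R g x)) \<in> borel_measurable lebesgue"
    using assms by (intro borel_measurable_times) (auto simp: L2_def set_borel_measurable_def)
  moreover have "(\<lambda>x. (indicator \<Omega> x *\<^sub>R f x) * (indicator \<Omega> x *\<^sub>R g x)) = (\<lambda>x. indicator \<Omega> x *\<^sub>R (f x * g x))"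
    by (auto simp: indicator_def fun_eq_iff)
  ultimately show "set_borel_measurable lebesgue \<Omega> (\<lambda>x. f x * g x)"
    by (simp add: set_borel_measurable_def)
  have "\<bar>f x * g x\<bar> \<le> \<bar>(f x)\<^sup>2 + (g x)\<^sup>2\<bar>" for x
  proof -
    have "0 \<le> (\<bar>f x\<bar> - \<bar>g x\<bar>)\<^sup>2" by simp
    then have "2 * (\<bar>f x\<bar> * \<bar>g x\<bar>) \<le> (f x)\<^sup>2 + (g x)\<^sup>2" by (simp add: power2_diff)
    moreover have "0 \<le> \<bar>f x\<bar> * \<bar>g x\<bar>" by simp
    ultimately show ?thesis unfolding abs_mult by linarith
  qed
  then show "AE x in lebesgue. x \<in> \<Omega> \<longrightarrow> norm (f x * g x) \<le> norm ((f x)\<^sup>2 + (g x)\<^sup>2)" by simp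
qed

lemma semi_inner_L2: "semi_inner fscale L2 L2_prod"
proof unfold_locales
  show "fs.subspace L2" unfolding fs.subspace_def
  proof (intro conjI ballI allI)
    show "0 \<in> L2" by (simp add: L2_def set_borel_measurable_def set_integrable_def)
    fix f assume f: "f \<in> L2"
    show "c *\<^sub>f f \<in> L2" for c
    proof -
      have "(\<lambda>x. c * (indicator \<Omega> x *\<^sub>R f x)) \<in> borel_measurable lebesgue"
        using f by (intro borel_measurable_times) (auto simp: L2_def set_borel_measurable_def)
      moreover have "set_integrable lebesgue \<Omega> (\<lambda>x. c\<^sup>2 * (f x)\<^sup>2)" using f by (auto simp: L2_def)
      ultimately show ?thesis by (simp add: L2_def set_borel_measurable_def fscale_def power_mult_distrib mult.left_commute)
    qed
    fix g assume g: "g \<in> L2"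
    have "(\<lambda>x. indicator \<Omega> x *\<^sub>R f x + indicator \<Omega> x *\<^sub>R g x) \<in> borel_measurable lebesgue"
      using f g by (intro borel_measurable_add) (auto simp: L2_def set_borel_measurable_def)
    moreover have "set_integrable lebesgue \<Omega> (\<lambda>x. (f x)\<^sup>2 + (g x)\<^sup>2 + 2 * (f x * g x))"
      using f g L2_mult_integrable[OF f g] by (intro set_integral_add) (auto simp: L2_def)
    ultimately show "f + g \<in> L2"
      by (simp add: L2_def set_borel_measurable_def plus_fun_def power2_sum distrib_left mult.assoc)
  qed
  fix f g h assume f: "f \<in> L2" and h: "h \<in> L2"
  show "L2_prod (c *\<^sub>f f) h = c * L2_prod f h" for c
    by (simp add: L2_prod_def fscale_def mult.assoc)
  show "L2_prod f h = L2_prod h f" by (simp add: L2_prod_def mult.commute)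
  show "0 \<le> L2_prod f f"
    unfolding L2_prod_def set_lebesgue_integral_def by (intro Bochner_Integration.integral_nonneg) auto
  assume g: "g \<in> L2"
  show "L2_prod (f + g) h = L2_prod f h + L2_prod g h"
    using set_integral_add(2)[OF L2_mult_integrable[OF f h] L2_mult_integrable[OF g h]]
    by (simp add: L2_prod_def distrib_right)
qed

lemma L2_prod_mass: "L2_prod v w = mass (\<lambda>_. 1) \<Omega> v w"
  by (simp add: L2_prod_def mass_def)

lemma (in fe_mesh) Vh_L2: "Vh N r \<subseteq> L2"
proof
  fix v assume "v \<in> Vh N r"
  then have pw: "v \<in> pw_bilinear n" using Vh_pw_bilinear by blast
  note I = unit_coeff.region_integrable[OF mesh_region_\<Omega>[OF n_pos]]
  have "set_integrable lebesgue \<Omega> v" using I[OF pw_cont_bilinear(1)[OF pw]] by simp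
  moreover have "set_integrable lebesgue \<Omega> (\<lambda>x. (v x)\<^sup>2)"
    using I[OF pw_cont_power2[OF pw_cont_bilinear(1)[OF pw]]] by simp
  ultimately show "v \<in> L2"
    unfolding L2_def set_integrable_def set_borel_measurable_def by (auto intro: borel_measurable_integrable)
qed


section \<open>Matrices\<close>

lemma mat_inv_inverts:
  fixes A :: "real mat"
  assumes A: "A \<in> carrier_mat m m" and U: "A \<in> Units (ring_mat TYPE(real) m ())"
  shows "A * mat_inv A = 1\<^sub>m m" "mat_inv A * A = 1\<^sub>m m" "mat_inv A \<in> carrier_mat m m"
proof -
  obtain B where B: "mat_inverse A = Some B"
    using mat_inverse(1)[OF A, where b = "()"] U by (cases "mat_inverse A") auto
  then have "mat_inv A = B" by (simp add: mat_inv_def)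
  then show "A * mat_inv A = 1\<^sub>m m" "mat_inv A * A = 1\<^sub>m m" "mat_inv A \<in> carrier_mat m m"
    using mat_inverse(2)[OF A B] by auto
qed

lemma invertible_mat_Units:
  assumes A: "(A :: real mat) \<in> carrier_mat m m" and inv: "invertible_mat A"
  shows "A \<in> Units (ring_mat TYPE(real) m ())"
proof -
  obtain B where B: "A * B = 1\<^sub>m (dim_row A)" "B * A = 1\<^sub>m (dim_row B)"
    using inv by (auto simp: invertible_mat_def inverts_mat_def)
  have "dim_col (A * B) = m" using B(1) A by simp
  moreover have "dim_col (B * A) = m" using A by simp
  then have "dim_row B = m" using B(2) by simp
  ultimately have "B \<in> carrier_mat m m" by auto
  then show ?thesis using A B by (auto simp: Units_def ring_mat_def)
qed

lemma sum_mult_mat: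
  fixes A B :: "real mat"
  assumes "A * B = 1\<^sub>m m" "A \<in> carrier_mat m m" "B \<in> carrier_mat m m" "j < m" "k < m"
  shows "(\<Sum>l<m. A $$ (j, l) * B $$ (l, k)) = (if j = k then 1 else 0)"
proof -
  have "(A * B) $$ (j, k) = (\<Sum>l<m. A $$ (j, l) * B $$ (l, k))"
    using assms(2-5) by (simp add: scalar_prod_def lessThan_atLeast0)
  then show ?thesis using assms(1,4,5) by simp
qed

lemma sum_cauchy_schwarz: "\<bar>\<Sum>i\<in>I. a i * b i\<bar> \<le> sqrt (\<Sum>i\<in>I. (a i)\<^sup>2) * sqrt (\<Sum>i\<in>I. (b i)\<^sup>2)"
  for a b :: "'i \<Rightarrow> real"
  using L2_set_mult_ineq[of a b I] order_trans[OF sum_abs[of "\<lambda>i. a i * b i" I]]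
  by (simp add: L2_set_def abs_mult)

text \<open>Cauchy-Schwarz reduces the quadratic form to the norm of the image of the normalized
  vector, which belongs to the set whose supremum is taken.\<close>

lemma mat_norm2_quadratic:
  fixes F :: "nat \<Rightarrow> nat \<Rightarrow> real" and d :: "nat \<Rightarrow> real"
  shows "(\<Sum>j<m. \<Sum>l<m. d j * d l * F j l) \<le> mat_norm2 (mat m m (\<lambda>(j, l). F j l)) * (\<Sum>j<m. (d j)\<^sup>2)"
proof -
  let ?A = "mat m m (\<lambda>(j, l). F j l)"
  define Q where "Q = {sqrt (scalar_prod (?A *\<^sub>v x) (?A *\<^sub>v x)) | x. x \<in> carrier_vec m \<and> scalar_prod x x = 1}"
  have Ax: "scalar_prod (?A *\<^sub>v x) (?A *\<^sub>v x) = (\<Sum>j<m. (\<Sum>l<m. F j l * x $ l)\<^sup>2)" if "x \<in> carrier_vec m" for x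
    using that by (simp add: scalar_prod_def lessThan_atLeast0 power2_eq_square row_def)
  have xx: "scalar_prod x x = (\<Sum>l<m. (x $ l)\<^sup>2)" if "x \<in> carrier_vec m" for x :: "real vec"
    using that by (simp add: scalar_prod_def lessThan_atLeast0 power2_eq_square)
  \<comment> \<open>A supremum is an upper bound only for a set known to be bounded; crude row sums
    are enough.\<close>
  have bdd: "bdd_above Q"
  proof (rule bdd_aboveI)
    fix t assume "t \<in> Q"
    then obtain x where x: "x \<in> carrier_vec m" "scalar_prod x x = 1" "t = sqrt (scalar_prod (?A *\<^sub>v x) (?A *\<^sub>v x))"
      unfolding Q_def by blast
    have x1: "\<bar>x $ l\<bar> \<le> 1" if "l < m" for l
    proof -
      have "(x $ l)\<^sup>2 \<le> (\<Sum>l<m. (x $ l)\<^sup>2)" using that by (intro member_le_sum) auto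
      then show ?thesis using x xx by (simp add: abs_square_le_1)
    qed
    have "\<bar>\<Sum>l<m. F j l * x $ l\<bar> \<le> (\<Sum>l<m. \<bar>F j l\<bar>)" for j
    proof -
      have "\<bar>\<Sum>l<m. F j l * x $ l\<bar> \<le> (\<Sum>l<m. \<bar>F j l * x $ l\<bar>)" by (rule sum_abs)
      also have "\<dots> \<le> (\<Sum>l<m. \<bar>F j l\<bar>)"
        using x1 by (intro sum_mono) (simp add: abs_mult mult_left_le)
      finally show ?thesis .
    qed
    then have "(\<Sum>l<m. F j l * x $ l)\<^sup>2 \<le> (\<Sum>l<m. \<bar>F j l\<bar>)\<^sup>2" for j
      by (metis abs_ge_zero power2_abs power_mono)
    then show "t \<le> sqrt (\<Sum>j<m. (\<Sum>l<m. \<bar>F j l\<bar>)\<^sup>2)"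
      unfolding x(3) Ax[OF x(1)] by (intro real_sqrt_le_mono sum_mono)
  qed
  define s where "s = sqrt (\<Sum>j<m. (d j)\<^sup>2)"
  have s2: "s\<^sup>2 = (\<Sum>j<m. (d j)\<^sup>2)" by (simp add: s_def sum_nonneg)
  show ?thesis
  proof (cases "s = 0")
    case True
    then have "(\<Sum>j<m. (d j)\<^sup>2) = 0" using s2 by simp
    then have d0: "d j = 0" if "j < m" for j using that by (simp add: sum_nonneg_eq_0_iff)
    then show ?thesis by simp
  next
    case False
    then have s: "0 < s" by (simp add: s_def sum_nonneg order_less_le)
    define x where "x = vec m (\<lambda>j. d j / s)"
    have x: "x \<in> carrier_vec m" by (simp add: x_def)
    have "(\<Sum>l<m. (x $ l)\<^sup>2) = 1"
      using s by (simp add: x_def power_divide sum_divide_distrib[symmetric] s2[symmetric])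
    then have "sqrt (\<Sum>j<m. (\<Sum>l<m. F j l * x $ l)\<^sup>2) \<in> Q"
      unfolding Q_def using x Ax[OF x] xx[OF x] by (intro CollectI exI[of _ x]) auto
    then have le: "sqrt (\<Sum>j<m. (\<Sum>l<m. F j l * x $ l)\<^sup>2) \<le> mat_norm2 ?A"
      using cSup_upper[OF _ bdd] by (simp add: mat_norm2_def Q_def)
    have "(\<Sum>l<m. F j l * x $ l) = (\<Sum>l<m. F j l * d l) / s" for j
      by (simp add: x_def sum_divide_distrib)
    then have eq: "sqrt (\<Sum>j<m. (\<Sum>l<m. F j l * x $ l)\<^sup>2) = sqrt (\<Sum>j<m. (\<Sum>l<m. F j l * d l)\<^sup>2) / s"
      using s by (simp add: power_divide sum_divide_distrib[symmetric] real_sqrt_divide)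
    have "(\<Sum>j<m. \<Sum>l<m. d j * d l * F j l) = (\<Sum>j<m. d j * (\<Sum>l<m. F j l * d l))"
      by (simp add: sum_distrib_left mult_ac)
    also have "\<dots> \<le> s * sqrt (\<Sum>j<m. (\<Sum>l<m. F j l * d l)\<^sup>2)"
      using sum_cauchy_schwarz[of d "\<lambda>j. \<Sum>l<m. F j l * d l" "{..<m}"] by (simp add: s_def)
    also have "\<dots> \<le> s * (mat_norm2 ?A * s)"
      using le s unfolding eq by (simp add: pos_divide_le_eq)
    also have "\<dots> = mat_norm2 ?A * s\<^sup>2" by (simp add: power2_eq_square)
    also have "\<dots> = mat_norm2 ?A * (\<Sum>j<m. (d j)\<^sup>2)" unfolding s2 ..
    finally show ?thesis .
  qed
qed

section \<open>Dual nodes and the kernel\<close>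

sublocale fe_problem \<subseteq> A: fin_inner fscale "Vh N r" "a_form \<kappa>" "hat N r ` nodes N r"
  by (rule fin_inner_Vh[OF coefficient_axioms])

locale ms_setting = fe_problem N r \<kappa> \<beta> for N r \<kappa> \<beta> +
  fixes lam :: "idx \<Rightarrow> nat \<Rightarrow> real" and \<psi> :: "idx \<Rightarrow> nat \<Rightarrow> fn" and \<mu> :: "idx \<Rightarrow> real"
    and L :: "idx \<Rightarrow> nat" and dn :: "idx \<Rightarrow> nat \<Rightarrow> idx" and ns :: "idx list"
  assumes eb: "\<And>i. i \<in> elems N \<Longrightarrow> eigenbasis N r \<kappa> i (lam i) (\<psi> i)"
    and \<mu>: "\<And>i. i \<in> elems N \<Longrightarrow> smallest_pos_eigenvalue N r i (\<mu> i)"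
    and L: "\<And>i. i \<in> elems N \<Longrightarrow> 1 \<le> L i \<and> L i \<le> local_dim N r i"
    and lam: "\<And>i j. i \<in> elems N \<Longrightarrow> L i \<le> j \<Longrightarrow> j < local_dim N r i \<Longrightarrow> lam i j > \<mu> i / 2"
    and dual: "dual_nodes N r \<kappa> L \<psi> dn"
    and ns: "distinct ns" "set ns = nodes N r - N_aux N L dn"
begin

abbreviation "s \<equiv> s_form N \<kappa>"
abbreviation "a \<equiv> a_form \<kappa>"
abbreviation "\<phi> \<equiv> phi N r \<kappa>"
abbreviation "\<phi>d \<equiv> phi_dual N r \<kappa> dn"
abbreviation "\<phi>t \<equiv> phi_tilde N r \<kappa> L \<psi> dn"
abbreviation "S \<equiv> S_mat N r \<kappa> L \<psi> dn"
abbreviation "ker \<equiv> ker_fn N r \<kappa> L \<psi> dn"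

lemma \<psi>_pw: "i \<in> elems N \<Longrightarrow> j < L i \<Longrightarrow> \<psi> i j \<in> pw_bilinear n"
  using eigenbasis_expansion(3)[OF _ eb, of i 0 j] L[of i] by (simp add: A.V_zero)

lemma hat_norm:
  assumes "p \<in> nodes N r"
  shows "0 < form_norm a (hat N r p)"
proof -
  have "hat N r p \<noteq> 0" using nodal_hat[of p "fst p" "snd p"] by (auto simp: nodal_zero)
  then show ?thesis unfolding form_norm_def using A.B_pos[OF hat_Vh[OF assms]] by simp
qed

lemma \<phi>_Vh: "p \<in> nodes N r \<Longrightarrow> \<phi> p \<in> Vh N r"
  by (simp add: phi_def unit_energy_def hat_Vh)

lemma \<phi>_unit: "p \<in> nodes N r \<Longrightarrow> a (\<phi> p) (\<phi> p) = 1"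
  using hat_norm[of p] hat_Vh[of p] A.B_nonneg[OF hat_Vh[of p]]
  by (simp add: phi_def unit_energy_def A.B_scale_left A.B_scale_right form_norm_def)

lemma hat_\<phi>: "p \<in> nodes N r \<Longrightarrow> hat N r p = form_norm a (hat N r p) *\<^sub>f \<phi> p"
  using hat_norm[of p] by (simp add: phi_def unit_energy_def)

lemma dn_nodes: "i \<in> elems N \<Longrightarrow> j < L i \<Longrightarrow> dn i j \<in> nodes N r"
  and dn_interior: "i \<in> elems N \<Longrightarrow> j < L i \<Longrightarrow> node_pt N r (dn i j) \<in> interior (K N i)"
  and S_invertible: "i \<in> elems N \<Longrightarrow> invertible_mat (S i)"
  and dn_separated: "\<And>e p q. e \<in> elems n \<Longrightarrow> p \<in> N_aux N L dn \<Longrightarrow> q \<in> N_aux N L dn \<Longrightarrow>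
    p \<in> cell_vertices e \<Longrightarrow> q \<in> cell_vertices e \<Longrightarrow> p = q"
  using dual unfolding dual_nodes_def by auto

lemma \<phi>d_Vh: "i \<in> elems N \<Longrightarrow> j < L i \<Longrightarrow> \<phi>d i j \<in> Vh N r"
  by (simp add: phi_dual_def \<phi>_Vh dn_nodes)

lemma node_interior_K:
  "node_pt N r p \<in> interior (K N i) \<longleftrightarrow> fst i * r < fst p \<and> fst p < fst i * r + r \<and> snd i * r < snd p \<and> snd p < snd i * r + r"
proof -
  have "fst (node_pt N r p) * real n = real (fst p)" "snd (node_pt N r p) * real n = real (snd p)"
    using n_pos N r by (auto simp: node_pt_def mesh_h_def)
  then show ?thesis unfolding interior_K_alt by (simp only: of_nat_less_iff)
qed

lemma \<phi>_zero_cell: "p \<notin> cell_vertices e \<Longrightarrow> x \<in> ocell n e \<Longrightarrow> \<phi> p x = 0"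
proof -
  assume "p \<notin> cell_vertices e" "x \<in> ocell n e"
  then have "hat N r p x = 0" using hat_zero_cell ocell_subset_cell by blast
  then show ?thesis by (simp add: phi_def unit_energy_def fscale_def)
qed

lemma \<phi>d_zero_cell:
  assumes "i \<in> elems N" "j < L i" "e \<notin> kblock i" "x \<in> ocell n e"
  shows "\<phi>d i j x = 0"
proof -
  have "dn i j \<notin> cell_vertices e"
    using dn_interior[OF assms(1,2)] assms(3) unfolding node_interior_K
    by (cases e; cases "dn i j") (auto simp: cell_vertices_def block_def)
  then show ?thesis using \<phi>_zero_cell assms(4) by (simp add: phi_dual_def)
qed

lemma semi_inner_s: "i \<in> elems N \<Longrightarrow> semi_inner fscale (pw_bilinear n) (s i)"
  by (rule semi_inner_s_form)

lemma s_\<phi>d_other: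
  assumes "i \<in> elems N" "j < L i" "i' \<in> elems N" "i' \<noteq> i" "w \<in> pw_bilinear n"
  shows "s i' (\<phi>d i j) w = 0"
proof -
  have "mass \<kappa> (K N i') (\<phi>d i j) w = 0"
  proof (rule mass_disjoint[OF mesh_region_K[OF assms(3)] Vh_pw[OF \<phi>d_Vh[OF assms(1,2)]] assms(5)])
    fix e assume "e \<in> kblock i'"
    then have "e \<notin> kblock i" using kblock_disjoint[OF assms(4)] by blast
    then show "(\<forall>x\<in>ocell n e. \<phi>d i j x = 0) \<or> (\<forall>x\<in>ocell n e. w x = 0)"
      using \<phi>d_zero_cell[OF assms(1,2)] by blast
  qed
  then show ?thesis by (simp add: s_form_mass)
qed

lemma S_carrier: "S i \<in> carrier_mat (L i) (L i)"
  by (simp add: S_mat_def)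

lemma S_inverse:
  assumes "i \<in> elems N"
  shows "S i * mat_inv (S i) = 1\<^sub>m (L i)" "mat_inv (S i) * S i = 1\<^sub>m (L i)" "mat_inv (S i) \<in> carrier_mat (L i) (L i)"
  using mat_inv_inverts[OF S_carrier invertible_mat_Units[OF S_carrier S_invertible[OF assms]]] by auto

lemma \<phi>t_Vh: "i \<in> elems N \<Longrightarrow> \<phi>t i j \<in> Vh N r"
  unfolding phi_tilde_def by (intro A.V_sum A.V_scale \<phi>d_Vh) auto

lemma s_\<phi>t:
  assumes i: "i \<in> elems N" and j: "j < L i" and k: "k < L i"
  shows "s i (\<phi>t i j) (\<psi> i k) = (if j = k then 1 else 0)"
proof -
  interpret s: semi_inner fscale "pw_bilinear n" "s i" by (rule semi_inner_s[OF i])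
  have "s i (\<phi>t i j) (\<psi> i k) = (\<Sum>l<L i. s i (mat_inv (S i) $$ (j, l) *\<^sub>f \<phi>d i l) (\<psi> i k))"
    unfolding phi_tilde_def using \<phi>d_Vh[OF i] Vh_pw \<psi>_pw[OF i k] by (intro s.B_sum_left) auto
  also have "\<dots> = (\<Sum>l<L i. mat_inv (S i) $$ (j, l) * S i $$ (l, k))"
    using \<phi>d_Vh[OF i] Vh_pw \<psi>_pw[OF i k] k by (intro sum.cong) (auto simp: s.B_scale_left S_mat_def)
  also have "\<dots> = (if j = k then 1 else 0)"
    by (rule sum_mult_mat[OF S_inverse(2)[OF i] S_inverse(3)[OF i] S_carrier j k])
  finally show ?thesis .
qed

lemma s_\<phi>t_other:
  assumes i: "i \<in> elems N" and i': "i' \<in> elems N" "i' \<noteq> i" and w: "w \<in> pw_bilinear n"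
  shows "s i' (\<phi>t i j) w = 0"
proof -
  interpret s: semi_inner fscale "pw_bilinear n" "s i'" by (rule semi_inner_s[OF i'(1)])
  have "s i' (\<phi>t i j) w = (\<Sum>l<L i. s i' (mat_inv (S i) $$ (j, l) *\<^sub>f \<phi>d i l) w)"
    unfolding phi_tilde_def using \<phi>d_Vh[OF i] Vh_pw w by (intro s.B_sum_left) auto
  also have "\<dots> = 0"
    using \<phi>d_Vh[OF i] Vh_pw w s_\<phi>d_other[OF i _ i' w] by (intro sum.neutral) (auto simp: s.B_scale_left)
  finally show ?thesis .
qed

lemma \<phi>d_\<phi>t:
  assumes i: "i \<in> elems N" and j: "j < L i"
  shows "\<phi>d i j = (\<Sum>k<L i. s i (\<phi>d i j) (\<psi> i k) *\<^sub>f \<phi>t i k)"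
proof -
  let ?R = "mat_inv (S i)"
  have "(\<Sum>k<L i. s i (\<phi>d i j) (\<psi> i k) *\<^sub>f \<phi>t i k) = (\<Sum>k<L i. \<Sum>l<L i. (S i $$ (j, k) * ?R $$ (k, l)) *\<^sub>f \<phi>d i l)"
    unfolding phi_tilde_def using j by (intro sum.cong) (auto simp: fs.scale_sum_right S_mat_def)
  also have "\<dots> = (\<Sum>l<L i. (\<Sum>k<L i. S i $$ (j, k) * ?R $$ (k, l)) *\<^sub>f \<phi>d i l)"
    by (subst sum.swap) (simp add: fs.scale_sum_left)
  also have "\<dots> = (\<Sum>l<L i. if j = l then \<phi>d i l else 0)"
    using sum_mult_mat[OF S_inverse(1)[OF i] S_carrier S_inverse(3)[OF i] j] by (intro sum.cong) auto
  also have "\<dots> = \<phi>d i j" using j by simp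
  finally show ?thesis ..
qed

text \<open>The projection onto the span of the dual hats along the kernel: it fixes every dual hat
  and keeps all auxiliary coefficients. The given functions \<open>\<phi> p\<close> minus their
  tilde versions are its complementary part.\<close>

definition dual_part :: "fn \<Rightarrow> fn" where
  "dual_part v = (\<Sum>i\<in>elems N. \<Sum>j<L i. s i v (\<psi> i j) *\<^sub>f \<phi>t i j)"

lemma ker_alt: "ker p = \<phi> p - dual_part (\<phi> p)"
  by (simp add: ker_fn_def dual_part_def)

lemma dual_part_Vh: "dual_part v \<in> Vh N r"
  unfolding dual_part_def using \<phi>t_Vh by (intro A.V_sum A.V_scale) auto

lemma dual_part_add:
  assumes "v \<in> Vh N r" "w \<in> Vh N r"
  shows "dual_part (v + w) = dual_part v + dual_part w"
proof -
  have "s i (v + w) (\<psi> i j) = s i v (\<psi> i j) + s i w (\<psi> i j)" if "i \<in> elems N" "j < L i" for i j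
    using semi_inner.B_add_left[OF semi_inner_s[OF that(1)] Vh_pw Vh_pw \<psi>_pw[OF that]] assms by simp
  then have "(\<Sum>j<L i. s i (v + w) (\<psi> i j) *\<^sub>f \<phi>t i j)
      = (\<Sum>j<L i. s i v (\<psi> i j) *\<^sub>f \<phi>t i j) + (\<Sum>j<L i. s i w (\<psi> i j) *\<^sub>f \<phi>t i j)" if "i \<in> elems N" for i
    using that by (simp add: fs.scale_left_distrib sum.distrib)
  then show ?thesis unfolding dual_part_def by (simp add: sum.distrib)
qed

lemma dual_part_scale:
  assumes "v \<in> Vh N r"
  shows "dual_part (c *\<^sub>f v) = c *\<^sub>f dual_part v"
proof -
  have "s i (c *\<^sub>f v) (\<psi> i j) = c * s i v (\<psi> i j)" if "i \<in> elems N" "j < L i" for i j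
    using semi_inner.B_scale_left[OF semi_inner_s[OF that(1)] Vh_pw \<psi>_pw[OF that]] assms by simp
  then show ?thesis unfolding dual_part_def by (simp add: fs.scale_sum_right)
qed

lemma dual_part_\<phi>d:
  assumes i: "i \<in> elems N" and j: "j < L i"
  shows "dual_part (\<phi>d i j) = \<phi>d i j"
proof -
  have "(\<Sum>k<L i'. s i' (\<phi>d i j) (\<psi> i' k) *\<^sub>f \<phi>t i' k) = (if i' = i then \<phi>d i j else 0)" if "i' \<in> elems N" for i'
  proof (cases "i' = i")
    case True
    then show ?thesis using \<phi>d_\<phi>t[OF i j] by simp
  next
    case False
    have "s i' (\<phi>d i j) (\<psi> i' k) = 0" if "k < L i'" for k
      using s_\<phi>d_other[OF i j \<open>i' \<in> elems N\<close> False \<psi>_pw[OF \<open>i' \<in> elems N\<close> that]] .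
    then show ?thesis using False by (auto intro!: sum.neutral)
  qed
  then show ?thesis unfolding dual_part_def using i finite_elems by simp
qed

lemma s_dual_part:
  assumes i: "i \<in> elems N" and k: "k < L i" and v: "v \<in> Vh N r"
  shows "s i (dual_part v) (\<psi> i k) = s i v (\<psi> i k)"
proof -
  interpret s: semi_inner fscale "pw_bilinear n" "s i" by (rule semi_inner_s[OF i])
  note p = \<psi>_pw[OF i k]
  have "s i (dual_part v) (\<psi> i k) = (\<Sum>i'\<in>elems N. s i (\<Sum>j<L i'. s i' v (\<psi> i' j) *\<^sub>f \<phi>t i' j) (\<psi> i k))"
    unfolding dual_part_def using p \<phi>t_Vh Vh_pw by (intro s.B_sum_left) auto
  also have "\<dots> = (\<Sum>i'\<in>elems N. \<Sum>j<L i'. s i' v (\<psi> i' j) * s i (\<phi>t i' j) (\<psi> i k))"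
  proof (intro sum.cong refl)
    fix i' assume i': "i' \<in> elems N"
    have "s i (\<Sum>j<L i'. s i' v (\<psi> i' j) *\<^sub>f \<phi>t i' j) (\<psi> i k) = (\<Sum>j<L i'. s i (s i' v (\<psi> i' j) *\<^sub>f \<phi>t i' j) (\<psi> i k))"
      using p \<phi>t_Vh[OF i'] Vh_pw by (intro s.B_sum_left) auto
    then show "s i (\<Sum>j<L i'. s i' v (\<psi> i' j) *\<^sub>f \<phi>t i' j) (\<psi> i k) = (\<Sum>j<L i'. s i' v (\<psi> i' j) * s i (\<phi>t i' j) (\<psi> i k))"
      using p \<phi>t_Vh[OF i'] Vh_pw by (simp add: s.B_scale_left)
  qed
  also have "\<dots> = (\<Sum>i'\<in>elems N. if i' = i then s i v (\<psi> i k) else 0)"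
  proof (intro sum.cong refl)
    fix i' assume i': "i' \<in> elems N"
    show "(\<Sum>j<L i'. s i' v (\<psi> i' j) * s i (\<phi>t i' j) (\<psi> i k)) = (if i' = i then s i v (\<psi> i k) else 0)"
    proof (cases "i' = i")
      case True
      have "(\<Sum>j<L i. s i v (\<psi> i j) * s i (\<phi>t i j) (\<psi> i k)) = (\<Sum>j<L i. if j = k then s i v (\<psi> i k) else 0)"
        using s_\<phi>t[OF i _ k] by (intro sum.cong) auto
      then show ?thesis using True k by simp
    next
      case False
      then show ?thesis using s_\<phi>t_other[OF i' i _ p] by simp
    qed
  qed
  also have "\<dots> = s i v (\<psi> i k)" using i finite_elems by simp
  finally show ?thesis .
qed

text \<open>The kernel enters through spanning functions; \<open>s_W\<close> shows that its elements
  have no auxiliary coefficients, and \<open>minus_dual_part_W\<close> gives the splitting of the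
  whole space.\<close>

definition W :: "fn set" where "W = fs.span (ker ` (nodes N r - N_aux N L dn))"

lemma ker_Vh: "p \<in> nodes N r \<Longrightarrow> ker p \<in> Vh N r"
  unfolding ker_alt using \<phi>_Vh dual_part_Vh by auto

lemma W_Vh: "W \<subseteq> Vh N r"
  unfolding W_def by (intro A.V_span) (auto simp: ker_Vh)

lemma subspace_W: "fs.subspace W" by (simp add: W_def)

lemma s_W:
  assumes i: "i \<in> elems N" and k: "k < L i" and w: "w \<in> W"
  shows "s i w (\<psi> i k) = 0"
proof -
  interpret s: semi_inner fscale "pw_bilinear n" "s i" by (rule semi_inner_s[OF i])
  note p = \<psi>_pw[OF i k]
  have "W \<subseteq> {w \<in> Vh N r. s i w (\<psi> i k) = 0}"
    unfolding W_def
  proof (rule fs.span_minimal)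
    show "ker ` (nodes N r - N_aux N L dn) \<subseteq> {w \<in> Vh N r. s i w (\<psi> i k) = 0}"
    proof safe
      fix q assume q: "q \<in> nodes N r"
      show "ker q \<in> Vh N r" by (rule ker_Vh[OF q])
      show "s i (ker q) (\<psi> i k) = 0"
        unfolding ker_alt using s_dual_part[OF i k \<phi>_Vh[OF q]] Vh_pw[OF \<phi>_Vh[OF q]] Vh_pw[OF dual_part_Vh] p
        by (simp add: s.B_diff_left)
    qed
    show "fs.subspace {w \<in> Vh N r. s i w (\<psi> i k) = 0}"
      unfolding fs.subspace_def using p Vh_pw by (auto simp: s.B_simps)
  qed
  then show ?thesis using w by blast
qed

text \<open>By linearity it suffices to look at hats: for a dual node the difference is zero, for
  any other node it is a multiple of \<open>ker p\<close>.\<close>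

lemma minus_dual_part_W:
  assumes v: "v \<in> Vh N r"
  shows "v - dual_part v \<in> W"
proof -
  have "Vh N r \<subseteq> {v \<in> Vh N r. v - dual_part v \<in> W}"
    unfolding span_hat[symmetric]
  proof (rule fs.span_minimal)
    show "hat N r ` nodes N r \<subseteq> {v \<in> fs.span (hat N r ` nodes N r). v - dual_part v \<in> W}"
      unfolding span_hat
    proof safe
      fix p assume p: "p \<in> nodes N r"
      show "hat N r p \<in> Vh N r" by (rule hat_Vh[OF p])
      define c where "c = form_norm a (hat N r p)"
      have "hat N r p - dual_part (hat N r p) = c *\<^sub>f (\<phi> p - dual_part (\<phi> p))"
        using hat_\<phi>[OF p] dual_part_scale[OF \<phi>_Vh[OF p], of c] by (simp add: c_def fs.scale_right_diff_distrib)
      moreover have "\<phi> p - dual_part (\<phi> p) \<in> W"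
      proof (cases "p \<in> N_aux N L dn")
        case True
        then obtain i j where "i \<in> elems N" "j < L i" "p = dn i j" by (auto simp: N_aux_def)
        then have "\<phi> p - dual_part (\<phi> p) = 0" using dual_part_\<phi>d[of i j] by (simp add: phi_dual_def)
        then show ?thesis by (simp add: W_def fs.span_zero)
      next
        case False
        then show ?thesis unfolding ker_alt[symmetric] W_def using p by (intro fs.span_base) auto
      qed
      ultimately show "hat N r p - dual_part (hat N r p) \<in> W" using fs.subspace_scale[OF subspace_W] by simp
    qed
    show "fs.subspace {v \<in> fs.span (hat N r ` nodes N r). v - dual_part v \<in> W}"
      unfolding span_hat fs.subspace_def
    proof (safe; (intro A.V_zero A.V_add A.V_scale)?)
      show "0 - dual_part 0 \<in> W"
        using dual_part_scale[of 0 0] fs.subspace_0[OF subspace_W] by simp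
      fix x assume x: "x \<in> Vh N r" "x - dual_part x \<in> W"
      show "c *\<^sub>f x - dual_part (c *\<^sub>f x) \<in> W" for c
        using fs.subspace_scale[OF subspace_W x(2), of c] dual_part_scale[OF x(1), of c]
        by (simp add: fs.scale_right_diff_distrib)
      fix y assume y: "y \<in> Vh N r" "y - dual_part y \<in> W"
      have "x + y - dual_part (x + y) = (x - dual_part x) + (y - dual_part y)"
        using dual_part_add[OF x(1) y(1)] by simp
      then show "x + y - dual_part (x + y) \<in> W" using fs.subspace_add[OF subspace_W x(2) y(2)] by metis
    qed
  qed
  then show ?thesis using v by blast
qed

section \<open>Energy of the dual part\<close>

definition dual_idx :: "(idx \<times> nat) set" where
  "dual_idx = Sigma (elems N) (\<lambda>i. {..<L i})"

lemma finite_dual_idx: "finite dual_idx"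
  by (simp add: dual_idx_def finite_elems)

lemma card_dual_idx: "card dual_idx = (\<Sum>i\<in>elems N. L i)"
  by (simp add: dual_idx_def finite_elems)

text \<open>Dual nodes of different coarse squares differ because they are interior; within one
  square a repeated node would give \<open>S i\<close> two equal rows, against
  invertibility.\<close>

lemma dn_inj:
  assumes "(i, j) \<in> dual_idx" "(i', j') \<in> dual_idx" "dn i j = dn i' j'"
  shows "(i, j) = (i', j')"
proof -
  have m: "i \<in> elems N" "j < L i" "i' \<in> elems N" "j' < L i'" using assms by (auto simp: dual_idx_def)
  have eq: "b = c" if "b * r < x" "x < b * r + r" "c * r < x" "x < c * r + r" for b c x
  proof -
    have "x div r = b" "x div r = c" using that by (auto intro!: div_nat_eqI simp: algebra_simps)
    then show ?thesis by simp
  qed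
  have ii: "i = i'"
    using dn_interior[OF m(1,2)] dn_interior[OF m(3,4)] unfolding assms(3) node_interior_K
    by (intro prod_eqI eq[of _ "fst (dn i' j')"] eq[of _ "snd (dn i' j')"]) auto
  have "j = j'"
  proof (rule ccontr)
    assume ne: "j \<noteq> j'"
    have j': "j' < L i" using m ii by simp
    have "S i $$ (j, l) = S i $$ (j', l)" if "l < L i" for l
      using that m(2) j' assms(3) ii by (simp add: S_mat_def phi_dual_def)
    then have "(\<Sum>l<L i. S i $$ (j, l) * mat_inv (S i) $$ (l, j)) = (\<Sum>l<L i. S i $$ (j', l) * mat_inv (S i) $$ (l, j))"
      by (intro sum.cong) auto
    then show False
      using sum_mult_mat[OF S_inverse(1) S_carrier S_inverse(3), of i j j] sum_mult_mat[OF S_inverse(1) S_carrier S_inverse(3), of i j' j]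
        m(1,2) j' ne by simp
  qed
  then show ?thesis using ii by simp
qed

text \<open>Separation of the dual nodes means that on every fine cell at most one of two different
  dual hats is nonzero, so the energy integrand vanishes cell by cell.\<close>

lemma \<phi>d_orthonormal:
  assumes "(i, j) \<in> dual_idx" "(i', j') \<in> dual_idx"
  shows "a (\<phi>d i j) (\<phi>d i' j') = (if (i, j) = (i', j') then 1 else 0)"
proof (cases "(i, j) = (i', j')")
  case True
  then show ?thesis using assms by (auto simp: phi_dual_def dual_idx_def intro!: \<phi>_unit dn_nodes)
next
  case False
  have m: "i \<in> elems N" "j < L i" "i' \<in> elems N" "j' < L i'" using assms by (auto simp: dual_idx_def)
  have "dn i j \<noteq> dn i' j'" using dn_inj[OF assms] False by blast
  moreover have aux: "dn i j \<in> N_aux N L dn" "dn i' j' \<in> N_aux N L dn"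
    using m unfolding N_aux_def by blast+
  ultimately have sep: "e \<in> elems n \<Longrightarrow> dn i j \<notin> cell_vertices e \<or> dn i' j' \<notin> cell_vertices e" for e
    using dn_separated by blast
  have "a (\<phi>d i j) (\<phi>d i' j') = 0"
  proof (rule energy_disjoint[OF mesh_region_\<Omega>[OF n_pos] Vh_pw[OF \<phi>d_Vh[OF m(1,2)]] Vh_pw[OF \<phi>d_Vh[OF m(3,4)]]])
    fix e assume "e \<in> elems n"
    then show "(\<forall>x\<in>ocell n e. \<phi>d i j x = 0) \<or> (\<forall>x\<in>ocell n e. \<phi>d i' j' x = 0)"
      using sep[of e] \<phi>_zero_cell[of "dn i j" e] \<phi>_zero_cell[of "dn i' j'" e] unfolding phi_dual_def by blast
  qed
  then show ?thesis using False by simp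
qed

lemma dual_energy:
  fixes c :: "idx \<Rightarrow> nat \<Rightarrow> real"
  defines "v \<equiv> \<Sum>(i, j)\<in>dual_idx. c i j *\<^sub>f \<phi>d i j"
  shows "v \<in> Vh N r" "a v v = (\<Sum>(i, j)\<in>dual_idx. (c i j)\<^sup>2)"
proof -
  let ?f = "\<lambda>(i, j). \<phi>d i j"
  have f: "?f p \<in> Vh N r" if "p \<in> dual_idx" for p using that \<phi>d_Vh by (auto simp: dual_idx_def)
  have on: "a (?f p) (?f q) = (if p = q then 1 else 0)" if "p \<in> dual_idx" "q \<in> dual_idx" for p q
    using \<phi>d_orthonormal that by (cases p; cases q) auto
  have v: "v = (\<Sum>p\<in>dual_idx. (case p of (i, j) \<Rightarrow> c i j) *\<^sub>f ?f p)"
    unfolding v_def by (intro sum.cong) auto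
  show vV: "v \<in> Vh N r" unfolding v using f by (intro A.V_sum A.V_scale) auto
  have coeff: "a v (?f q) = (case q of (i, j) \<Rightarrow> c i j)" if q: "q \<in> dual_idx" for q
  proof -
    have "a v (?f q) = (\<Sum>p\<in>dual_idx. a ((case p of (i, j) \<Rightarrow> c i j) *\<^sub>f ?f p) (?f q))"
      unfolding v using f q by (intro A.B_sum_left) auto
    also have "\<dots> = (\<Sum>p\<in>dual_idx. if p = q then (case q of (i, j) \<Rightarrow> c i j) else 0)"
      using f q by (intro sum.cong refl) (simp add: A.B_scale_left on del: split_paired_All split_beta)
    finally show ?thesis using q finite_dual_idx by simp
  qed
  have "v \<in> fs.span (?f ` dual_idx)"
    unfolding v by (intro fs.span_sum fs.span_scale fs.span_base imageI)
  then have "a v v = (\<Sum>q\<in>dual_idx. (a v (?f q))\<^sup>2)"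
    by (intro A.parseval[OF finite_dual_idx f on])
  also have "\<dots> = (\<Sum>q\<in>dual_idx. (case q of (i, j) \<Rightarrow> c i j)\<^sup>2)"
    by (intro sum.cong refl) (simp only: coeff)
  finally show "a v v = (\<Sum>(i, j)\<in>dual_idx. (c i j)\<^sup>2)"
    by (simp add: split_beta)
qed

lemma dual_part_\<phi>d_expansion:
  "\<exists>c. dual_part v = (\<Sum>(i, j)\<in>dual_idx. c i j *\<^sub>f \<phi>d i j)"
proof -
  define c where "c = (\<lambda>i l. \<Sum>j<L i. s i v (\<psi> i j) * mat_inv (S i) $$ (j, l))"
  have "dual_part v = (\<Sum>i\<in>elems N. \<Sum>l<L i. c i l *\<^sub>f \<phi>d i l)"
    unfolding dual_part_def
  proof (rule sum.cong[OF refl])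
    fix i
    have "(\<Sum>j<L i. s i v (\<psi> i j) *\<^sub>f \<phi>t i j) = (\<Sum>j<L i. \<Sum>l<L i. (s i v (\<psi> i j) * mat_inv (S i) $$ (j, l)) *\<^sub>f \<phi>d i l)"
      unfolding phi_tilde_def by (simp add: fs.scale_sum_right)
    also have "\<dots> = (\<Sum>l<L i. c i l *\<^sub>f \<phi>d i l)"
      by (subst sum.swap) (simp add: c_def fs.scale_sum_left)
    finally show "(\<Sum>j<L i. s i v (\<psi> i j) *\<^sub>f \<phi>t i j) = (\<Sum>l<L i. c i l *\<^sub>f \<phi>d i l)" .
  qed
  then show ?thesis
    by (intro exI[of _ c]) (simp add: dual_idx_def sum.Sigma finite_elems)
qed

abbreviation "M \<equiv> M_const N r \<kappa> L \<psi> dn"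

text \<open>Contributions of different coarse squares have disjoint supports off the grid lines, so
  their energies add up, and each square can be treated with its own matrix norm.\<close>

lemma dual_part_energy:
  assumes v: "v \<in> Vh N r"
  shows "a (dual_part v) (dual_part v) \<le> M * (\<Sum>i\<in>elems N. s i v v)"
proof -
  define g where "g = (\<lambda>i. \<Sum>j<L i. s i v (\<psi> i j) *\<^sub>f \<phi>t i j)"
  have gV: "g i \<in> Vh N r" if "i \<in> elems N" for i
    unfolding g_def using \<phi>t_Vh[OF that] by (intro A.V_sum A.V_scale) auto
  have g0: "g i x = 0" if "i \<in> elems N" "e \<notin> kblock i" "x \<in> ocell n e" for i e x
  proof -
    have sum_app: "(\<Sum>j\<in>J. f j) x = (\<Sum>j\<in>J. f j x)" for f :: "nat \<Rightarrow> fn" and J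
      by (induction J rule: infinite_finite_induct) auto
    have "\<phi>t i j x = 0" for j
    proof -
      have "\<phi>t i j x = (\<Sum>l<L i. (mat_inv (S i) $$ (j, l) *\<^sub>f \<phi>d i l) x)"
        unfolding phi_tilde_def by (rule sum_app)
      then show ?thesis using \<phi>d_zero_cell[OF that(1) _ that(2,3)] by (simp add: fscale_def)
    qed
    then show ?thesis unfolding g_def sum_app by (simp add: fscale_def)
  qed
  have go: "a (g i) (g i') = 0" if "i \<in> elems N" "i' \<in> elems N" "i \<noteq> i'" for i i'
    by (rule energy_disjoint[OF mesh_region_\<Omega>[OF n_pos] Vh_pw[OF gV[OF that(1)]] Vh_pw[OF gV[OF that(2)]]])
      (use kblock_disjoint[OF that(3)] g0[OF that(1)] g0[OF that(2)] in blast)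
  have Mi: "a (g i) (g i) \<le> M * s i v v" if i: "i \<in> elems N" for i
  proof -
    let ?A = "mat (L i) (L i) (\<lambda>(j, l). a (\<phi>t i j) (\<phi>t i l))"
    define d where "d = (\<lambda>j. s i v (\<psi> i j))"
    have "a (g i) (g i) = (\<Sum>j<L i. a (d j *\<^sub>f \<phi>t i j) (g i))"
      unfolding g_def d_def using \<phi>t_Vh[OF i] gV[OF i] by (intro A.B_sum_left) auto
    also have "\<dots> = (\<Sum>j<L i. \<Sum>l<L i. a (d j *\<^sub>f \<phi>t i j) (d l *\<^sub>f \<phi>t i l))"
      unfolding g_def d_def using \<phi>t_Vh[OF i] by (intro sum.cong refl A.B_sum_right) auto
    also have "\<dots> = (\<Sum>j<L i. \<Sum>l<L i. d j * d l * a (\<phi>t i j) (\<phi>t i l))"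
      using \<phi>t_Vh[OF i] by (simp add: A.B_scale_left A.B_scale_right mult_ac)
    also have "\<dots> \<le> mat_norm2 ?A * (\<Sum>j<L i. (d j)\<^sup>2)"
      by (rule mat_norm2_quadratic)
    finally have 1: "a (g i) (g i) \<le> mat_norm2 ?A * (\<Sum>j<L i. (d j)\<^sup>2)" .
    have 2: "mat_norm2 ?A \<le> M" unfolding M_const_def using i finite_elems by (intro Max_ge) auto
    have 3: "(\<Sum>j<L i. (d j)\<^sup>2) \<le> s i v v"
      unfolding d_def by (rule s_form_bessel[OF i eb[OF i] v]) (use L[OF i] in simp)
    have 4: "0 \<le> (\<Sum>j<L i. (d j)\<^sup>2)" by (simp add: sum_nonneg)
    have 5: "0 \<le> mat_norm2 ?A"
    proof -
      \<comment> \<open>The first unit vector, available because \<open>L i\<close> is positive: its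
        quadratic form is an energy, hence nonnegative, and it bounds the matrix norm from
        below.\<close>
      define u where "u = (\<lambda>j::nat. if j = 0 then 1 else 0 :: real)"
      have "0 \<le> a (\<phi>t i 0) (\<phi>t i 0)" by (rule A.B_nonneg[OF \<phi>t_Vh[OF i]])
      also have "\<dots> = (\<Sum>j<L i. \<Sum>l<L i. u j * u l * a (\<phi>t i j) (\<phi>t i l))"
      proof -
        have "(\<Sum>l<L i. u j * u l * a (\<phi>t i j) (\<phi>t i l)) = (if j = 0 then a (\<phi>t i 0) (\<phi>t i 0) else 0)" for j
          using L[OF i] by (auto simp: u_def if_distrib[of "\<lambda>x. x * _"] cong: if_cong)
        then show ?thesis using L[OF i] by simp
      qed
      also have "\<dots> \<le> mat_norm2 ?A * (\<Sum>j<L i. (u j)\<^sup>2)" by (rule mat_norm2_quadratic)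
      also have "(\<Sum>j<L i. (u j)\<^sup>2) = 1"
        using L[OF i] by (simp add: u_def if_distrib[of "\<lambda>x. x\<^sup>2"] cong: if_cong)
      finally show ?thesis by simp
    qed
    have "mat_norm2 ?A * (\<Sum>j<L i. (d j)\<^sup>2) \<le> M * s i v v"
      using 2 3 4 5 by (intro mult_mono) auto
    then show ?thesis using 1 by linarith
  qed
  have "a (dual_part v) (dual_part v) = (\<Sum>i\<in>elems N. a (g i) (dual_part v))"
    unfolding dual_part_def g_def[symmetric] using gV by (intro A.B_sum_left) auto
  also have "\<dots> = (\<Sum>i\<in>elems N. \<Sum>i'\<in>elems N. a (g i) (g i'))"
    unfolding dual_part_def g_def[symmetric] using gV by (intro sum.cong refl A.B_sum_right) auto
  also have "\<dots> = (\<Sum>i\<in>elems N. \<Sum>i'\<in>elems N. if i' = i then a (g i) (g i) else 0)"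
    using go by (intro sum.cong) auto
  also have "\<dots> = (\<Sum>i\<in>elems N. a (g i) (g i))" using finite_elems by simp
  also have "\<dots> \<le> (\<Sum>i\<in>elems N. M * s i v v)" by (intro sum_mono Mi)
  finally show ?thesis by (simp add: sum_distrib_left)
qed

text \<open>Testing \<open>dual_part_energy\<close> with a dual function whose local mass is at
  least 1 by Bessel's inequality, so that the factor of \<open>M\<close> is positive.\<close>

lemma M_nonneg: "0 \<le> M"
proof -
  have i: "(0, 0) \<in> elems N" using N by (simp add: elems_def)
  let ?v = "\<phi>t (0, 0) 0"
  have "0 \<le> a (dual_part ?v) (dual_part ?v)" by (rule A.B_nonneg[OF dual_part_Vh])
  also have "\<dots> \<le> M * (\<Sum>i\<in>elems N. s i ?v ?v)" by (rule dual_part_energy[OF \<phi>t_Vh[OF i]])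
  finally have *: "0 \<le> M * (\<Sum>i\<in>elems N. s i ?v ?v)" .
  have nn: "0 \<le> s i ?v ?v" if "i \<in> elems N" for i
    by (rule semi_inner.B_nonneg[OF semi_inner_s[OF that] Vh_pw[OF \<phi>t_Vh[OF i]]])
  have "1 = (s (0, 0) ?v (\<psi> (0, 0) 0))\<^sup>2" using s_\<phi>t[OF i, of 0 0] L[OF i] by simp
  also have "\<dots> \<le> (\<Sum>j<L (0, 0). (s (0, 0) ?v (\<psi> (0, 0) j))\<^sup>2)"
    using L[OF i] by (intro member_le_sum) auto
  also have "\<dots> \<le> s (0, 0) ?v ?v"
    by (rule s_form_bessel[OF i eb[OF i] \<phi>t_Vh[OF i]]) (use L[OF i] in simp)
  also have "\<dots> \<le> (\<Sum>i\<in>elems N. s i ?v ?v)"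
    using i nn finite_elems by (intro member_le_sum) auto
  finally have "0 < (\<Sum>i\<in>elems N. s i ?v ?v)" by simp
  then show ?thesis using * by (simp add: zero_le_mult_iff)
qed

lemma s_sum_le:
  assumes v: "v \<in> Vh N r"
  shows "(\<Sum>i\<in>elems N. s i v v) \<le> (real N)\<^sup>2 * \<beta> * L2_prod v v"
proof -
  have "(\<Sum>i\<in>elems N. s i v v) = (real N)\<^sup>2 * mass \<kappa> \<Omega> v v"
    using mass_split[OF coefficient_axioms Vh_pw[OF v] Vh_pw[OF v]] by (simp add: s_form_mass sum_distrib_left)
  also have "\<dots> \<le> (real N)\<^sup>2 * (\<beta> * mass (\<lambda>_. 1) \<Omega> v v)"
    by (intro mult_left_mono mass_upper[OF mesh_region_\<Omega>[OF n_pos] Vh_pw[OF v]]) simp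
  finally show ?thesis by (simp add: L2_prod_mass)
qed

end


section \<open>The special basis of the kernel\<close>

context fe_problem
begin

lemma unit_energy_scale:
  assumes "v \<in> Vh N r"
  shows "\<exists>c. c \<noteq> 0 \<and> unit_energy (a_form \<kappa>) v = c *\<^sub>f v"
proof (cases "v = 0")
  case True
  then show ?thesis by (intro exI[of _ 1]) (simp add: unit_energy_def)
next
  case False
  then show ?thesis using A.B_pos[OF assms False]
    by (intro exI[of _ "1 / form_norm (a_form \<kappa>) v"]) (simp add: unit_energy_def form_norm_def)
qed

lemma gram_schmidt_snoc:
  "gram_schmidt_fn b (vs @ [v]) = gram_schmidt_fn b vs @ [unit_energy b (v - (\<Sum>e\<leftarrow>gram_schmidt_fn b vs. b v e *\<^sub>f e))]"
  by (simp add: gram_schmidt_fn_def)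

lemma length_gram_schmidt: "length (gram_schmidt_fn b vs) = length vs"
  by (induction vs rule: rev_induct) (simp_all add: gram_schmidt_snoc, simp add: gram_schmidt_fn_def)

text \<open>Each step exchanges \<open>v\<close> for a nonzero multiple of \<open>v\<close> minus an
  element of the earlier span. This preserves spans whatever the coefficients are, also for
  dependent input.\<close>

lemma span_gram_schmidt:
  assumes "set vs \<subseteq> Vh N r"
  shows "fs.span (set (gram_schmidt_fn (a_form \<kappa>) vs)) = fs.span (set vs)"
  using assms
proof (induction vs rule: rev_induct)
  case Nil
  then show ?case by (simp add: gram_schmidt_fn_def)
next
  case (snoc v vs)
  define es where "es = gram_schmidt_fn (a_form \<kappa>) vs"
  define p where "p = (\<Sum>e\<leftarrow>es. a_form \<kappa> v e *\<^sub>f e)"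
  have IH: "fs.span (set es) = fs.span (set vs)" using snoc by (simp add: es_def)
  have "(\<Sum>e\<leftarrow>es'. a_form \<kappa> v e *\<^sub>f e) \<in> fs.span (set es)" if "set es' \<subseteq> set es" for es'
    using that by (induction es') (auto intro: fs.span_zero fs.span_add fs.span_scale fs.span_base)
  then have p: "p \<in> fs.span (set es)" unfolding p_def by blast
  have "fs.span (set es) \<subseteq> Vh N r" unfolding IH using snoc.prems by (intro A.V_span) auto
  then have pV: "p \<in> Vh N r" using p by blast
  have vV: "v \<in> Vh N r" using snoc.prems by simp
  obtain c where c: "c \<noteq> 0" "unit_energy (a_form \<kappa>) (v - p) = c *\<^sub>f (v - p)"
    using unit_energy_scale[of "v - p"] vV pV by auto
  have "fs.span (insert (c *\<^sub>f (v - p)) (set es)) = fs.span (insert v (set es))"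
  proof (rule antisym)
    have "p \<in> fs.span (insert v (set es))" using p by (meson fs.span_mono subset_insertI subsetD)
    then have "c *\<^sub>f (v - p) \<in> fs.span (insert v (set es))"
      by (intro fs.span_scale fs.span_diff) (auto intro: fs.span_base)
    then show "fs.span (insert (c *\<^sub>f (v - p)) (set es)) \<subseteq> fs.span (insert v (set es))"
      by (intro fs.span_minimal) (auto intro: fs.span_base)
    have "p \<in> fs.span (insert (c *\<^sub>f (v - p)) (set es))" using p by (meson fs.span_mono subset_insertI subsetD)
    moreover have "(1 / c) *\<^sub>f (c *\<^sub>f (v - p)) \<in> fs.span (insert (c *\<^sub>f (v - p)) (set es))"
      by (intro fs.span_scale fs.span_base) simp
    ultimately have "(1 / c) *\<^sub>f (c *\<^sub>f (v - p)) + p \<in> fs.span (insert (c *\<^sub>f (v - p)) (set es))"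
      by (rule fs.span_add[rotated])
    then have "v \<in> fs.span (insert (c *\<^sub>f (v - p)) (set es))" using c(1) by simp
    then show "fs.span (insert v (set es)) \<subseteq> fs.span (insert (c *\<^sub>f (v - p)) (set es))"
      by (intro fs.span_minimal) (auto intro: fs.span_base)
  qed
  also have "\<dots> = fs.span (insert v (set vs))" using IH by (simp add: fs.span_insert)
  finally show ?case by (simp add: gram_schmidt_snoc es_def[symmetric] p_def[symmetric] c(2))
qed

lemma card_gram_schmidt: "card (set (gram_schmidt_fn b vs)) \<le> length vs"
  using card_length[of "gram_schmidt_fn b vs"] by (simp add: length_gram_schmidt)

lemma proj_span:
  assumes "finite T" "T \<subseteq> Vh N r" "v \<in> Vh N r"
  shows "proj (a_form \<kappa>) T v \<in> fs.span T" "z \<in> fs.span T \<Longrightarrow> a_form \<kappa> (v - proj (a_form \<kappa>) T v) z = 0"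
  using theI'[OF A.projection[OF assms]] unfolding proj_def by blast+

end

section \<open>Coarse edges and vertices in node coordinates\<close>

context fe_mesh
begin

text \<open>The common side of the squares (b, c) and (b + 1, c), hence the \<open>Suc\<close> in
  the fixed coordinate; likewise for horizontal edges.\<close>

definition v_edge :: "nat \<Rightarrow> nat \<Rightarrow> pt set" where
  "v_edge b c = {real (Suc b) / real N} \<times> {real c / real N..real (Suc c) / real N}"

definition h_edge :: "nat \<Rightarrow> nat \<Rightarrow> pt set" where
  "h_edge b c = {real b / real N..real (Suc b) / real N} \<times> {real (Suc c) / real N}"

lemma coarse_edges_alt:
  "coarse_edges N = {v_edge b c | b c. Suc b < N \<and> c < N} \<union> {h_edge b c | b c. b < N \<and> Suc c < N}"
proof -
  have N0: "0 < N" using N by simp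
  have v: "K N (b, c) \<inter> K N (Suc b, c) = v_edge b c" for b c
    using N0 by (auto simp: K_def cell_alt[OF N0] v_edge_def field_simps)
  have h: "K N (b, c) \<inter> K N (b, Suc c) = h_edge b c" for b c
    using N0 by (auto simp: K_def cell_alt[OF N0] h_edge_def field_simps)
  show ?thesis
  proof (rule Set.set_eqI)
    fix E
    have "E \<in> coarse_edges N \<longleftrightarrow> (\<exists>b c. E = K N (b, c) \<inter> K N (Suc b, c) \<and> Suc b < N \<and> c < N)
        \<or> (\<exists>b c. E = K N (b, c) \<inter> K N (b, Suc c) \<and> b < N \<and> Suc c < N)"
      unfolding coarse_edges_def elems_def by fastforce
    then show "E \<in> coarse_edges N \<longleftrightarrow> E \<in> {v_edge b c | b c. Suc b < N \<and> c < N} \<union> {h_edge b c | b c. b < N \<and> Suc c < N}"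
      unfolding v h by blast
  qed
qed

lemma node_pt_coord:
  "real q * mesh_h N r = real b / real N \<longleftrightarrow> q = b * r"
  "real b / real N < real q * mesh_h N r \<longleftrightarrow> b * r < q"
  "real q * mesh_h N r < real b / real N \<longleftrightarrow> q < b * r"
proof -
  have p: "0 < real N" "0 < real r" using N r by auto
  have "real x * mesh_h N r = real x / real r / real N" for x using p by (simp add: mesh_h_def)
  moreover have "real b = real (b * r) / real r" using p by simp
  ultimately show "real q * mesh_h N r = real b / real N \<longleftrightarrow> q = b * r"
    "real b / real N < real q * mesh_h N r \<longleftrightarrow> b * r < q"
    "real q * mesh_h N r < real b / real N \<longleftrightarrow> q < b * r"
    using p by (metis (no_types) divide_cancel_right divide_strict_right_mono of_nat_eq_iff of_nat_less_iff
        less_irrefl divide_less_cancel not_less_iff_gr_or_eq)+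
qed

lemma node_v_edge: "node_pt N r p \<in> rel_interior (v_edge b c) \<longleftrightarrow> fst p = Suc b * r \<and> c * r < snd p \<and> snd p < c * r + r"
proof -
  have lt: "real c / real N < real (Suc c) / real N" using N by (simp add: divide_strict_right_mono)
  have "rel_interior (v_edge b c) = {real (Suc b) / real N} \<times> {real c / real N<..<real (Suc c) / real N}"
    unfolding v_edge_def using rel_interior_real_box[OF lt]
    by (subst rel_interior_Times) (simp_all add: cbox_interval box_real)
  then show ?thesis
    using node_pt_coord(1)[of "fst p" "Suc b"] node_pt_coord(2)[of c "snd p"] node_pt_coord(3)[of "snd p" "Suc c"]
    by (auto simp: node_pt_def add.commute)
qed

lemma node_h_edge: "node_pt N r p \<in> rel_interior (h_edge b c) \<longleftrightarrow> snd p = Suc c * r \<and> b * r < fst p \<and> fst p < b * r + r"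
proof -
  have lt: "real b / real N < real (Suc b) / real N" using N by (simp add: divide_strict_right_mono)
  have "rel_interior (h_edge b c) = {real b / real N<..<real (Suc b) / real N} \<times> {real (Suc c) / real N}"
    unfolding h_edge_def using rel_interior_real_box[OF lt]
    by (subst rel_interior_Times) (simp_all add: cbox_interval box_real)
  then show ?thesis
    using node_pt_coord(1)[of "snd p" "Suc c"] node_pt_coord(2)[of b "fst p"] node_pt_coord(3)[of "fst p" "Suc b"]
    by (auto simp: node_pt_def add.commute)
qed

lemma node_coarse_vertex:
  "node_pt N r p \<in> coarse_vertices N \<longleftrightarrow> (\<exists>b\<in>{1..<N}. \<exists>c\<in>{1..<N}. fst p = b * r \<and> snd p = c * r)"
  unfolding coarse_vertices_def node_pt_def mem_Collect_eq prod.inject node_pt_coord(1) by blast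

end

section \<open>Span, cardinality and independence of the special basis\<close>

context ms_setting
begin

abbreviation "nd \<equiv> nodes N r - N_aux N L dn"
abbreviation "XK \<equiv> xi_elem N r \<kappa> L \<psi> dn ns"
abbreviation "XE \<equiv> xi_edge N r \<kappa> L \<psi> dn ns"
abbreviation "XV \<equiv> xi_vertex N r \<kappa> L \<psi> dn ns"
abbreviation "KB \<equiv> kernel_basis N r \<kappa> L \<psi> dn ns"

definition CK :: "idx \<Rightarrow> idx set" where "CK i = {p \<in> nd. node_pt N r p \<in> interior (K N i)}"
definition CE :: "pt set \<Rightarrow> idx set" where "CE E = {p \<in> nd. node_pt N r p \<in> rel_interior E}"
definition CV :: "idx set" where "CV = {p \<in> nodes N r. node_pt N r p \<in> coarse_vertices N}"

lemma ker_W: "p \<in> nd \<Longrightarrow> ker p \<in> W"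
  unfolding W_def by (intro fs.span_base imageI)

text \<open>The cardinality is only bounded above: until independence is known, the orthonormalized
  list could contain repetitions.\<close>

lemma XK_span: "fs.span (XK i) = fs.span (ker ` CK i)"
  and XK_card: "card (XK i) \<le> card (CK i)"
  and XK_finite: "finite (XK i)"
proof -
  let ?l = "filter (\<lambda>p. node_pt N r p \<in> interior (K N i)) ns"
  have set: "set ?l = CK i" using ns(2) by (auto simp: CK_def)
  have "length ?l = card (CK i)" using ns(1) set by (metis distinct_card distinct_filter)
  then show "card (XK i) \<le> card (CK i)"
    unfolding xi_elem_def using card_gram_schmidt[of a "map ker ?l"] by simp
  show "finite (XK i)" by (simp add: xi_elem_def)
  have "set (map ker ?l) = ker ` CK i" using set by simp
  moreover have "ker ` CK i \<subseteq> Vh N r" using ker_Vh by (auto simp: CK_def)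
  ultimately show "fs.span (XK i) = fs.span (ker ` CK i)"
    unfolding xi_elem_def using span_gram_schmidt[of "map ker ?l"] by simp
qed

lemma XK_W: "XK i \<subseteq> W"
proof -
  have "fs.span (ker ` CK i) \<subseteq> W"
    by (rule fs.span_minimal) (use ker_W subspace_W in \<open>auto simp: CK_def\<close>)
  then show ?thesis using XK_span[of i] fs.span_superset[of "XK i"] by blast
qed

definition SE :: "pt set \<Rightarrow> fn set" where
  "SE E = (\<Union>i\<in>{i\<in>elems N. E \<subseteq> K N i}. XK i)"

lemma SE_W: "SE E \<subseteq> W" and SE_finite: "finite (SE E)"
  using XK_W XK_finite finite_elems by (auto simp: SE_def)

lemma proj_W:
  assumes "finite T" "T \<subseteq> W" "p \<in> nodes N r"
  shows "proj a T (ker p) \<in> fs.span T" "proj a T (ker p) \<in> W"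
proof -
  show "proj a T (ker p) \<in> fs.span T"
    using assms W_Vh ker_Vh by (intro proj_span) auto
  then show "proj a T (ker p) \<in> W" using fs.span_minimal[OF assms(2) subspace_W] by blast
qed

lemma XE_span: "fs.span (XE E) = fs.span ((\<lambda>p. ker p - proj a (SE E) (ker p)) ` CE E)"
  and XE_card: "card (XE E) \<le> card (CE E)"
  and XE_finite: "finite (XE E)"
proof -
  let ?l = "filter (\<lambda>p. node_pt N r p \<in> rel_interior E) ns"
  let ?f = "\<lambda>p. ker p - proj a (SE E) (ker p)"
  have XE: "XE E = set (gram_schmidt_fn a (map ?f ?l))"
    by (simp add: xi_edge_def Let_def SE_def)
  have set: "set ?l = CE E" using ns(2) by (auto simp: CE_def)
  have "length ?l = card (CE E)" using ns(1) set by (metis distinct_card distinct_filter)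
  then show "card (XE E) \<le> card (CE E)"
    unfolding XE using card_gram_schmidt[of a "map ?f ?l"] by simp
  show "finite (XE E)" by (simp add: XE)
  have "set (map ?f ?l) = ?f ` CE E" using set by simp
  moreover have "?f ` CE E \<subseteq> Vh N r"
  proof
    fix v assume "v \<in> ?f ` CE E"
    then obtain p where p: "p \<in> nodes N r" "v = ?f p" by (auto simp: CE_def)
    have "proj a (SE E) (ker p) \<in> Vh N r" using proj_W(2)[OF SE_finite SE_W p(1)] W_Vh by blast
    then show "v \<in> Vh N r" using p ker_Vh by auto
  qed
  ultimately show "fs.span (XE E) = fs.span (?f ` CE E)"
    unfolding XE using span_gram_schmidt[of "map ?f ?l"] by simp
qed

lemma XE_W: "XE E \<subseteq> W"
proof -
  have "fs.span ((\<lambda>p. ker p - proj a (SE E) (ker p)) ` CE E) \<subseteq> W"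
  proof (rule fs.span_minimal[OF _ subspace_W], safe)
    fix p assume "p \<in> CE E"
    then show "ker p - proj a (SE E) (ker p) \<in> W"
      using proj_W(2)[OF SE_finite SE_W] ker_W by (intro fs.subspace_diff[OF subspace_W]) (auto simp: CE_def)
  qed
  then show ?thesis using XE_span[of E] fs.span_superset[of "XE E"] by blast
qed

lemma finite_coarse_edges: "finite (coarse_edges N)"
proof -
  have "coarse_edges N \<subseteq> (\<lambda>(b, c). v_edge b c) ` ({..<N} \<times> {..<N}) \<union> (\<lambda>(b, c). h_edge b c) ` ({..<N} \<times> {..<N})"
    unfolding coarse_edges_alt by force
  then show ?thesis by (rule finite_subset) auto
qed

definition SV :: "idx \<Rightarrow> fn set" where
  "SV p = (\<Union>i\<in>{i\<in>elems N. node_pt N r p \<in> K N i}. XK i) \<union> (\<Union>E\<in>{E\<in>coarse_edges N. node_pt N r p \<in> E}. XE E)"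

lemma SV_W: "SV p \<subseteq> W"
  unfolding SV_def using XK_W XE_W by blast

lemma SV_finite: "finite (SV p)"
  by (simp add: SV_def XK_finite XE_finite finite_elems finite_coarse_edges)

lemma XV_alt: "XV p = unit_energy a (ker p - proj a (SV p) (ker p))"
  by (simp add: xi_vertex_def Let_def SV_def)

lemma N_aux_interior: "p \<in> N_aux N L dn \<Longrightarrow> \<exists>i\<in>elems N. node_pt N r p \<in> interior (K N i)"
  using dn_interior by (auto simp: N_aux_def)

lemma mod_interior: "b * r < x \<Longrightarrow> x < b * r + r \<Longrightarrow> x mod r \<noteq> 0 \<and> x div r = b"
proof
  assume x: "b * r < x" "x < b * r + r"
  show d: "x div r = b" using x by (auto intro!: div_nat_eqI simp: algebra_simps)
  show "x mod r \<noteq> 0" using x d by (metis add.right_neutral div_mult_mod_eq less_irrefl)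
qed

lemma mod_interior_div:
  assumes "x mod r \<noteq> 0"
  shows "x div r * r < x" "x < x div r * r + r"
proof -
  have "x = x div r * r + x mod r" by simp
  moreover have "x mod r < r" using r by simp
  ultimately show "x div r * r < x" "x < x div r * r + r" using assms by linarith+
qed

text \<open>Dual nodes lie inside coarse squares, where no coordinate is a multiple of
  \<open>r\<close>.\<close>

lemma CV_nd: "CV \<subseteq> nd"
proof
  fix p assume p: "p \<in> CV"
  then obtain b where "fst p = b * r" by (auto simp: CV_def node_coarse_vertex)
  then have "fst p mod r = 0" by simp
  have "p \<notin> N_aux N L dn"
  proof
    assume "p \<in> N_aux N L dn"
    then obtain i :: idx where "fst i * r < fst p" "fst p < fst i * r + r"
      using N_aux_interior[of p] unfolding node_interior_K by blast
    then show False using mod_interior[of "fst i" "fst p"] \<open>fst p mod r = 0\<close> by simp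
  qed
  then show "p \<in> nd" using p by (auto simp: CV_def)
qed

lemma XV_W:
  assumes p: "p \<in> CV"
  shows "XV p \<in> W"
proof -
  have "p \<in> nd" using p CV_nd by blast
  then have "ker p \<in> W" "proj a (SV p) (ker p) \<in> W"
    using ker_W proj_W(2)[OF SV_finite SV_W] by blast+
  then show ?thesis
    unfolding XV_alt unit_energy_def by (intro fs.subspace_scale[OF subspace_W] fs.subspace_diff[OF subspace_W])
qed

lemma KB_alt: "KB = (\<Union>i\<in>elems N. XK i) \<union> (\<Union>E\<in>coarse_edges N. XE E) \<union> XV ` CV"
  by (simp add: kernel_basis_def CV_def)

lemma KB_W: "KB \<subseteq> W"
  unfolding KB_alt using XK_W XE_W XV_W by blast

lemma node_cases:
  assumes p: "p \<in> nodes N r"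
  shows "(\<exists>i\<in>elems N. node_pt N r p \<in> interior (K N i)) \<or> (\<exists>E\<in>coarse_edges N. node_pt N r p \<in> rel_interior E)
    \<or> node_pt N r p \<in> coarse_vertices N"
proof -
  have b: "1 \<le> fst p" "fst p < N * r" "1 \<le> snd p" "snd p < N * r" using p by (auto simp: nodes_def)
  have d: "x div r < N" if "x < N * r" for x using that by (simp add: less_mult_imp_div_less)
  have z: "\<exists>c. x = Suc c * r \<and> Suc c < N" if "1 \<le> x" "x < N * r" "x mod r = 0" for x
  proof -
    have x: "x = x div r * r" using that(3) by (metis add.right_neutral div_mult_mod_eq)
    then have "x div r \<noteq> 0" using that(1) by (metis mult_zero_left not_one_le_zero)
    then obtain c where "x div r = Suc c" using not0_implies_Suc by blast
    then show ?thesis using x d[OF that(2)] by metis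
  qed
  consider "fst p mod r \<noteq> 0" "snd p mod r \<noteq> 0" | "fst p mod r = 0" "snd p mod r \<noteq> 0"
    | "fst p mod r \<noteq> 0" "snd p mod r = 0" | "fst p mod r = 0" "snd p mod r = 0" by blast
  then show ?thesis
  proof cases
    case 1
    then have "node_pt N r p \<in> interior (K N (fst p div r, snd p div r))"
      unfolding node_interior_K using mod_interior_div by simp
    moreover have "(fst p div r, snd p div r) \<in> elems N" using d b by (simp add: elems_def)
    ultimately show ?thesis by blast
  next
    case 2
    obtain c where c: "fst p = Suc c * r" "Suc c < N" using z[OF b(1,2) 2(1)] by blast
    have "node_pt N r p \<in> rel_interior (v_edge c (snd p div r))"
      unfolding node_v_edge using mod_interior_div[OF 2(2)] c by simp
    moreover have "v_edge c (snd p div r) \<in> coarse_edges N"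
      unfolding coarse_edges_alt using c(2) d[OF b(4)] by (intro UnI1 CollectI exI conjI) (rule refl)
    ultimately show ?thesis by blast
  next
    case 3
    obtain c where c: "snd p = Suc c * r" "Suc c < N" using z[OF b(3,4) 3(2)] by blast
    have "node_pt N r p \<in> rel_interior (h_edge (fst p div r) c)"
      unfolding node_h_edge using mod_interior_div[OF 3(1)] c by simp
    moreover have "h_edge (fst p div r) c \<in> coarse_edges N"
      unfolding coarse_edges_alt using c(2) d[OF b(2)] by (intro UnI2 CollectI exI conjI) (rule refl)
    ultimately show ?thesis by blast
  next
    case 4
    obtain c c' where "fst p = Suc c * r" "Suc c < N" "snd p = Suc c' * r" "Suc c' < N"
      using z[OF b(1,2) 4(1)] z[OF b(3,4) 4(2)] by blast
    then have "node_pt N r p \<in> coarse_vertices N"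
      unfolding node_coarse_vertex by (intro bexI[of _ "Suc c"] bexI[of _ "Suc c'"]) auto
    then show ?thesis by blast
  qed
qed

text \<open>Each \<open>ker p\<close> is recovered from the basis functions of its class by adding
  back its projection, which lies in the span of basis functions constructed earlier.\<close>

lemma span_KB: "fs.span KB = W"
proof (rule antisym)
  show "fs.span KB \<subseteq> W" by (rule fs.span_minimal[OF KB_W subspace_W])
  show "W \<subseteq> fs.span KB" unfolding W_def
  proof (rule fs.span_minimal[OF _ fs.subspace_span], rule image_subsetI)
    fix p assume p: "p \<in> nd"
    then have pn: "p \<in> nodes N r" by simp
    have diff: "ker p \<in> fs.span KB" if "ker p - proj a T (ker p) \<in> fs.span KB" "finite T" "T \<subseteq> W" "T \<subseteq> KB" for T
    proof -
      have "proj a T (ker p) \<in> fs.span KB" using proj_W(1)[OF that(2,3) pn] fs.span_mono[OF that(4)] by blast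
      from fs.span_add[OF that(1) this] show ?thesis by simp
    qed
    consider i where "i \<in> elems N" "node_pt N r p \<in> interior (K N i)" | E where "E \<in> coarse_edges N" "node_pt N r p \<in> rel_interior E"
      | "node_pt N r p \<in> coarse_vertices N" using node_cases[OF pn] by blast
    then show "ker p \<in> fs.span KB"
    proof cases
      case 1
      then have "ker p \<in> fs.span (XK i)" unfolding XK_span using p by (intro fs.span_base imageI) (simp add: CK_def)
      moreover have "XK i \<subseteq> KB" using 1 unfolding KB_alt by blast
      ultimately show ?thesis using fs.span_mono by blast
    next
      case 2
      have "ker p - proj a (SE E) (ker p) \<in> fs.span (XE E)"
        unfolding XE_span using p 2 by (intro fs.span_base imageI) (simp add: CE_def)
      moreover have "XE E \<subseteq> KB" using 2 unfolding KB_alt by blast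
      ultimately have "ker p - proj a (SE E) (ker p) \<in> fs.span KB" using fs.span_mono by blast
      moreover have "SE E \<subseteq> KB" unfolding KB_alt SE_def by blast
      ultimately show ?thesis using diff SE_finite SE_W by blast
    next
      case 3
      have "p \<in> CV" using 3 pn by (simp add: CV_def)
      then have X: "XV p \<in> fs.span KB" unfolding KB_alt by (intro fs.span_base) blast
      have "ker p - proj a (SV p) (ker p) \<in> Vh N r"
        using ker_Vh[OF pn] subsetD[OF W_Vh proj_W(2)[OF SV_finite SV_W pn]] by (rule A.V_diff)
      then obtain c where c: "c \<noteq> 0" "XV p = c *\<^sub>f (ker p - proj a (SV p) (ker p))"
        using unit_energy_scale unfolding XV_alt by blast
      have "(1 / c) *\<^sub>f XV p \<in> fs.span KB" by (rule fs.span_scale[OF X])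
      then have "ker p - proj a (SV p) (ker p) \<in> fs.span KB" using c by simp
      moreover have "SV p \<subseteq> KB" unfolding KB_alt SV_def by blast
      ultimately show ?thesis using diff SV_finite SV_W by blast
    qed
  qed
qed

text \<open>Every basis function is charged to a non-dual node. The classes of nodes are told apart
  by divisibility by \<open>r\<close>: no coordinate in the interior of a square, exactly one on an
  edge, both at a vertex.\<close>

lemma card_KB: "card KB \<le> card nd"
proof -
  have fnd: "finite nd" using finite_nodes by simp
  have fin: "finite (CK i)" "finite (CE E)" "finite CV" for i E
    using fnd finite_nodes by (auto simp: CK_def CE_def CV_def)
  have dK: "CK i \<inter> CK i' = {}" if "i \<noteq> i'" for i i'
  proof -
    have "i = i'" if "p \<in> CK i" "p \<in> CK i'" for p
      using that mod_interior[of _ "fst p"] mod_interior[of _ "snd p"]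
      unfolding CK_def node_interior_K by (intro prod_eqI) (metis (no_types, lifting) mem_Collect_eq)+
    then show ?thesis using that by blast
  qed
  \<comment> \<open>The edge can be read off from any of its nodes, which makes the classes of
    different edges disjoint; subtracting 1 undoes the \<open>Suc\<close> in the fixed
    coordinate.\<close>
  have E_type: "(fst p mod r = 0 \<and> snd p mod r \<noteq> 0 \<and> E = v_edge (fst p div r - 1) (snd p div r))
      \<or> (fst p mod r \<noteq> 0 \<and> snd p mod r = 0 \<and> E = h_edge (fst p div r) (snd p div r - 1))"
    if E: "E \<in> coarse_edges N" and p: "p \<in> CE E" for E p
  proof -
    have r0: "r \<noteq> 0" using r by simp
    from E consider b c where "E = v_edge b c" | b c where "E = h_edge b c" unfolding coarse_edges_alt by blast
    then show ?thesis
    proof cases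
      case 1
      then have *: "fst p = Suc b * r" "c * r < snd p" "snd p < c * r + r" using p by (auto simp: CE_def node_v_edge)
      have "fst p div r = Suc b" "fst p mod r = 0"
        unfolding *(1) by (rule nonzero_mult_div_cancel_right[OF r0], rule mod_mult_self2_is_0)
      then show ?thesis using mod_interior[OF *(2,3)] 1 by simp
    next
      case 2
      then have *: "snd p = Suc c * r" "b * r < fst p" "fst p < b * r + r" using p by (auto simp: CE_def node_h_edge)
      have "snd p div r = Suc c" "snd p mod r = 0"
        unfolding *(1) by (rule nonzero_mult_div_cancel_right[OF r0], rule mod_mult_self2_is_0)
      then show ?thesis using mod_interior[OF *(2,3)] 2 by simp
    qed
  qed
  have dE: "CE E \<inter> CE E' = {}" if "E \<in> coarse_edges N" "E' \<in> coarse_edges N" "E \<noteq> E'" for E E'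
  proof -
    have "E = E'" if "p \<in> CE E" "p \<in> CE E'" for p
      using E_type[OF \<open>E \<in> coarse_edges N\<close> that(1)] E_type[OF \<open>E' \<in> coarse_edges N\<close> that(2)] by argo
    then show ?thesis using \<open>E \<noteq> E'\<close> by blast
  qed
  have K_type: "fst p mod r \<noteq> 0 \<and> snd p mod r \<noteq> 0" if "p \<in> CK i" for p i
    using that mod_interior[of _ "fst p"] mod_interior[of _ "snd p"] unfolding CK_def node_interior_K by blast
  have V_type: "fst p mod r = 0 \<and> snd p mod r = 0" if "p \<in> CV" for p
    using that by (auto simp: CV_def node_coarse_vertex)
  let ?UK = "\<Union>i\<in>elems N. CK i" and ?UE = "\<Union>E\<in>coarse_edges N. CE E"
  have "card KB \<le> card (\<Union>i\<in>elems N. XK i) + card (\<Union>E\<in>coarse_edges N. XE E) + card (XV ` CV)"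
    unfolding KB_alt by (meson add_le_cancel_right card_Un_le order_trans)
  also have "card (\<Union>i\<in>elems N. XK i) \<le> (\<Sum>i\<in>elems N. card (XK i))" by (rule card_UN_le[OF finite_elems])
  also have "\<dots> \<le> (\<Sum>i\<in>elems N. card (CK i))" by (intro sum_mono XK_card)
  also have "\<dots> = card ?UK" using finite_elems fin dK by (intro card_UN_disjoint[symmetric]) auto
  also have "card (\<Union>E\<in>coarse_edges N. XE E) \<le> (\<Sum>E\<in>coarse_edges N. card (XE E))" by (rule card_UN_le[OF finite_coarse_edges])
  also have "\<dots> \<le> (\<Sum>E\<in>coarse_edges N. card (CE E))" by (intro sum_mono XE_card)
  also have "\<dots> = card ?UE" using finite_coarse_edges fin dE by (intro card_UN_disjoint[symmetric]) auto
  also have "card (XV ` CV) \<le> card CV" by (rule card_image_le[OF fin(3)])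
  also have "card ?UK + card ?UE + card CV = card (?UK \<union> ?UE \<union> CV)"
  proof -
    have E_mod: "(fst p mod r = 0) \<noteq> (snd p mod r = 0)" if "E \<in> coarse_edges N" "p \<in> CE E" for E p
      using E_type[OF that] by argo
    have "?UK \<inter> ?UE = {}"
    proof (intro equals0I)
      fix p assume "p \<in> ?UK \<inter> ?UE"
      then obtain i E where "p \<in> CK i" "E \<in> coarse_edges N" "p \<in> CE E" by blast
      then show False using K_type[of p i] E_mod[of E p] by simp
    qed
    moreover have "(?UK \<union> ?UE) \<inter> CV = {}"
    proof (intro equals0I)
      fix p assume p: "p \<in> (?UK \<union> ?UE) \<inter> CV"
      then consider i where "p \<in> CK i" | E where "E \<in> coarse_edges N" "p \<in> CE E" by blast
      then show False using V_type[of p] K_type[of p] E_mod[of _ p] p by cases auto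
    qed
    moreover have "finite ?UK" "finite ?UE" using fin finite_elems finite_coarse_edges by auto
    ultimately show ?thesis using fin(3) by (simp add: card_Un_disjoint)
  qed
  also have "\<dots> \<le> card nd"
    by (rule card_mono[OF fnd]) (use CV_nd in \<open>auto simp: CK_def CE_def\<close>)
  finally show ?thesis by simp
qed

lemma independent_KB: "fs.independent KB" and finite_KB: "finite KB"
proof -
  have fnd: "finite nd" using finite_nodes by simp
  show fin: "finite KB"
    unfolding KB_alt using finite_elems XK_finite finite_coarse_edges XE_finite finite_nodes by (auto simp: CV_def)
  \<comment> \<open>A dual part combines hats at dual nodes and so vanishes at all other nodes;
    hence \<open>ker p\<close> has there the values of the scaled hat at \<open>p\<close>
    alone.\<close>
  have nod_dp: "nodal n (dual_part v) (fst q) (snd q) = 0" if q: "q \<in> nd" for v q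
  proof -
    obtain c where c: "dual_part v = (\<Sum>(i, j)\<in>dual_idx. c i j *\<^sub>f \<phi>d i j)" using dual_part_\<phi>d_expansion by blast
    have "nodal n (\<phi>d i j) (fst q) (snd q) = 0" if "(i, j) \<in> dual_idx" for i j
    proof -
      have "dn i j \<in> N_aux N L dn" using that unfolding N_aux_def dual_idx_def by blast
      then have "q \<noteq> dn i j" using q by blast
      then show ?thesis by (simp add: phi_dual_def phi_def unit_energy_def nodal_scale nodal_hat)
    qed
    then show ?thesis unfolding c nodal_sum by (intro sum.neutral) (auto simp: nodal_scale)
  qed
  have nod_ker: "nodal n (ker p) (fst q) (snd q) = (if p = q then 1 / form_norm a (hat N r p) else 0)" if "q \<in> nd" for p q
    using nod_dp[OF that] by (cases "q = p") (auto simp: ker_alt nodal_diff phi_def unit_energy_def nodal_scale nodal_hat)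
  have inj: "inj_on ker nd"
  proof (rule inj_onI)
    fix p q assume pq: "p \<in> nd" "q \<in> nd" "ker p = ker q"
    have "nodal n (ker p) (fst q) (snd q) \<noteq> 0" unfolding pq(3) using nod_ker[OF pq(2), of q] hat_norm[of q] pq(2) by simp
    then show "p = q" using nod_ker[OF pq(2), of p] by (auto split: if_splits)
  qed
  have ind: "fs.independent (ker ` nd)"
  proof (rule fs.independent_if_scalars_zero)
    fix f x assume s: "(\<Sum>x\<in>ker ` nd. f x *\<^sub>f x) = 0" and x: "x \<in> ker ` nd"
    obtain q where q: "q \<in> nd" "x = ker q" using x by blast
    have "0 = nodal n (\<Sum>x\<in>ker ` nd. f x *\<^sub>f x) (fst q) (snd q)" unfolding s by (simp add: nodal_zero)
    also have "\<dots> = (\<Sum>p\<in>nd. f (ker p) * nodal n (ker p) (fst q) (snd q))"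
      by (simp add: nodal_sum nodal_scale sum.reindex[OF inj])
    also have "\<dots> = (\<Sum>p\<in>nd. if p = q then f (ker q) / form_norm a (hat N r q) else 0)"
      by (intro sum.cong refl) (simp add: nod_ker[OF q(1)])
    also have "\<dots> = f x / form_norm a (hat N r q)" using q fnd by simp
    finally show "f x = 0" using hat_norm[of q] q by simp
  qed (use fnd in simp)
  \<comment> \<open>An independent subset with the same span has at least as many elements as the
    independent family \<open>ker\<close>, while the whole set has at most as many; so the subset is
    everything.\<close>
  obtain B where B: "B \<subseteq> KB" "fs.independent B" "KB \<subseteq> fs.span B"
    using fs.maximal_independent_subset[of KB] by blast
  have "fs.span KB \<subseteq> fs.span B" by (rule fs.span_minimal[OF B(3) fs.subspace_span])
  then have "ker ` nd \<subseteq> fs.span B" using fs.span_superset[of "ker ` nd"] span_KB unfolding W_def by blast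
  then have "card (ker ` nd) \<le> card B"
    using fs.independent_span_bound[OF finite_subset[OF B(1) fin] ind] by blast
  then have "card KB \<le> card B" using card_KB card_image[OF inj] by simp
  then have "B = KB" using card_seteq[OF fin B(1)] by blast
  then show "fs.independent KB" using B(2) by simp
qed

text \<open>A nontrivial kernel provides \<open>G\<close> with an eigenvalue, so that
  \<open>Min\<close> and \<open>Max\<close> in \<open>cond_num\<close> range over a nonempty set.
  The witness comes from the coarse vertex (1/N, 1/N), interior because N is at least 2.\<close>

lemma KB_nonempty: "\<exists>w\<in>W. w \<noteq> 0"
proof -
  have "node_pt N r (r, r) \<in> coarse_vertices N"
    unfolding node_coarse_vertex using N by (intro bexI[of _ 1]) auto
  moreover have "r < N * r" using N r by simp
  then have "(r, r) \<in> nodes N r" using r by (simp add: nodes_def)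
  ultimately have "(r, r) \<in> CV" by (simp add: CV_def)
  then have X: "XV (r, r) \<in> KB" unfolding KB_alt by blast
  then have "XV (r, r) \<noteq> 0" using independent_KB fs.dependent_zero by metis
  then show ?thesis using X KB_W by blast
qed

end


section \<open>The conjugate gradient correction\<close>

text \<open>Coefficients are indexed by \<open>I\<close> and not by the image, because Krylov
  vectors with different exponents may coincide.\<close>

lemma span_image_sum:
  assumes "finite I" "x \<in> fs.span (g ` I)"
  shows "\<exists>c. x = (\<Sum>i\<in>I. c i *\<^sub>f g i)"
  using assms(2)
proof (induction rule: fs.span_induct_alt)
  case base
  then show ?case by (intro exI[of _ "\<lambda>_. 0"]) simp
next
  case (step c x y)
  then obtain i d where i: "i \<in> I" "x = g i" and d: "y = (\<Sum>i\<in>I. d i *\<^sub>f g i)" by blast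
  have "(\<Sum>j\<in>I. (d j + (if j = i then c else 0)) *\<^sub>f g j) = y + (\<Sum>j\<in>I. if j = i then c *\<^sub>f g i else 0)"
    unfolding d by (simp add: fs.scale_left_distrib sum.distrib if_distrib[of "\<lambda>t. t *\<^sub>f _"] cong: if_cong sum.cong)
  also have "\<dots> = c *\<^sub>f x + y" using i assms(1) by (simp add: add.commute)
  finally show ?case by metis
qed

locale ms_problem = ms_setting N r \<kappa> \<beta> lam \<psi> \<mu> L dn ns
  for N r \<kappa> \<beta> lam \<psi> \<mu> L dn ns +
  fixes \<xi> :: "fn list" and k :: nat
  assumes \<xi>_distinct: "distinct \<xi>" and \<xi>_set: "set \<xi> = KB" and k: "1 \<le> k"
begin

abbreviation "m \<equiv> length \<xi>"
abbreviation "G \<equiv> gram \<kappa> \<xi>"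

definition lc :: "real vec \<Rightarrow> fn" where "lc x = (\<Sum>t<m. (x $ t) *\<^sub>f (\<xi> ! t))"

text \<open>\<open>lc\<close> carries multiplication by \<open>G\<close> to this operator
  (\<open>lc_G\<close>) and the quadratic form of \<open>G\<close> to the energy
  (\<open>quadratic_G\<close>), so that the iteration can be analysed without coordinates.\<close>

definition \<A> :: "fn \<Rightarrow> fn" where "\<A> w = (\<Sum>t<m. a w (\<xi> ! t) *\<^sub>f (\<xi> ! t))"

lemma \<xi>_W: "t < m \<Longrightarrow> \<xi> ! t \<in> W"
  using KB_W \<xi>_set nth_mem by blast

lemma \<xi>_Vh: "t < m \<Longrightarrow> \<xi> ! t \<in> Vh N r"
  using \<xi>_W W_Vh by blast

sublocale W: fin_inner fscale W a "set \<xi>"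
proof -
  interpret semi_inner fscale W a by (rule A.semi_inner_subspace[OF subspace_W W_Vh])
  show "fin_inner fscale W a (set \<xi>)"
    by unfold_locales (use \<xi>_set span_KB finite_KB W_Vh A.definite in auto)
qed

lemma lc_independent:
  assumes "(\<Sum>t<m. c t *\<^sub>f (\<xi> ! t)) = 0" "t < m"
  shows "c t = 0"
proof -
  have inj: "inj_on ((!) \<xi>) {..<m}" using \<xi>_distinct by (simp add: inj_on_nth)
  have im: "(!) \<xi> ` {..<m} = KB" using \<xi>_set by (auto simp: set_conv_nth)
  define d where "d = (\<lambda>v. c (the_inv_into {..<m} ((!) \<xi>) v))"
  have d: "d (\<xi> ! t) = c t" if "t < m" for t using that inj by (simp add: d_def the_inv_into_f_f)
  have "(\<Sum>v\<in>KB. d v *\<^sub>f v) = (\<Sum>t<m. c t *\<^sub>f (\<xi> ! t))"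
    unfolding im[symmetric] sum.reindex[OF inj] by (intro sum.cong) (auto simp: d)
  then have "(\<Sum>v\<in>KB. d v *\<^sub>f v) = 0" using assms(1) by simp
  then have "d (\<xi> ! t) = 0"
    using fs.independentD[OF independent_KB finite_KB subset_refl] \<xi>_set assms(2) nth_mem by blast
  then show ?thesis using d assms(2) by simp
qed

lemma lc_W: "lc x \<in> W"
  unfolding lc_def using \<xi>_W by (intro W.V_sum W.V_scale) auto

lemma lc_surj:
  assumes "w \<in> W"
  shows "\<exists>x\<in>carrier_vec m. w = lc x"
proof -
  have im: "(!) \<xi> ` {..<m} = set \<xi>" by (auto simp: set_conv_nth)
  have "w \<in> fs.span ((!) \<xi> ` {..<m})" using assms W.S_span im by simp
  then obtain c where "w = (\<Sum>t<m. c t *\<^sub>f (\<xi> ! t))" using span_image_sum by blast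
  then show ?thesis by (intro bexI[of _ "vec m c"]) (auto simp: lc_def)
qed

lemma lc_inj:
  assumes "x \<in> carrier_vec m" "y \<in> carrier_vec m" "lc x = lc y"
  shows "x = y"
proof (rule eq_vecI)
  have "(\<Sum>t<m. (x $ t - y $ t) *\<^sub>f (\<xi> ! t)) = 0"
    using assms(3) by (simp add: lc_def fs.scale_left_diff_distrib sum_subtractf)
  then show "x $ t = y $ t" if "t < dim_vec y" for t using lc_independent[of "\<lambda>t. x $ t - y $ t" t] that assms by simp
qed (use assms in simp)

lemma G_carrier: "G \<in> carrier_mat m m" by (simp add: gram_def)

lemma G_mult:
  assumes x: "x \<in> carrier_vec m" and t: "t < m"
  shows "(G *\<^sub>v x) $ t = a (lc x) (\<xi> ! t)"
proof -
  have "a (lc x) (\<xi> ! t) = (\<Sum>u<m. a ((x $ u) *\<^sub>f (\<xi> ! u)) (\<xi> ! t))"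
    unfolding lc_def using \<xi>_W t by (intro W.B_sum_left) auto
  also have "\<dots> = (\<Sum>u<m. a (\<xi> ! t) (\<xi> ! u) * x $ u)"
  proof (intro sum.cong refl)
    fix u assume "u \<in> {..<m}"
    then have u: "u < m" by simp
    show "a ((x $ u) *\<^sub>f (\<xi> ! u)) (\<xi> ! t) = a (\<xi> ! t) (\<xi> ! u) * x $ u"
      using W.B_scale_left[OF \<xi>_W[OF u] \<xi>_W[OF t], of "x $ u"] W.B_sym[OF \<xi>_W[OF u] \<xi>_W[OF t]] by simp
  qed
  finally show ?thesis using x t by (simp add: gram_def scalar_prod_def lessThan_atLeast0)
qed

lemma G_carrier_vec: "x \<in> carrier_vec m \<Longrightarrow> G *\<^sub>v x \<in> carrier_vec m"
  using G_carrier by simp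

lemma lc_G: "x \<in> carrier_vec m \<Longrightarrow> lc (G *\<^sub>v x) = \<A> (lc x)"
  unfolding lc_def[of "G *\<^sub>v x"] \<A>_def by (intro sum.cong) (auto simp: G_mult)

lemma quadratic_G:
  assumes x: "x \<in> carrier_vec m"
  shows "scalar_prod x (G *\<^sub>v x) = a (lc x) (lc x)"
proof -
  have "a (lc x) (lc x) = (\<Sum>t<m. a (lc x) ((x $ t) *\<^sub>f (\<xi> ! t)))"
    unfolding lc_def[of x] using \<xi>_W lc_W[unfolded lc_def] by (intro W.B_sum_right) auto
  also have "\<dots> = (\<Sum>t<m. x $ t * (G *\<^sub>v x) $ t)"
    using \<xi>_W lc_W by (intro sum.cong) (auto simp: W.B_scale_right G_mult[OF x])
  also have "\<dots> = scalar_prod x (G *\<^sub>v x)"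
    using carrier_vecD[OF G_carrier_vec[OF x]] by (simp only: scalar_prod_def lessThan_atLeast0)
  finally show ?thesis ..
qed

lemma G_inverse: "mat_inv G * G = 1\<^sub>m m" "mat_inv G \<in> carrier_mat m m"
proof -
  have "det G \<noteq> 0"
  proof
    assume "det G = 0"
    then obtain x where x: "x \<in> carrier_vec m" "x \<noteq> 0\<^sub>v m" "G *\<^sub>v x = 0\<^sub>v m"
      using det_0_iff_vec_prod_zero_field[OF G_carrier] by blast
    have "a (lc x) (lc x) = 0" using quadratic_G[OF x(1)] x by simp
    then have "lc x = 0" using W.definite lc_W by blast
    also have "\<dots> = lc (0\<^sub>v m)" by (simp add: lc_def)
    finally show False using lc_inj[OF x(1)] x(2) by simp
  qed
  then have "G \<in> Units (ring_mat TYPE(real) m ())" by (rule det_non_zero_imp_unit[OF G_carrier])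
  then show "mat_inv G * G = 1\<^sub>m m" "mat_inv G \<in> carrier_mat m m" using mat_inv_inverts[OF G_carrier] by auto
qed

lemma \<A>_lin_op: "W.lin_op \<A>"
  unfolding W.lin_op_def
proof (intro conjI ballI allI)
  show "\<A> x \<in> W" for x unfolding \<A>_def using \<xi>_W by (intro W.V_sum W.V_scale) auto
  show "\<A> (x + y) = \<A> x + \<A> y" if "x \<in> W" "y \<in> W" for x y
    unfolding \<A>_def sum.distrib[symmetric] using \<xi>_W that
    by (intro sum.cong) (auto simp: W.B_add_left fs.scale_left_distrib)
  show "\<A> (c *\<^sub>f x) = c *\<^sub>f \<A> x" if "x \<in> W" for x c
    unfolding \<A>_def fs.scale_sum_right using \<xi>_W that by (intro sum.cong) (auto simp: W.B_scale_left)
qed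

lemma \<A>_form:
  assumes "x \<in> W" "y \<in> W"
  shows "a (\<A> x) y = (\<Sum>t<m. a x (\<xi> ! t) * a y (\<xi> ! t))"
proof -
  have "a (\<A> x) y = (\<Sum>t<m. a (a x (\<xi> ! t) *\<^sub>f (\<xi> ! t)) y)"
    unfolding \<A>_def using \<xi>_W assms by (intro W.B_sum_left) auto
  also have "\<dots> = (\<Sum>t<m. a x (\<xi> ! t) * a y (\<xi> ! t))"
    using \<xi>_W assms by (intro sum.cong) (auto simp: W.B_scale_left W.B_sym[of y])
  finally show ?thesis .
qed

lemma \<A>_self: "x \<in> W \<Longrightarrow> y \<in> W \<Longrightarrow> a (\<A> x) y = a x (\<A> y)"
  using W.B_sym[of x "\<A> y"] W.lin_opD(1)[OF \<A>_lin_op] by (simp add: \<A>_form mult.commute)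

text \<open>Injectivity of \<open>lc\<close> lets the eigenvalue equation for functions be read off
  for their coordinate vectors.\<close>

lemma eigenvalue_G:
  assumes w: "w \<in> W" "w \<noteq> 0" "\<A> w = l *\<^sub>f w"
  shows "eigenvalue G l"
proof -
  obtain x where x: "x \<in> carrier_vec m" "w = lc x" using lc_surj[OF w(1)] by blast
  have "lc (l \<cdot>\<^sub>v x) = l *\<^sub>f lc x" using x(1) by (simp add: lc_def fs.scale_sum_right)
  then have "lc (G *\<^sub>v x) = lc (l \<cdot>\<^sub>v x)" using w(3) x by (simp add: lc_G)
  then have "G *\<^sub>v x = l \<cdot>\<^sub>v x" using x(1) by (intro lc_inj G_carrier_vec) auto
  moreover have "x \<noteq> 0\<^sub>v m"
  proof
    assume "x = 0\<^sub>v m"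
    then have "lc x = 0" by (simp add: lc_def)
    then show False using w(2) x(2) by simp
  qed
  ultimately show ?thesis
    unfolding eigenvalue_def eigenvector_def using x(1) G_carrier by auto
qed

lemma eigenvalue_G_pos:
  assumes "eigenvalue G l"
  shows "0 < l"
proof -
  obtain x where x: "x \<in> carrier_vec m" "x \<noteq> 0\<^sub>v m" "G *\<^sub>v x = l \<cdot>\<^sub>v x"
    using assms G_carrier unfolding eigenvalue_def eigenvector_def by auto
  have "lc x \<noteq> 0"
  proof
    assume "lc x = 0"
    also have "\<dots> = lc (0\<^sub>v m)" by (simp add: lc_def)
    finally show False using lc_inj[OF x(1)] x(2) by simp
  qed
  then have "0 < scalar_prod x (G *\<^sub>v x)" using quadratic_G[OF x(1)] W.B_pos[OF lc_W] by simp
  also have "scalar_prod x (G *\<^sub>v x) = l * scalar_prod x x" unfolding x(3) using x(1) by simp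
  finally have "0 < l * scalar_prod x x" .
  moreover have "0 \<le> scalar_prod x x" by (simp add: scalar_prod_def sum_nonneg)
  ultimately show ?thesis by (simp add: zero_less_mult_iff)
qed

lemma finite_eigenvalues: "finite {l. eigenvalue G l}"
proof -
  have "char_poly G \<noteq> 0" using degree_monic_char_poly[OF G_carrier] by auto
  then show ?thesis unfolding eigenvalue_root_char_poly[OF G_carrier] by (rule poly_roots_finite)
qed

text \<open>\<open>min_eigenvector\<close> for \<open>\<A>\<close> and for its negative yields two
  eigenvalues of \<open>G\<close> that bound the Rayleigh quotient from below and above; the
  smallest and largest eigenvalue can only be farther out.\<close>

lemma spectral_bounds:
  defines "lo \<equiv> Min {l. eigenvalue G l}" and "hi \<equiv> Max {l. eigenvalue G l}"
  shows "0 < lo" "lo \<le> hi" "\<And>x. x \<in> W \<Longrightarrow> lo * a x x \<le> a (\<A> x) x" "\<And>x. x \<in> W \<Longrightarrow> a (\<A> x) x \<le> hi * a x x"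
proof -
  obtain l v where lv: "v \<in> W" "v \<noteq> 0" "\<A> v = l *\<^sub>f v" "\<And>x. x \<in> W \<Longrightarrow> l * a x x \<le> a (\<A> x) x"
  proof (rule W.min_eigenvector[OF \<A>_lin_op _ KB_nonempty])
    show "a (\<A> x) y = a x (\<A> y)" if "x \<in> W" "y \<in> W" for x y by (rule \<A>_self[OF that])
  qed blast
  have neg: "W.lin_op (\<lambda>x. (- 1) *\<^sub>f \<A> x)"
    unfolding W.lin_op_def using W.lin_opD(1-3)[OF \<A>_lin_op]
    by (simp add: fs.scale_right_distrib del: fs.scale_minus_left)
  have negB: "a ((- 1) *\<^sub>f \<A> x) y = - a (\<A> x) y" if "x \<in> W" "y \<in> W" for x y
    using that W.lin_opD(1)[OF \<A>_lin_op] W.B_scale_left[of "\<A> x" y "- 1"] by simp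
  have negB': "a y ((- 1) *\<^sub>f \<A> x) = - a y (\<A> x)" if "x \<in> W" "y \<in> W" for x y
    using that W.lin_opD(1)[OF \<A>_lin_op] W.B_scale_right[of "\<A> x" y "- 1"] by simp
  obtain l' v' where lv': "v' \<in> W" "v' \<noteq> 0" "(- 1) *\<^sub>f \<A> v' = l' *\<^sub>f v'"
    "\<And>x. x \<in> W \<Longrightarrow> l' * a x x \<le> a ((- 1) *\<^sub>f \<A> x) x"
  proof (rule W.min_eigenvector[OF neg _ KB_nonempty])
    show "a ((- 1) *\<^sub>f \<A> x) y = a x ((- 1) *\<^sub>f \<A> y)" if "x \<in> W" "y \<in> W" for x y
      using negB[OF that] negB'[OF that(2,1)] \<A>_self[OF that] by simp
  qed blast
  have e: "eigenvalue G l" by (rule eigenvalue_G[OF lv(1-3)])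
  have "\<A> v' = (- 1) *\<^sub>f ((- 1) *\<^sub>f \<A> v')" by simp
  also have "\<dots> = (- l') *\<^sub>f v'" unfolding lv'(3) by simp
  finally have e': "eigenvalue G (- l')" by (rule eigenvalue_G[OF lv'(1,2)])
  have lo: "lo \<le> l" unfolding lo_def using finite_eigenvalues e by (intro Min_le) auto
  have hi: "- l' \<le> hi" unfolding hi_def using finite_eigenvalues e' by (intro Max_ge) auto
  have "lo \<in> {l. eigenvalue G l}" unfolding lo_def using finite_eigenvalues e by (intro Min_in) auto
  then show "0 < lo" using eigenvalue_G_pos by simp
  have "l \<le> hi" unfolding hi_def using finite_eigenvalues e by (intro Max_ge) auto
  then show "lo \<le> hi" using lo by simp
  fix x assume x: "x \<in> W"
  have "lo * a x x \<le> l * a x x" using lo W.B_nonneg[OF x] by (rule mult_right_mono)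
  then show "lo * a x x \<le> a (\<A> x) x" using lv(4)[OF x] by simp
  have "(- l') * a x x \<le> hi * a x x" using hi W.B_nonneg[OF x] by (rule mult_right_mono)
  then show "a (\<A> x) x \<le> hi * a x x" using lv'(4)[OF x] negB[OF x x] by simp
qed

lemma cg_rate_nonneg: "0 \<le> cg_rate G"
proof -
  have "1 \<le> cond_num G" using spectral_bounds(1,2) by (simp add: cond_num_def)
  then have "1 \<le> sqrt (cond_num G)" by simp
  then show ?thesis by (simp add: cg_rate_def)
qed

sublocale W: pos_operator fscale W a \<A> "Min {l. eigenvalue G l}" "Max {l. eigenvalue G l}"
  by unfold_locales (use spectral_bounds \<A>_self W.lin_opD[OF \<A>_lin_op] in auto)

lemma lc_pow: "x \<in> carrier_vec m \<Longrightarrow> lc ((G ^\<^sub>m j) *\<^sub>v x) = (\<A> ^^ j) (lc x)"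
proof (induction j arbitrary: x)
  case 0
  then show ?case using G_carrier by simp
next
  case (Suc j)
  have "(G ^\<^sub>m Suc j) *\<^sub>v x = (G ^\<^sub>m j) *\<^sub>v (G *\<^sub>v x)"
    using G_carrier Suc.prems by (simp add: assoc_mult_mat_vec[of _ m m _ m])
  then show ?case using Suc.IH[OF G_carrier_vec[OF Suc.prems]] lc_G[OF Suc.prems] by (simp add: funpow_swap1)
qed

text \<open>The vector \<open>b\<close> already corresponds to \<open>\<A> y\<close>, which explains
  the shift of exponents in \<open>krylov_space\<close>.\<close>

lemma lc_krylov:
  assumes b: "b \<in> carrier_vec m" and y: "\<A> y = lc b"
  shows "lc ` krylov G b k = W.krylov_space \<A> y k"
proof -
  have lc_poly: "lc (vec (dim_vec b) (\<lambda>t. \<Sum>j<k. c j * (((G ^\<^sub>m j) *\<^sub>v b) $ t))) = (\<Sum>j<k. c j *\<^sub>f (\<A> ^^ Suc j) y)" for c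
  proof -
    have "lc (vec (dim_vec b) (\<lambda>t. \<Sum>j<k. c j * (((G ^\<^sub>m j) *\<^sub>v b) $ t)))
        = (\<Sum>t<m. \<Sum>j<k. c j *\<^sub>f ((((G ^\<^sub>m j) *\<^sub>v b) $ t) *\<^sub>f (\<xi> ! t)))"
      unfolding lc_def using b by (intro sum.cong) (auto simp: fs.scale_sum_left)
    also have "\<dots> = (\<Sum>j<k. c j *\<^sub>f lc ((G ^\<^sub>m j) *\<^sub>v b))"
      by (subst sum.swap) (simp add: lc_def fs.scale_sum_right)
    also have "\<dots> = (\<Sum>j<k. c j *\<^sub>f (\<A> ^^ Suc j) y)"
      by (intro sum.cong refl) (simp add: lc_pow[OF b] y[symmetric] funpow_swap1)
    finally show ?thesis .
  qed
  show ?thesis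
  proof (rule antisym)
    show "lc ` krylov G b k \<subseteq> W.krylov_space \<A> y k"
    proof
      fix w assume "w \<in> lc ` krylov G b k"
      then obtain c where "w = (\<Sum>j<k. c j *\<^sub>f (\<A> ^^ Suc j) y)"
        unfolding krylov_def using lc_poly by blast
      then show "w \<in> W.krylov_space \<A> y k"
        unfolding W.krylov_space_def by (simp only:) (intro fs.span_sum fs.span_scale fs.span_base imageI)
    qed
    show "W.krylov_space \<A> y k \<subseteq> lc ` krylov G b k"
    proof
      fix x assume "x \<in> W.krylov_space \<A> y k"
      then obtain c where "x = (\<Sum>j<k. c j *\<^sub>f (\<A> ^^ Suc j) y)"
        unfolding W.krylov_space_def using span_image_sum[of "{..<k}" x "\<lambda>j. (\<A> ^^ Suc j) y"] by blast
      then show "x \<in> lc ` krylov G b k" unfolding lc_poly[symmetric] krylov_def by blast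
    qed
  qed
qed

lemma krylov_carrier: "b \<in> carrier_vec m \<Longrightarrow> x \<in> krylov G b k \<Longrightarrow> x \<in> carrier_vec m"
  by (auto simp: krylov_def)

text \<open>\<open>y\<close> is the exact correction of \<open>v\<close>. Since \<open>v - y\<close>
  is orthogonal to \<open>W\<close>, its coordinates solve the linear system, and
  \<open>cg_error\<close> is the squared energy distance to \<open>y\<close>.\<close>

lemma correction_error:
  assumes v: "v \<in> Vh N r" and y: "y \<in> W" "\<And>z. z \<in> W \<Longrightarrow> a (v - y) z = 0"
  shows "correction \<kappa> \<xi> k v \<in> W"
    "a (y - correction \<kappa> \<xi> k v) (y - correction \<kappa> \<xi> k v) \<le> (2 * cg_rate G ^ k)\<^sup>2 * a y y"
proof -
  define b where "b = vec m (\<lambda>t. a v (\<xi> ! t))"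
  have b: "b \<in> carrier_vec m" by (simp add: b_def)
  have yV: "y \<in> Vh N r" using y(1) W_Vh by blast
  have by': "b $ t = a y (\<xi> ! t)" if "t < m" for t
    using y(2)[OF \<xi>_W[OF that]] that v yV \<xi>_Vh[OF that] by (simp add: b_def A.B_diff_left)
  obtain x where x: "x \<in> carrier_vec m" "y = lc x" using lc_surj[OF y(1)] by blast
  have Gx: "G *\<^sub>v x = b"
    using b G_carrier G_mult[OF x(1)] by' x(2) by (intro eq_vecI) auto
  have Ay: "\<A> y = lc b" using lc_G[OF x(1)] Gx x(2) by simp
  have "mat_inv G *\<^sub>v b = (mat_inv G * G) *\<^sub>v x"
    using G_inverse(2) G_carrier x(1) unfolding Gx[symmetric] by (simp add: assoc_mult_mat_vec[of _ m m _ m])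
  then have inv: "mat_inv G *\<^sub>v b = x" using G_inverse(1) x(1) by simp
  have err: "cg_error G b z = a (y - lc z) (y - lc z)" if "z \<in> carrier_vec m" for z
  proof -
    have "lc (x - z) = y - lc z"
      using that x by (simp add: lc_def fs.scale_left_diff_distrib sum_subtractf)
    then show ?thesis
      using quadratic_G[of "x - z"] x(1) that by (simp add: cg_error_def inv Let_def)
  qed
  let ?K = "W.krylov_space \<A> y k"
  have K: "lc ` krylov G b k = ?K" by (rule lc_krylov[OF b Ay])
  have fK: "finite ((\<lambda>j. (\<A> ^^ Suc j) y) ` {..<k})" by simp
  have KW: "?K \<subseteq> W" by (rule W.krylov_space_V[OF y(1)])
  have gK: "(\<lambda>j. (\<A> ^^ Suc j) y) ` {..<k} \<subseteq> W"
    by (rule order_trans[OF fs.span_superset KW[unfolded W.krylov_space_def]])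
  obtain w where w: "w \<in> ?K" "\<And>z. z \<in> ?K \<Longrightarrow> a (y - w) z = 0"
    using W.projection[OF fK gK y(1)] unfolding W.krylov_space_def by blast
  then obtain x0 where x0: "x0 \<in> krylov G b k" "w = lc x0" using K by blast
  \<comment> \<open>\<open>ARG_MIN\<close> is a choice, which satisfies the minimum property only if
    a minimizer exists; the energy projection of \<open>y\<close> onto the Krylov space provides
    one.\<close>
  have "is_arg_min (cg_error G b) (\<lambda>x. x \<in> krylov G b k) x0"
    unfolding is_arg_min_linorder
  proof (intro conjI allI impI x0(1))
    fix z assume z: "z \<in> krylov G b k"
    have "a (y - w) (y - w) \<le> a (y - lc z) (y - lc z)"
      by (rule W.best_approximation[OF y(1) W.krylov_space_subspace KW w(1) _ w(2)]) (use z K in blast)+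
    then show "cg_error G b x0 \<le> cg_error G b z"
      using err krylov_carrier[OF b] x0 z by simp
  qed
  then have "is_arg_min (cg_error G b) (\<lambda>x. x \<in> krylov G b k) (cg G b k)"
    unfolding cg_def arg_min_def by (rule someI)
  then have cg: "cg G b k \<in> krylov G b k" "\<And>z. z \<in> krylov G b k \<Longrightarrow> cg_error G b (cg G b k) \<le> cg_error G b z"
    unfolding is_arg_min_linorder by auto
  have corr: "correction \<kappa> \<xi> k v = lc (cg G b k)"
    by (simp add: correction_def b_def lc_def Let_def)
  show "correction \<kappa> \<xi> k v \<in> W" unfolding corr by (rule lc_W)
  obtain z where z: "z \<in> ?K" "a (y - z) (y - z) \<le> (2 * cg_rate G ^ k)\<^sup>2 * a y y"
    using W.krylov_space_approximation[OF y(1) k, of "cg_rate G"] by (auto simp: cg_rate_def cond_num_def)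
  then obtain z' where z': "z' \<in> krylov G b k" "z = lc z'" using K by blast
  have "cg_error G b (cg G b k) \<le> cg_error G b z'" by (rule cg(2)[OF z'(1)])
  then show "a (y - correction \<kappa> \<xi> k v) (y - correction \<kappa> \<xi> k v) \<le> (2 * cg_rate G ^ k)\<^sup>2 * a y y"
    using err krylov_carrier[OF b] cg(1) z' z(2) unfolding corr by simp
qed

section \<open>The error estimates\<close>

abbreviation "Vms \<equiv> V_ms N r \<kappa> L dn \<xi> k"

lemma projection_W:
  assumes v: "v \<in> Vh N r"
  shows "\<exists>y. y \<in> W \<and> (\<forall>z\<in>W. a (v - y) z = 0)"
proof -
  have "set \<xi> \<subseteq> Vh N r" using \<xi>_set KB_W W_Vh by blast
  then show ?thesis using A.projection[OF _ _ v, of "set \<xi>"] W.S_span by auto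
qed

lemma Vms_alt: "Vms = fs.span ((\<lambda>(i, j). \<phi>d i j - correction \<kappa> \<xi> k (\<phi>d i j)) ` dual_idx)"
proof -
  have "{\<phi>d i j - correction \<kappa> \<xi> k (\<phi>d i j) | i j. i \<in> elems N \<and> j < L i}
      = (\<lambda>(i, j). \<phi>d i j - correction \<kappa> \<xi> k (\<phi>d i j)) ` dual_idx"
    by (force simp: dual_idx_def)
  then show ?thesis by (simp add: V_ms_def)
qed

lemma dual_idxD: "(i, j) \<in> dual_idx \<Longrightarrow> i \<in> elems N \<and> j < L i"
  by (simp add: dual_idx_def)

lemma corrected_Vh:
  assumes "(i, j) \<in> dual_idx"
  shows "\<phi>d i j - correction \<kappa> \<xi> k (\<phi>d i j) \<in> Vh N r"
proof -
  have v: "\<phi>d i j \<in> Vh N r" using \<phi>d_Vh dual_idxD[OF assms] by blast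
  obtain y where "y \<in> W" "\<forall>z\<in>W. a (\<phi>d i j - y) z = 0" using projection_W[OF v] by blast
  then have "correction \<kappa> \<xi> k (\<phi>d i j) \<in> Vh N r" using correction_error(1)[OF v] W_Vh by blast
  then show ?thesis using v by auto
qed

lemma Vms_gens: "(\<lambda>(i, j). \<phi>d i j - correction \<kappa> \<xi> k (\<phi>d i j)) ` dual_idx \<subseteq> Vh N r"
  using corrected_Vh by (auto split: prod.splits)

lemma Vms_Vh: "Vms \<subseteq> Vh N r"
  unfolding Vms_alt by (rule A.V_span[OF Vms_gens])

lemma galerkin_exists:
  assumes g: "g \<in> L2" and T: "finite T" "T \<subseteq> Vh N r"
  shows "\<exists>u. galerkin_solution \<kappa> g (fs.span T) u"
proof -
  interpret L2: semi_inner fscale L2 L2_prod by (rule semi_inner_L2)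
  have sub: "x \<in> L2" if "x \<in> fs.span T" for x using that A.V_span[OF T(2)] Vh_L2 by blast
  have "\<exists>w\<in>fs.span T. \<forall>z\<in>fs.span T. a w z = L2_prod g z"
    by (rule A.riesz[OF T]) (use sub g in \<open>auto simp: L2.B_add_right L2.B_scale_right\<close>)
  then show ?thesis by (auto simp: galerkin_solution_def)
qed

text \<open>Testing with \<open>u\<close> itself and using Poincare on the whole domain; constant
  one keeps the localization error free of further factors.\<close>

lemma L2_stability:
  assumes f: "f \<in> L2" and u: "galerkin_solution \<kappa> f (Vh N r) u"
  shows "L2_norm u \<le> L2_norm f"
proof -
  interpret L2: semi_inner fscale L2 L2_prod by (rule semi_inner_L2)
  have uV: "u \<in> Vh N r" "a u u = L2_prod f u" using u by (auto simp: galerkin_solution_def)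
  have uL: "u \<in> L2" using uV Vh_L2 by blast
  have "(L2_norm u)\<^sup>2 = L2_prod u u" using L2.B_nonneg[OF uL] by (simp add: L2_norm_def)
  also have "\<dots> \<le> 4 / pi\<^sup>2 * a u u"
    using poincare_\<Omega>[OF coefficient_axioms uV(1)] by (simp add: L2_prod_mass)
  also have "\<dots> \<le> 1 * a u u"
  proof (rule mult_right_mono)
    have "2\<^sup>2 \<le> pi\<^sup>2" using pi_ge_two by (intro power_mono) auto
    then show "4 / pi\<^sup>2 \<le> 1" by simp
  qed (rule A.B_nonneg[OF uV(1)])
  also have "1 * a u u \<le> L2_norm f * L2_norm u"
    using L2.cauchy_schwarz_sqrt[OF f uL] uV(2) by (simp add: L2_norm_def)
  finally have *: "L2_norm u * L2_norm u \<le> L2_norm f * L2_norm u" by (simp add: power2_eq_square)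
  have nn: "0 \<le> L2_norm u" "0 \<le> L2_norm f" using L2.B_nonneg[OF uL] L2.B_nonneg[OF f] by (simp_all add: L2_norm_def)
  show ?thesis
  proof (cases "L2_norm u = 0")
    case False
    then show ?thesis using * nn by (simp add: mult_le_cancel_right)
  qed (use nn in simp)
qed

lemma kernel_L2:
  assumes w: "w \<in> W"
  shows "L2_norm w \<le> 2 powr (3 / 2) / pi * (1 / real N) * form_norm a w"
proof -
  have wV: "w \<in> Vh N r" using w W_Vh by blast
  have "L2_prod w w \<le> 8 / pi\<^sup>2 / (real N)\<^sup>2 * a w w"
    unfolding L2_prod_mass by (rule kernel_poincare[OF eb wV \<mu> s_W[OF _ _ w] lam])
  then have "L2_norm w \<le> sqrt (8 / pi\<^sup>2 / (real N)\<^sup>2 * a w w)" unfolding L2_norm_def by (rule real_sqrt_le_mono)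
  also have "\<dots> = sqrt 8 / pi / real N * form_norm a w"
    by (simp add: form_norm_def real_sqrt_mult real_sqrt_divide)
  also have "sqrt 8 = 2 powr (3 / 2)"
  proof -
    have "(2 powr (3 / 2))\<^sup>2 = (2 :: real) powr 3" by (simp add: power2_eq_square flip: powr_add)
    also have "\<dots> = 8" by simp
    finally show ?thesis by (intro real_sqrt_unique) auto
  qed
  finally show ?thesis by simp
qed

text \<open>With \<open>z\<close> the ideal multiscale solution, the error splits as \<open>(u - z) + (z - w)\<close> with \<open>u - z\<close> in
  the kernel and \<open>w\<close> the localized counterpart of \<open>z\<close>.\<close>

lemma energy_error:
  assumes f: "f \<in> L2" and u: "galerkin_solution \<kappa> f (Vh N r) u" and uk: "galerkin_solution \<kappa> f Vms u\<^sub>k"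
    and small: "2 * cg_rate G ^ k * sqrt (real (\<Sum>i\<in>elems N. L i)) * sqrt M * sqrt \<beta> \<le> (1 / real N)\<^sup>2"
  shows "form_norm a (u - u\<^sub>k) \<le> (2 powr (3 / 2) / pi + 1) * (1 / real N) * L2_norm f"
proof -
  interpret L2: semi_inner fscale L2 L2_prod by (rule semi_inner_L2)
  let ?C = "2 powr (3 / 2) / pi" and ?q = "2 * cg_rate G ^ k"
  have uV: "u \<in> Vh N r" "\<And>v. v \<in> Vh N r \<Longrightarrow> a u v = L2_prod f v" using u by (auto simp: galerkin_solution_def)
  have ukV: "u\<^sub>k \<in> Vms" "\<And>v. v \<in> Vms \<Longrightarrow> a u\<^sub>k v = L2_prod f v" using uk by (auto simp: galerkin_solution_def)
  have ukV': "u\<^sub>k \<in> Vh N r" using ukV Vms_Vh by blast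
  have q0: "0 \<le> ?q" using cg_rate_nonneg by simp
  obtain c where c: "dual_part u = (\<Sum>(i, j)\<in>dual_idx. c i j *\<^sub>f \<phi>d i j)" using dual_part_\<phi>d_expansion by blast
  define vd where "vd = dual_part u"
  have "\<forall>p\<in>dual_idx. \<exists>y. y \<in> W \<and> (\<forall>z\<in>W. a (\<phi>d (fst p) (snd p) - y) z = 0)"
    using projection_W \<phi>d_Vh dual_idxD by (metis prod.collapse)
  then obtain Y where Y: "\<And>p. p \<in> dual_idx \<Longrightarrow> Y p \<in> W" "\<And>p z. p \<in> dual_idx \<Longrightarrow> z \<in> W \<Longrightarrow> a (\<phi>d (fst p) (snd p) - Y p) z = 0"
    by metis
  define F where "F = (\<lambda>p :: idx \<times> nat. \<phi>d (fst p) (snd p))"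
  define d where "d = (\<lambda>p :: idx \<times> nat. c (fst p) (snd p))"
  define R where "R = (\<lambda>p. correction \<kappa> \<xi> k (F p))"
  have F: "F p \<in> Vh N r" "a (F p) (F p) = 1" if "p \<in> dual_idx" for p
    using that \<phi>d_Vh dual_idxD[of "fst p" "snd p"] \<phi>d_orthonormal[of "fst p" "snd p" "fst p" "snd p"] by (auto simp: F_def)
  have Yo: "a (F p - Y p) z = 0" if "p \<in> dual_idx" "z \<in> W" for p z using Y(2)[OF that] by (simp add: F_def)
  have YV: "Y p \<in> Vh N r" if "p \<in> dual_idx" for p using Y(1)[OF that] W_Vh by blast
  have R: "R p \<in> W" "a (Y p - R p) (Y p - R p) \<le> ?q\<^sup>2 * a (Y p) (Y p)" if "p \<in> dual_idx" for p
    using correction_error[OF F(1)[OF that] Y(1)[OF that] Yo[OF that]] by (simp_all add: R_def)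
  have RV: "R p \<in> Vh N r" if "p \<in> dual_idx" for p using R(1)[OF that] W_Vh by blast
  \<comment> \<open>The exact correction is a projection of a hat of unit energy, which turns the
    relative bound for the iteration into the absolute bound
    \<open>2 * cg_rate G ^ k\<close>.\<close>
  have Y1: "a (Y p) (Y p) \<le> 1" if p: "p \<in> dual_idx" for p
  proof -
    have "a (F p) (F p) = a ((F p - Y p) + Y p) ((F p - Y p) + Y p)" by simp
    also have "\<dots> = a (F p - Y p) (F p - Y p) + 2 * a (F p - Y p) (Y p) + a (Y p) (Y p)"
      using F[OF p] YV[OF p] A.B_sym[of "Y p" "F p - Y p"] by (simp only: A.B_add_left A.B_add_right A.V_diff A.V_add)
    finally show ?thesis using F(2)[OF p] Yo[OF p Y(1)[OF p]] A.B_nonneg[of "F p - Y p"] F(1)[OF p] YV[OF p] by simp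
  qed
  have R1: "sqrt (a (Y p - R p) (Y p - R p)) \<le> ?q" if p: "p \<in> dual_idx" for p
  proof -
    have "a (Y p - R p) (Y p - R p) \<le> ?q\<^sup>2 * 1"
      using R(2)[OF p] mult_left_mono[OF Y1[OF p], of "?q\<^sup>2"] by simp
    then show ?thesis using q0 by (intro real_le_lsqrt) auto
  qed
  define z where "z = (\<Sum>p\<in>dual_idx. d p *\<^sub>f (F p - Y p))"
  define w where "w = (\<Sum>p\<in>dual_idx. d p *\<^sub>f (F p - R p))"
  have vd: "vd = (\<Sum>p\<in>dual_idx. d p *\<^sub>f F p)" unfolding vd_def c by (simp add: d_def F_def split_beta)
  have zV: "z \<in> Vh N r" unfolding z_def using F YV by (intro A.V_sum A.V_scale A.V_diff) auto
  have wV: "w \<in> Vms"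
    unfolding w_def Vms_alt
    by (intro fs.span_sum fs.span_scale fs.span_base) (force simp: R_def F_def split_beta)
  have wV': "w \<in> Vh N r" using wV Vms_Vh by blast
  have zo: "a z v = 0" if v: "v \<in> W" for v
  proof -
    have vV: "v \<in> Vh N r" using v W_Vh by blast
    have "a z v = (\<Sum>p\<in>dual_idx. a (d p *\<^sub>f (F p - Y p)) v)"
      unfolding z_def using F YV vV by (intro A.B_sum_left) auto
    also have "\<dots> = 0" using F YV vV Yo[OF _ v] by (intro sum.neutral) (auto simp: A.B_scale_left)
    finally show ?thesis .
  qed
  \<comment> \<open>\<open>z\<close> replaces each dual hat in \<open>vd\<close> by its part
    orthogonal to \<open>W\<close>. Thus \<open>u - z\<close> is in \<open>W\<close> and
    \<open>z\<close> is orthogonal to \<open>W\<close>, which identifies \<open>z\<close> as a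
    projection of \<open>u\<close>.\<close>
  have "u - z = (u - vd) + (\<Sum>p\<in>dual_idx. d p *\<^sub>f Y p)"
    unfolding z_def vd by (simp add: fs.scale_right_diff_distrib sum_subtractf)
  moreover have "(\<Sum>p\<in>dual_idx. d p *\<^sub>f Y p) \<in> W" using Y(1) by (intro W.V_sum W.V_scale) auto
  then have "(u - vd) + (\<Sum>p\<in>dual_idx. d p *\<^sub>f Y p) \<in> W"
    using minus_dual_part_W[OF uV(1)] unfolding vd_def by (rule W.V_add[rotated])
  ultimately have uzW: "u - z \<in> W" by (simp only:)
  have uzV: "u - z \<in> Vh N r" using uzW W_Vh by blast
  \<comment> \<open>Orthogonality turns the squared energy into the load tested with
    \<open>u - z\<close>; the estimate on \<open>W\<close> then returns one factor of the energy
    norm, which is divided out.\<close>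
  have "(form_norm a (u - z))\<^sup>2 = a (u - z) (u - z)" using A.B_nonneg[OF uzV] by (simp add: form_norm_def)
  also have "\<dots> = a u (u - z)" using zo[OF uzW] uV(1) zV uzV by (subst A.B_diff_left) auto
  also have "\<dots> \<le> L2_norm f * L2_norm (u - z)"
    using uV(2)[OF uzV] L2.cauchy_schwarz_sqrt[OF f, of "u - z"] uzV Vh_L2 by (auto simp: L2_norm_def subset_iff)
  also have "\<dots> \<le> L2_norm f * (?C * (1 / real N) * form_norm a (u - z))"
    using kernel_L2[OF uzW] L2.B_nonneg[OF f] by (intro mult_left_mono) (auto simp: L2_norm_def)
  finally have *: "form_norm a (u - z) * form_norm a (u - z) \<le> (?C * (1 / real N) * L2_norm f) * form_norm a (u - z)"
    by (simp add: power2_eq_square mult_ac)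
  have nn: "0 \<le> form_norm a v" "0 \<le> L2_norm f" if "v \<in> Vh N r" for v
    using A.B_nonneg[OF that] L2.B_nonneg[OF f] by (simp_all add: form_norm_def L2_norm_def)
  have uz: "form_norm a (u - z) \<le> ?C * (1 / real N) * L2_norm f"
  proof (cases "form_norm a (u - z) = 0")
    case True
    then show ?thesis using nn[OF uzV] by simp
  next
    case False
    then have "0 < form_norm a (u - z)" using nn(1)[OF uzV] by simp
    with * show ?thesis by (rule mult_right_le_imp_le)
  qed
  have zw: "form_norm a (z - w) \<le> 1 / real N * L2_norm f"
  proof -
    have RY: "R p - Y p \<in> Vh N r" if "p \<in> dual_idx" for p using RV YV that by auto
    have "z - w = (\<Sum>p\<in>dual_idx. d p *\<^sub>f (R p - Y p))"
      unfolding z_def w_def by (simp add: fs.scale_right_diff_distrib sum_subtractf)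
    then have "form_norm a (z - w) \<le> (\<Sum>p\<in>dual_idx. sqrt (a (d p *\<^sub>f (R p - Y p)) (d p *\<^sub>f (R p - Y p))))"
      unfolding form_norm_def using RY by (simp only:) (intro A.triangle_sum A.V_scale)
    also have "\<dots> = (\<Sum>p\<in>dual_idx. \<bar>d p\<bar> * sqrt (a (R p - Y p) (R p - Y p)))"
      using RY A.norm_scale by (intro sum.cong) auto
    also have "\<dots> \<le> (\<Sum>p\<in>dual_idx. \<bar>d p\<bar> * ?q)"
    proof (intro sum_mono mult_left_mono)
      fix p assume p: "p \<in> dual_idx"
      have "a (R p - Y p) (R p - Y p) = a (Y p - R p) (Y p - R p)"
        using RV[OF p] YV[OF p] by (simp add: A.B_diff_left A.B_diff_right A.B_sym[of "Y p" "R p"])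
      then show "sqrt (a (R p - Y p) (R p - Y p)) \<le> ?q" using R1[OF p] by simp
    qed simp
    also have "\<dots> = ?q * (\<Sum>p\<in>dual_idx. 1 * \<bar>d p\<bar>)"
      unfolding sum_distrib_left by (intro sum.cong refl) simp
    also have "\<dots> \<le> ?q * (sqrt (\<Sum>p\<in>dual_idx. 1\<^sup>2) * sqrt (\<Sum>p\<in>dual_idx. \<bar>d p\<bar>\<^sup>2))"
      using sum_cauchy_schwarz[of "\<lambda>_. 1" "\<lambda>p. \<bar>d p\<bar>" dual_idx] q0 by (intro mult_left_mono) auto
    also have "(\<Sum>p\<in>dual_idx. 1\<^sup>2) = real (\<Sum>i\<in>elems N. L i)" by (simp add: card_dual_idx)
    also have "(\<Sum>p\<in>dual_idx. \<bar>d p\<bar>\<^sup>2) = a vd vd"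
      using dual_energy(2)[of c] unfolding vd_def c by (simp add: d_def split_beta)
    also have "?q * (sqrt (real (\<Sum>i\<in>elems N. L i)) * sqrt (a vd vd))
        \<le> ?q * (sqrt (real (\<Sum>i\<in>elems N. L i)) * (sqrt M * (real N * (sqrt \<beta> * L2_norm u))))"
    proof (intro mult_left_mono)
      have "a vd vd \<le> M * (\<Sum>i\<in>elems N. s i u u)" unfolding vd_def by (rule dual_part_energy[OF uV(1)])
      also have "\<dots> \<le> M * ((real N)\<^sup>2 * \<beta> * L2_prod u u)" by (rule mult_left_mono[OF s_sum_le[OF uV(1)] M_nonneg])
      finally have "sqrt (a vd vd) \<le> sqrt (M * ((real N)\<^sup>2 * \<beta> * L2_prod u u))" by (rule real_sqrt_le_mono)
      then show "sqrt (a vd vd) \<le> sqrt M * (real N * (sqrt \<beta> * L2_norm u))"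
        by (simp add: real_sqrt_mult L2_norm_def mult.assoc)
    qed (use q0 in \<open>auto intro: sum_nonneg\<close>)
    also have "\<dots> = (?q * sqrt (real (\<Sum>i\<in>elems N. L i)) * sqrt M * sqrt \<beta>) * (real N * L2_norm u)"
      by (simp only: mult_ac)
    also have "\<dots> \<le> (1 / real N)\<^sup>2 * (real N * L2_norm u)"
    proof (rule mult_right_mono[OF small])
      have "u \<in> L2" using uV(1) Vh_L2 by blast
      then show "0 \<le> real N * L2_norm u" using L2.B_nonneg[of u] by (simp add: L2_norm_def)
    qed
    also have "\<dots> = 1 / real N * L2_norm u" using N by (simp add: power2_eq_square)
    also have "\<dots> \<le> 1 / real N * L2_norm f" using L2_stability[OF f u] by (intro mult_left_mono) auto
    finally show ?thesis .
  qed
  have "a (u - u\<^sub>k) (u - u\<^sub>k) \<le> a (u - w) (u - w)"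
  proof (rule A.best_approximation[OF uV(1) _ Vms_Vh ukV(1) wV])
    show "fs.subspace Vms" unfolding Vms_alt by (rule fs.subspace_span)
    show "a (u - u\<^sub>k) v = 0" if "v \<in> Vms" for v
      using that uV ukV ukV' Vms_Vh by (simp add: A.B_diff_left subset_iff)
  qed
  then have "form_norm a (u - u\<^sub>k) \<le> form_norm a ((u - z) + (z - w))" by (simp add: form_norm_def)
  also have "\<dots> \<le> form_norm a (u - z) + form_norm a (z - w)"
    unfolding form_norm_def by (rule A.triangle[OF uzV A.V_diff[OF zV wV']])
  also have "\<dots> \<le> (?C + 1) * (1 / real N) * L2_norm f" using add_mono[OF uz zw] by (simp only: distrib_right mult_1_left)
  finally show ?thesis .
qed

text \<open>The second bound follows by duality: the Galerkin problems with the error itself as right hand side.\<close>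

lemma L2_error:
  assumes f: "f \<in> L2" and u: "galerkin_solution \<kappa> f (Vh N r) u" and uk: "galerkin_solution \<kappa> f Vms u\<^sub>k"
    and small: "2 * cg_rate G ^ k * sqrt (real (\<Sum>i\<in>elems N. L i)) * sqrt M * sqrt \<beta> \<le> (1 / real N)\<^sup>2"
  shows "L2_norm (u - u\<^sub>k) \<le> ((2 powr (3 / 2) / pi + 1) * (1 / real N))\<^sup>2 * L2_norm f"
proof -
  interpret L2: semi_inner fscale L2 L2_prod by (rule semi_inner_L2)
  let ?D = "(2 powr (3 / 2) / pi + 1) * (1 / real N)"
  define g where "g = u - u\<^sub>k"
  have uV: "u \<in> Vh N r" "\<And>v. v \<in> Vh N r \<Longrightarrow> a u v = L2_prod f v" using u by (auto simp: galerkin_solution_def)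
  have ukV: "u\<^sub>k \<in> Vms" "\<And>v. v \<in> Vms \<Longrightarrow> a u\<^sub>k v = L2_prod f v" using uk by (auto simp: galerkin_solution_def)
  have ukV': "u\<^sub>k \<in> Vh N r" using ukV Vms_Vh by blast
  have gV: "g \<in> Vh N r" using uV ukV' by (simp add: g_def)
  have gL: "g \<in> L2" using gV Vh_L2 by blast
  have go: "a g v = 0" if "v \<in> Vms" for v
    using that uV ukV ukV' Vms_Vh by (simp add: g_def A.B_diff_left subset_iff)
  obtain y where y: "galerkin_solution \<kappa> g (Vh N r) y"
  proof -
    have "hat N r ` nodes N r \<subseteq> Vh N r" using hat_Vh by blast
    then show thesis using galerkin_exists[OF gL A.finite_S] that unfolding span_hat by blast
  qed
  obtain y\<^sub>k where yk: "galerkin_solution \<kappa> g Vms y\<^sub>k"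
    using galerkin_exists[OF gL finite_imageI[OF finite_dual_idx] Vms_gens] unfolding Vms_alt by blast
  have yV: "y \<in> Vh N r" "a y g = L2_prod g g" "y\<^sub>k \<in> Vms"
    using y yk gV by (auto simp: galerkin_solution_def)
  have ykV: "y\<^sub>k \<in> Vh N r" using yV(3) Vms_Vh by blast
  have D0: "0 \<le> ?D" by simp
  have nn: "0 \<le> L2_norm g" "0 \<le> L2_norm f" using L2.B_nonneg[OF gL] L2.B_nonneg[OF f] by (simp_all add: L2_norm_def)
  have "(L2_norm g)\<^sup>2 = L2_prod g g" using L2.B_nonneg[OF gL] by (simp add: L2_norm_def)
  \<comment> \<open>Galerkin orthogonality of \<open>g\<close> to \<open>Vms\<close> allows
    \<open>y\<^sub>k\<close> to be subtracted; the energy error of the dual problem supplies the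
    second factor \<open>?D\<close>.\<close>
  also have "\<dots> = a g (y - y\<^sub>k)"
    using yV go[OF yV(3)] gV ykV A.B_sym[OF gV yV(1)] by (simp add: A.B_diff_right)
  also have "\<dots> \<le> form_norm a g * form_norm a (y - y\<^sub>k)"
    using A.cauchy_schwarz_sqrt[OF gV, of "y - y\<^sub>k"] yV(1) ykV by (simp add: form_norm_def)
  also have "\<dots> \<le> (?D * L2_norm f) * (?D * L2_norm g)"
  proof (rule mult_mono)
    show "form_norm a g \<le> ?D * L2_norm f" unfolding g_def by (rule energy_error[OF f u uk small])
    show "form_norm a (y - y\<^sub>k) \<le> ?D * L2_norm g" by (rule energy_error[OF gL y yk small])
    show "0 \<le> ?D * L2_norm f" using D0 nn(2) by (rule mult_nonneg_nonneg)
    show "0 \<le> form_norm a (y - y\<^sub>k)" using A.B_nonneg[of "y - y\<^sub>k"] yV(1) ykV by (simp add: form_norm_def)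
  qed
  also have "\<dots> = (?D\<^sup>2 * L2_norm f) * L2_norm g" by (simp only: power2_eq_square mult_ac)
  finally have *: "L2_norm g * L2_norm g \<le> (?D\<^sup>2 * L2_norm f) * L2_norm g" by (simp only: power2_eq_square)
  have "L2_norm g \<le> ?D\<^sup>2 * L2_norm f"
  proof (cases "L2_norm g = 0")
    case True
    then show ?thesis using nn(2) by simp
  next
    case False
    then have "0 < L2_norm g" using nn(1) by simp
    with * show ?thesis by (rule mult_right_le_imp_le)
  qed
  then show ?thesis by (simp add: g_def)
qed

end

theorem mainTheorem1:
  fixes N r k :: nat
    and \<kappa> f u_h u_k :: "real \<times> real \<Rightarrow> real"
    and \<beta> :: real
    and lam :: "nat \<times> nat \<Rightarrow> nat \<Rightarrow> real"
    and \<psi> :: "nat \<times> nat \<Rightarrow> nat \<Rightarrow> real \<times> real \<Rightarrow> real"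
    and \<mu> :: "nat \<times> nat \<Rightarrow> real"
    and L :: "nat \<times> nat \<Rightarrow> nat"
    and dn :: "nat \<times> nat \<Rightarrow> nat \<Rightarrow> nat \<times> nat"
    and ns :: "(nat \<times> nat) list"
    and \<xi> :: "(real \<times> real \<Rightarrow> real) list"
  defines "H \<equiv> 1 / real N"
    and "q \<equiv> cg_rate (gram \<kappa> \<xi>)"
    and "C \<equiv> 2 powr (3 / 2) / pi"
  assumes "2 \<le> N" and "2 \<le> r"
    and "pw_const_coeff \<kappa> \<beta>"
    and "\<And>i. i \<in> elems N \<Longrightarrow> eigenbasis N r \<kappa> i (lam i) (\<psi> i)"
    and "\<And>i. i \<in> elems N \<Longrightarrow> smallest_pos_eigenvalue N r i (\<mu> i)"
    and "\<And>i. i \<in> elems N \<Longrightarrow> 1 \<le> L i \<and> L i \<le> local_dim N r i"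
    and "\<And>i j. i \<in> elems N \<Longrightarrow> L i \<le> j \<Longrightarrow> j < local_dim N r i \<Longrightarrow> lam i j > \<mu> i / 2"
    and "dual_nodes N r \<kappa> L \<psi> dn"
    and "distinct ns" and "set ns = nodes N r - N_aux N L dn"
    and "distinct \<xi>" and "set \<xi> = kernel_basis N r \<kappa> L \<psi> dn ns"
    and "f \<in> L2"
    and "galerkin_solution \<kappa> f (Vh N r) u_h"
    and "1 \<le> k"
    and "galerkin_solution \<kappa> f (V_ms N r \<kappa> L dn \<xi> k) u_k"
    and "2 * q ^ k * sqrt (real (\<Sum>i\<in>elems N. L i)) * sqrt (M_const N r \<kappa> L \<psi> dn) * sqrt \<beta> \<le> H\<^sup>2"
  shows "form_norm (a_form \<kappa>) (u_h - u_k) \<le> (C + 1) * H * L2_norm f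
       \<and> L2_norm (u_h - u_k) \<le> ((C + 1) * H)\<^sup>2 * L2_norm f"
proof -
  interpret coefficient \<kappa> \<beta> by (rule pw_const_coeff_coefficient) fact
  interpret ms_problem N r \<kappa> \<beta> lam \<psi> \<mu> L dn ns \<xi> k
    by unfold_locales fact+
  show ?thesis
    unfolding H_def C_def using assms(16-20) unfolding q_def H_def
    by (intro conjI energy_error L2_error)
qed

end
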